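(* Let $\delta\ge0$, $\lambda\ge0$, and let $G$ and the reduced objective $j:L^2(0,T)\to\mathbb{R}$, $$j(w)=\tfrac12\|\mathbf{u}-\mathbf{u}_d\|_{L^2(0,T;\mathbf{L}^2(\Omega))}^2+\tfrac12\|p-p_d\|_{L^2(0,T;L^2(\Omega))}^2+\tfrac{\lambda}{2}\|w\|_{L^2(0,T)}^2,\qquad (\mathbf{u},p)=Gw+(\tilde{\mathbf{u}},\tilde p),$$ be as described in the context. Then $j$ is twice continuously differentiable at every $\xi\in L^2(0,T)$. Moreover, $$|\nabla^2 j(w)(\xi,\varphi)|=|(G\xi,G\varphi)+\lambda(\xi,\varphi)|$$ and there exists $C>0$ such that $$|\nabla^2 j(w)(\xi,\varphi)|\le C\|\xi\|_{L^2(0,T)}\|\varphi\|_{L^2(0,T)}$$ for all $w\in L^2(0,T)$ and all $\xi,\varphi\in L^2(0,T)$. When $\lambda>0$, the following property does not hold: there is $C>0$ such that $|\nabla^2 j(w)(\psi,\phi)|\le C\|\psi\|_{L^1(0,T)}\|\phi\|_{L^1(0,T)}$ for all $w,\psi,\phi\in L^2(0,T)$.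
   Context: $T>0$; $\Omega\subset\mathbb{R}^3$ is a bounded Lipschitz domain with $\partial\Omega=\Gamma_D\cup\Gamma_N$, $\Gamma_D\cap\Gamma_N=\emptyset$, $\Gamma_D=\Gamma_{D,p}\cup\Gamma_{D,\mathbf{v}}$, where $\Gamma_D$ and $\Gamma_{D,p}$ have positive surface measure. Constants $\lambda_e,\mu_e,\lambda_v,\mu_v,k>0$. The (poroelastic for $\delta=0$, poroviscoelastic for $\delta>0$) system for displacement $\mathbf{u}$ and pressure $p$ is $$\nabla\cdot\mathbf{T}(\mathbf{u},p)+\mathbf{F}=\mathbf{0},\qquad (\nabla\cdot\mathbf{u})_t-\nabla\cdot(k\nabla p)=S\quad\text{in }\Omega\times(0,T),$$ with $\mathbf{T}(\mathbf{u},p)=\delta\mu_v(\nabla\mathbf{u}_t+\nabla\mathbf{u}_t^T)+\delta\lambda_v(\nabla\cdot\mathbf{u}_t)\mathbf{I}+\mu_e(\nabla\mathbf{u}+\nabla\mathbf{u}^T)+\lambda_e(\nabla\cdot\mathbf{u})\mathbf{I}-p\mathbf{I}$, boundary conditions (with $\mathbf{v}=-k\nabla p$, $\mathbf{n}$ the outward unit normal) $\mathbf{T}\mathbf{n}=\mathbf{g}$, $\mathbf{v}\cdot\mathbf{n}=0$ on $\Gamma_N$; $\mathbf{u}=\mathbf{0}$, $p=0$ on $\Gamma_{D,p}$; $\mathbf{u}=\mathbf{0}$, $\mathbf{v}\cdot\mathbf{n}=\psi$ on $\Gamma_{D,\mathbf{v}}$; and initial condition $\mathbf{u}(\cdot,0)=\mathbf{u}_0$.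 Let $\mathbf{V}=(H^1_{\Gamma_D}(\Omega))^3$ and $V=H^1_{\Gamma_{D,p}}(\Omega)$ ($H^1$ functions with zero trace on the indicated part of the boundary). Solutions are understood in the weak sense: $(\mathbf{u},p)\in L^2(0,T;\mathbf{V})\times L^2(0,T;V)$ (and $\mathbf{u}\in H^1(0,T;\mathbf{V})$ if $\delta>0$), obtained by testing the first equation with $\mathbf{z}\in\mathbf{V}$, i.e. for a.a. $t$, $\int_\Omega\mathbf{T}(\mathbf{u},p):\nabla\mathbf{z}\,dx=\int_\Omega\mathbf{F}\cdot\mathbf{z}\,dx+\int_{\Gamma_N}\mathbf{g}\cdot\mathbf{z}$, and the second with $q\in H^1(0,T;V)$, $q(T)=0$, i.e. $\int_0^T[-(\nabla\cdot\mathbf{u},q_t)+k(\nabla p,\nabla q)]dt=(\nabla\cdot\mathbf{u}_0,q(0))+\int_0^T[(S,q)-\int_{\Gamma_{D,\mathbf{v}}}\psi q]dt$ (with $\mathbf{u}(0)=\mathbf{u}_0$ if $\delta>0$). Known well-posedness (may be used): if $\mathbf{F}\in H^1(0,T;\mathbf{L}^2(\Omega))$, $\mathbf{g}\in H^1(0,T;\mathbf{H}^{1/2}(\Gamma_N))$ for $\delta=0$ (resp. $\mathbf{F}\in L^2(0,T;\mathbf{L}^2(\Omega))$, $\mathbf{g}\in L^2(0,T;\mathbf{H}^{1/2}(\Gamma_N))$ for $\delta>0$), $S\in L^2(0,T;L^2(\Omega))$, and $\psi(x,t)=w(t)\chi(x)$ with $w\in L^2(0,T)$, $\chi\in L^2(\Gamma_{D,\mathbf{v}})$,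 there is a unique weak solution, and $\int_0^T(\|p\|_V^2+\|\mathbf{u}\|_{\mathbf{V}}^2)dt$ is bounded by a constant times $$\|\mathbf{u}_0\|_{\mathbf{V}}+\|\mathbf{F}\|_{H^1(0,T;\mathbf{L}^2(\Omega))}^2+\|S\|_{L^2(0,T;L^2(\Omega))}^2+\|\mathbf{g}\|_{H^1(0,T;\mathbf{H}^{1/2}(\Gamma_N))}^2+\|\psi\|_{L^2(0,T;L^2(\Gamma_{D,\mathbf{v}}))}^2$$ for $\delta=0$, and by a constant times $$\|\mathbf{u}_0\|_{\mathbf{V}}+\|\mathbf{F}\|_{L^2(0,T;\mathbf{L}^2(\Omega))}^2+\|S\|_{L^2(0,T;L^2(\Omega))}^2+\|\mathbf{g}\|_{L^2(0,T;\mathbf{H}^{1/2}(\Gamma_N))}^2+\|\psi\|_{L^2(0,T;L^2(\Gamma_{D,\mathbf{v}}))}^2$$ for $\delta>0$. Control-to-state map: fix $\chi$ and let the control $w\in L^2(0,T)$ enter as $\chi(x)w(t)$ in place of either $S$ (with $\chi\in L^2(\Omega)$) or $\psi$ (with $\chi\in L^2(\Gamma_{D,\mathbf{v}})$). $G:L^2(0,T)\to L^2(0,T;\mathbf{L}^2(\Omega))\times L^2(0,T;L^2(\Omega))$ is the linear map sending $w$ to the unique weak solution $(\mathbf{u},p)$ with zero initial value and all sources zero except this one. $(\tilde{\mathbf{u}},\tilde p)$ is the weak solution for the given initial value and the other given sources with control $w=0$. $\mathbf{u}_d\in L^2(0,T;\mathbf{L}^2(\Omega))$ and $p_d\in L^2(0,T;L^2(\Omega))$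 are given. $(G\xi,G\varphi)$ is the inner product in $L^2(0,T;\mathbf{L}^2(\Omega))\times L^2(0,T;L^2(\Omega))$ and $(\xi,\varphi)$ that in $L^2(0,T)$. *)

theory Defs
  imports "HOL-Analysis.Analysis"
begin

section \<open>Square-integrable functions\<close>

definition L2_space :: "'a measure \<Rightarrow> ('a \<Rightarrow> 'b::euclidean_space) set" where
  "L2_space M = {f \<in> borel_measurable M. integrable M (\<lambda>x. (norm (f x))\<^sup>2)}"

definition L2_norm :: "'a measure \<Rightarrow> ('a \<Rightarrow> 'b::euclidean_space) \<Rightarrow> real" where
  "L2_norm M f = sqrt (LINT x|M. (norm (f x))\<^sup>2)"

definition L2_inner :: "'a measure \<Rightarrow> ('a \<Rightarrow> 'b::euclidean_space) \<Rightarrow> ('a \<Rightarrow> 'b) \<Rightarrow> real" where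
  "L2_inner M f g = (LINT x|M. f x \<bullet> g x)"

definition L2_converges ::
  "'a measure \<Rightarrow> (nat \<Rightarrow> 'a \<Rightarrow> 'b::euclidean_space) \<Rightarrow> ('a \<Rightarrow> 'b) \<Rightarrow> bool" where
  "L2_converges M fs f \<longleftrightarrow>
     (\<lambda>n. \<integral>\<^sup>+x. ennreal ((norm (fs n x - f x))\<^sup>2) \<partial>M) \<longlonglongrightarrow> 0"

abbreviation interval :: "real \<Rightarrow> real measure" where
  "interval T \<equiv> lebesgue_on {0<..<T}"

lemma L2_space_integrable_mult:
  fixes f g :: "'a \<Rightarrow> real"
  assumes "f \<in> L2_space M" "g \<in> L2_space M"
  shows "integrable M (\<lambda>x. f x * g x)"
proof (rule Bochner_Integration.integrable_bound)
  show "integrable M (\<lambda>x. (norm (f x))\<^sup>2 + (norm (g x))\<^sup>2)"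
    using assms by (auto simp: L2_space_def)
  show "(\<lambda>x. f x * g x) \<in> borel_measurable M"
    using assms by (auto simp: L2_space_def)
  have "\<bar>a * b\<bar> \<le> a\<^sup>2 + b\<^sup>2" for a b :: real
  proof -
    have "0 \<le> (\<bar>a\<bar> - \<bar>b\<bar>)\<^sup>2" by simp
    then have "2 * \<bar>a * b\<bar> \<le> a\<^sup>2 + b\<^sup>2" by (simp add: power2_diff abs_mult)
    moreover have "0 \<le> \<bar>a * b\<bar>" by simp
    ultimately show ?thesis by linarith
  qed
  then show "AE x in M. norm (f x * g x) \<le> norm ((norm (f x))\<^sup>2 + (norm (g x))\<^sup>2)"
    by (auto simp: abs_mult)
qed

lemma L2_space_add:
  fixes f g :: "'a \<Rightarrow> real"
  assumes "f \<in> L2_space M" "g \<in> L2_space M"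
  shows "(\<lambda>x. f x + g x) \<in> L2_space M"
proof -
  have "integrable M (\<lambda>x. (norm (f x))\<^sup>2 + (norm (g x))\<^sup>2 + 2 * (f x * g x))"
    using assms L2_space_integrable_mult[OF assms] by (auto simp: L2_space_def)
  moreover have "(\<lambda>x. (norm (f x))\<^sup>2 + (norm (g x))\<^sup>2 + 2 * (f x * g x))
      = (\<lambda>x. (norm (f x + g x))\<^sup>2)"
    by (auto simp: power2_eq_square algebra_simps)
  ultimately show ?thesis using assms by (auto simp: L2_space_def)
qed

lemma L2_space_scale:
  fixes f :: "'a \<Rightarrow> real"
  assumes "f \<in> L2_space M"
  shows "(\<lambda>x. c * f x) \<in> L2_space M"
  using assms by (auto simp: L2_space_def power_mult_distrib)

section \<open>The control space\<close>

text \<open>A type cannot depend on the term \<open>T\<close>. So the type below is the Hilbert space of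
  square-integrable functions on the whole real line modulo equality almost everywhere, and
  the space of square-integrable functions on \<open>(0,T)\<close> is its closed subspace
  \<open>control_space T\<close> of the classes vanishing outside \<open>(0,T)\<close>.  On it, the norm and inner product
  of the type are those of square-integrable functions on \<open>(0,T)\<close>.\<close>

definition l2_eq :: "(real \<Rightarrow> real) \<Rightarrow> (real \<Rightarrow> real) \<Rightarrow> bool" where
  "l2_eq f g \<longleftrightarrow> f \<in> L2_space lebesgue \<and> g \<in> L2_space lebesgue \<and> (AE x in lebesgue. f x = g x)"

quotient_type l2real = "real \<Rightarrow> real" / partial: l2_eq
proof (rule part_equivpI)
  show "\<exists>f. l2_eq f f"
    by (rule exI[of _ "\<lambda>_. 0"]) (simp add: l2_eq_def L2_space_def)
  show "symp l2_eq"
    by (auto simp: symp_def l2_eq_def)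
  show "transp l2_eq"
    by (auto simp: transp_def l2_eq_def elim: AE_mp)
qed

instantiation l2real :: real_inner
begin

lift_definition zero_l2real :: l2real is "\<lambda>_. 0"
  by (simp add: l2_eq_def L2_space_def)

lift_definition plus_l2real :: "l2real \<Rightarrow> l2real \<Rightarrow> l2real" is "\<lambda>f g x. f x + g x"
  by (auto simp: l2_eq_def intro!: L2_space_add)

lift_definition uminus_l2real :: "l2real \<Rightarrow> l2real" is "\<lambda>f x. - f x"
  by (auto simp: l2_eq_def L2_space_def)

lift_definition scaleR_l2real :: "real \<Rightarrow> l2real \<Rightarrow> l2real" is "\<lambda>c f x. c * f x"
  by (auto simp: l2_eq_def intro!: L2_space_scale)

lift_definition inner_l2real :: "l2real \<Rightarrow> l2real \<Rightarrow> real" is "L2_inner lebesgue"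
  unfolding L2_inner_def
  by (rule integral_cong_AE) (auto simp: l2_eq_def L2_space_def)

definition minus_l2real :: "l2real \<Rightarrow> l2real \<Rightarrow> l2real" where
  "minus_l2real x y = x + (- y)"

definition norm_l2real :: "l2real \<Rightarrow> real" where
  "norm_l2real x = sqrt (inner x x)"

definition dist_l2real :: "l2real \<Rightarrow> l2real \<Rightarrow> real" where
  "dist_l2real x y = norm (x - y)"

definition sgn_l2real :: "l2real \<Rightarrow> l2real" where
  "sgn_l2real x = inverse (norm x) *\<^sub>R x"

definition uniformity_l2real :: "(l2real \<times> l2real) filter" where
  "uniformity_l2real = (INF e\<in>{0 <..}. principal {(x, y). dist x y < e})"

definition open_l2real :: "l2real set \<Rightarrow> bool" where
  "open_l2real U \<longleftrightarrow> (\<forall>x\<in>U. eventually (\<lambda>(x', y). x' = x \<longrightarrow> y \<in> U) uniformity)"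

instance
proof
  fix x y z :: l2real and a b c :: real
  show "x + y + z = x + (y + z)"
    by transfer (auto simp: l2_eq_def add.assoc intro!: L2_space_add)
  show "x + y = y + x"
    by transfer (auto simp: l2_eq_def add.commute intro!: L2_space_add)
  show "0 + x = x"
    by transfer (auto simp: l2_eq_def)
  show "- x + x = 0"
    by transfer (auto simp: l2_eq_def L2_space_def)
  show "x - y = x + - y"
    by (rule minus_l2real_def)
  show "a *\<^sub>R (x + y) = a *\<^sub>R x + a *\<^sub>R y"
    by transfer (auto simp: l2_eq_def distrib_left intro!: L2_space_add L2_space_scale)
  show "(a + b) *\<^sub>R x = a *\<^sub>R x + b *\<^sub>R x"
    by transfer (auto simp: l2_eq_def distrib_right intro!: L2_space_add L2_space_scale
        simp flip: distrib_right)
  show "a *\<^sub>R b *\<^sub>R x = (a * b) *\<^sub>R x"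
    by transfer (auto simp: l2_eq_def mult.assoc intro!: L2_space_scale simp flip: mult.assoc)
  show "1 *\<^sub>R x = x"
    by transfer (auto simp: l2_eq_def)
  show "dist x y = norm (x - y)"
    by (rule dist_l2real_def)
  show "sgn x = inverse (norm x) *\<^sub>R x"
    by (rule sgn_l2real_def)
  show "uniformity = (INF e\<in>{0 <..}. principal {(x :: l2real, y). dist x y < e})"
    by (rule uniformity_l2real_def)
  show "open U \<longleftrightarrow> (\<forall>x\<in>U. eventually (\<lambda>(x', y). x' = x \<longrightarrow> y \<in> U) uniformity)"
    for U :: "l2real set"
    by (rule open_l2real_def)
  show "x \<bullet> y = y \<bullet> x"
    by transfer (auto simp: L2_inner_def mult.commute)
  show "(x + y) \<bullet> z = x \<bullet> z + y \<bullet> z"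
    by transfer
      (auto simp: L2_inner_def l2_eq_def distrib_right L2_space_integrable_mult)
  show "(a *\<^sub>R x) \<bullet> y = a * (x \<bullet> y)"
    by transfer (auto simp: L2_inner_def mult.assoc)
  show "0 \<le> x \<bullet> x"
    by transfer (auto simp: L2_inner_def)
  show "x \<bullet> x = 0 \<longleftrightarrow> x = 0"
  proof transfer
    fix f :: "real \<Rightarrow> real" assume "l2_eq f f"
    then have f: "f \<in> L2_space lebesgue" by (simp add: l2_eq_def)
    have "L2_inner lebesgue f f = 0 \<longleftrightarrow> (AE x in lebesgue. f x * f x = 0)"
      unfolding L2_inner_def inner_real_def
      by (rule integral_nonneg_eq_0_iff_AE[OF L2_space_integrable_mult[OF f f]]) auto
    then show "L2_inner lebesgue f f = 0 \<longleftrightarrow> l2_eq f (\<lambda>_. 0)"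
      using f by (auto simp: l2_eq_def L2_space_def)
  qed
  show "norm x = sqrt (x \<bullet> x)"
    by (rule norm_l2real_def)
qed

end

definition control_space :: "real \<Rightarrow> l2real set" where
  "control_space T = {w. AE t in lebesgue. t \<notin> {0<..<T} \<longrightarrow> rep_l2real w t = 0}"

definition L1_norm :: "real \<Rightarrow> l2real \<Rightarrow> real" where
  "L1_norm T w = (LINT t|interval T. \<bar>rep_l2real w t\<bar>)"

section \<open>Bochner spaces\<close>

text \<open>The space of values is a set \<open>X\<close> of functions (representatives) together with a
  seminorm \<open>N\<close>.  Strong measurability is pointwise a.e. approximability by simple functions.\<close>

definition bochner_L2 ::
  "real \<Rightarrow> ('x \<Rightarrow> 'b::euclidean_space) set \<Rightarrow> (('x \<Rightarrow> 'b) \<Rightarrow> real) \<Rightarrow> (real \<Rightarrow> 'x \<Rightarrow> 'b) set"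
where
  "bochner_L2 T X N = {f.
     (AE t in interval T. f t \<in> X) \<and>
     (\<exists>s. (\<forall>n. simple_function (interval T) (s n) \<and> s n ` {0<..<T} \<subseteq> X) \<and>
          (AE t in interval T. (\<lambda>n. N (\<lambda>x. f t x - s n t x)) \<longlonglongrightarrow> 0)) \<and>
     integrable (interval T) (\<lambda>t. (N (f t))\<^sup>2)}"

definition bochner_norm ::
  "real \<Rightarrow> (('x \<Rightarrow> 'b::euclidean_space) \<Rightarrow> real) \<Rightarrow> (real \<Rightarrow> 'x \<Rightarrow> 'b) \<Rightarrow> real" where
  "bochner_norm T N f = sqrt (LINT t|interval T. (N (f t))\<^sup>2)"

text \<open>For a simple function \<open>s\<close>, the Bochner integral is a finite linear combination of its
  values, so it can be evaluated pointwise in \<open>x\<close>.\<close>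

definition has_bochner_value ::
  "real \<Rightarrow> ('x \<Rightarrow> 'b::euclidean_space) set \<Rightarrow> (('x \<Rightarrow> 'b) \<Rightarrow> real) \<Rightarrow>
   (real \<Rightarrow> 'x \<Rightarrow> 'b) \<Rightarrow> ('x \<Rightarrow> 'b) \<Rightarrow> bool" where
  "has_bochner_value T X N f I \<longleftrightarrow>
     (AE t in interval T. f t \<in> X) \<and> I \<in> X \<and>
     (\<exists>s. (\<forall>n. simple_function (interval T) (s n) \<and> s n ` {0<..<T} \<subseteq> X \<and>
               integrable (interval T) (\<lambda>t. N (\<lambda>x. f t x - s n t x))) \<and>
          (\<lambda>n. LINT t|interval T. N (\<lambda>x. f t x - s n t x)) \<longlonglongrightarrow> 0 \<and>
          (\<lambda>n. N (\<lambda>x. (LINT t|interval T. s n t x) - I x)) \<longlonglongrightarrow> 0)"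

text \<open>For weak derivatives, continuously differentiable test functions are equivalent to smooth
  ones.  \<open>test_fun U \<phi> d\<phi>\<close>: \<open>\<phi>\<close> is continuously differentiable with gradient \<open>d\<phi>\<close> and has
  compact support in \<open>U\<close>.\<close>

definition test_fun ::
  "'a::euclidean_space set \<Rightarrow> ('a \<Rightarrow> real) \<Rightarrow> ('a \<Rightarrow> 'a) \<Rightarrow> bool" where
  "test_fun U \<phi> d\<phi> \<longleftrightarrow>
     (\<forall>x. (\<phi> has_derivative (\<lambda>h. d\<phi> x \<bullet> h)) (at x)) \<and> continuous_on UNIV d\<phi> \<and>
     (\<exists>K. compact K \<and> K \<subseteq> U \<and> (\<forall>x. x \<notin> K \<longrightarrow> \<phi> x = 0))"

text \<open>\<open>f\<close> belongs to \<open>H\<^sup>1(0,T;X)\<close>, with weak time derivative \<open>f'\<close>.\<close>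

definition has_time_deriv ::
  "real \<Rightarrow> ('x \<Rightarrow> 'b::euclidean_space) set \<Rightarrow> (('x \<Rightarrow> 'b) \<Rightarrow> real) \<Rightarrow>
   (real \<Rightarrow> 'x \<Rightarrow> 'b) \<Rightarrow> (real \<Rightarrow> 'x \<Rightarrow> 'b) \<Rightarrow> bool" where
  "has_time_deriv T X N f f' \<longleftrightarrow>
     f \<in> bochner_L2 T X N \<and> f' \<in> bochner_L2 T X N \<and>
     (\<forall>\<phi> d\<phi>. test_fun {0<..<T} \<phi> d\<phi> \<longrightarrow>
        (\<exists>I. has_bochner_value T X N (\<lambda>t x. d\<phi> t *\<^sub>R f t x) I \<and>
             has_bochner_value T X N (\<lambda>t x. \<phi> t *\<^sub>R f' t x) (\<lambda>x. - I x)))"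

definition bochner_H1 ::
  "real \<Rightarrow> ('x \<Rightarrow> 'b::euclidean_space) set \<Rightarrow> (('x \<Rightarrow> 'b) \<Rightarrow> real) \<Rightarrow> (real \<Rightarrow> 'x \<Rightarrow> 'b) set"
where
  "bochner_H1 T X N = {f. \<exists>f'. has_time_deriv T X N f f'}"

definition bochner_H1_norm ::
  "real \<Rightarrow> ('x \<Rightarrow> 'b::euclidean_space) set \<Rightarrow> (('x \<Rightarrow> 'b) \<Rightarrow> real) \<Rightarrow> (real \<Rightarrow> 'x \<Rightarrow> 'b) \<Rightarrow> real"
where
  "bochner_H1_norm T X N f =
     sqrt ((bochner_norm T N f)\<^sup>2 + (bochner_norm T N (SOME f'. has_time_deriv T X N f f'))\<^sup>2)"

text \<open>The value at \<open>t \<in> [0,T]\<close> of the continuous representative of \<open>f\<close>.\<close>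

definition has_time_value ::
  "real \<Rightarrow> ('x \<Rightarrow> 'b::euclidean_space) set \<Rightarrow> (('x \<Rightarrow> 'b) \<Rightarrow> real) \<Rightarrow>
   (real \<Rightarrow> 'x \<Rightarrow> 'b) \<Rightarrow> real \<Rightarrow> ('x \<Rightarrow> 'b) \<Rightarrow> bool" where
  "has_time_value T X N f t y \<longleftrightarrow> y \<in> X \<and>
     (\<exists>g. (\<forall>s\<in>{0..T}. g s \<in> X \<and>
             ((\<lambda>r. N (\<lambda>x. g r x - g s x)) \<longlongrightarrow> 0) (at s within {0..T})) \<and>
          (AE s in interval T. f s \<in> X \<and> N (\<lambda>x. f s x - g s x) = 0) \<and>
          N (\<lambda>x. g t x - y x) = 0)"

section \<open>Lipschitz domains and surface measure\<close>

definition lipschitz_domain :: "'a::euclidean_space set \<Rightarrow> bool" where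
  "lipschitz_domain U \<longleftrightarrow> open U \<and> connected U \<and> U \<noteq> {} \<and>
     (\<forall>x\<in>frontier U. \<exists>r>0. \<exists>e \<gamma> L. norm e = 1 \<and> L-lipschitz_on {z. z \<bullet> e = 0} \<gamma> \<and>
        U \<inter> ball x r = {y \<in> ball x r. \<gamma> (y - (y \<bullet> e) *\<^sub>R e) < y \<bullet> e})"

text \<open>Two-dimensional Hausdorff outer measure, normalised (factor \<open>\<pi>/4\<close>) to agree with surface
  area.  By Caratheodory's criterion it is countably additive on Borel sets, so that the
  \<open>measure_of\<close> below is not degenerate.\<close>

definition hausdorff2 :: "(real^3) set \<Rightarrow> ennreal" where
  "hausdorff2 A =
     (SUP d\<in>{0::real<..}.
        INF U\<in>{U::nat \<Rightarrow> (real^3) set.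
                A \<subseteq> (\<Union>i. U i) \<and> (\<forall>i. bounded (U i) \<and> diameter (U i) \<le> d)}.
          \<Sum>i. ennreal (pi / 4 * (diameter (U i))\<^sup>2))"

definition surface :: "(real^3) set \<Rightarrow> (real^3) measure" where
  "surface \<Gamma> = restrict_space (measure_of UNIV (sets borel) hausdorff2) \<Gamma>"

section \<open>Sobolev spaces and traces\<close>

text \<open>\<open>G x $ i\<close> is the \<open>i\<close>-th weak partial derivative; thus for a vector field \<open>v\<close> the matrix
  entry \<open>G x $ i $ j\<close> is \<open>\<partial>\<^sub>i v\<^sub>j\<close>.\<close>

definition has_weak_grad ::
  "(real^3) set \<Rightarrow> (real^3 \<Rightarrow> 'b::euclidean_space) \<Rightarrow> (real^3 \<Rightarrow> 'b^3) \<Rightarrow> bool" where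
  "has_weak_grad \<Omega> v G \<longleftrightarrow>
     v \<in> L2_space (lebesgue_on \<Omega>) \<and> G \<in> L2_space (lebesgue_on \<Omega>) \<and>
     (\<forall>\<phi> d\<phi> i. test_fun \<Omega> \<phi> d\<phi> \<longrightarrow>
        (LINT x|lebesgue_on \<Omega>. (d\<phi> x $ i) *\<^sub>R v x) = - (LINT x|lebesgue_on \<Omega>. \<phi> x *\<^sub>R (G x $ i)))"

definition H1 :: "(real^3) set \<Rightarrow> (real^3 \<Rightarrow> 'b::euclidean_space) set" where
  "H1 \<Omega> = {v. \<exists>G. has_weak_grad \<Omega> v G}"

definition wgrad :: "(real^3) set \<Rightarrow> (real^3 \<Rightarrow> 'b::euclidean_space) \<Rightarrow> real^3 \<Rightarrow> 'b^3" where
  "wgrad \<Omega> v = (SOME G. has_weak_grad \<Omega> v G)"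

definition wdiv :: "(real^3) set \<Rightarrow> (real^3 \<Rightarrow> real^3) \<Rightarrow> real^3 \<Rightarrow> real" where
  "wdiv \<Omega> v x = trace (wgrad \<Omega> v x)"

definition H1_norm :: "(real^3) set \<Rightarrow> (real^3 \<Rightarrow> 'b::euclidean_space) \<Rightarrow> real" where
  "H1_norm \<Omega> v =
     sqrt ((L2_norm (lebesgue_on \<Omega>) v)\<^sup>2 + (L2_norm (lebesgue_on \<Omega>) (wgrad \<Omega> v))\<^sup>2)"

text \<open>The trace operator is the continuous extension of the restriction to the boundary of
  functions that are continuously differentiable up to the boundary.\<close>

definition is_bdry_trace ::
  "(real^3) set \<Rightarrow> (real^3 \<Rightarrow> 'b::euclidean_space) \<Rightarrow> (real^3 \<Rightarrow> 'b) \<Rightarrow> bool" where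
  "is_bdry_trace \<Omega> v g \<longleftrightarrow>
     v \<in> H1 \<Omega> \<and> g \<in> L2_space (surface (frontier \<Omega>)) \<and>
     (\<exists>vs Ds.
        (\<forall>n x. (vs n has_derivative (\<lambda>h. \<Sum>i\<in>UNIV. (h $ i) *\<^sub>R (Ds n x $ i))) (at x)) \<and>
        (\<forall>n. continuous_on UNIV (Ds n)) \<and>
        L2_converges (lebesgue_on \<Omega>) vs v \<and>
        L2_converges (lebesgue_on \<Omega>) Ds (wgrad \<Omega> v) \<and>
        L2_converges (surface (frontier \<Omega>)) vs g)"

definition bdry_trace ::
  "(real^3) set \<Rightarrow> (real^3 \<Rightarrow> 'b::euclidean_space) \<Rightarrow> real^3 \<Rightarrow> 'b" where
  "bdry_trace \<Omega> v = (SOME g. is_bdry_trace \<Omega> v g)"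

definition H1_zero ::
  "(real^3) set \<Rightarrow> (real^3) set \<Rightarrow> (real^3 \<Rightarrow> 'b::euclidean_space) set" where
  "H1_zero \<Omega> \<Gamma> = {v \<in> H1 \<Omega>. \<exists>g. is_bdry_trace \<Omega> v g \<and>
     (AE x in surface (frontier \<Omega>). x \<in> \<Gamma> \<longrightarrow> g x = 0)}"

text \<open>\<open>H\<^sup>1\<^sup>/\<^sup>2\<close> on the two-dimensional surface \<open>\<Gamma>\<close>, with the Sobolev-Slobodeckij norm: the
  exponent 3 is the dimension 2 plus twice the smoothness 1/2.\<close>

definition Hhalf_sq :: "(real^3) set \<Rightarrow> (real^3 \<Rightarrow> 'b::euclidean_space) \<Rightarrow> ennreal" where
  "Hhalf_sq \<Gamma> g =
     (\<integral>\<^sup>+x. ennreal ((norm (g x))\<^sup>2) \<partial>surface \<Gamma>) +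
     (\<integral>\<^sup>+x. (\<integral>\<^sup>+y. ennreal ((norm (g x - g y))\<^sup>2 / (norm (x - y))^3) \<partial>surface \<Gamma>) \<partial>surface \<Gamma>)"

definition Hhalf :: "(real^3) set \<Rightarrow> (real^3 \<Rightarrow> 'b::euclidean_space) set" where
  "Hhalf \<Gamma> = {g \<in> borel_measurable (surface \<Gamma>). Hhalf_sq \<Gamma> g < \<infinity>}"

definition Hhalf_norm :: "(real^3) set \<Rightarrow> (real^3 \<Rightarrow> 'b::euclidean_space) \<Rightarrow> real" where
  "Hhalf_norm \<Gamma> g = sqrt (enn2real (Hhalf_sq \<Gamma> g))"

section \<open>The poro(visco)elastic system\<close>

record poro =
  Om :: "(real^3) set"
  T_end :: real
  Gam_D :: "(real^3) set"
  Gam_N :: "(real^3) set"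
  Gam_Dp :: "(real^3) set"
  Gam_Dv :: "(real^3) set"
  lam_e :: real
  mu_e :: real
  lam_v :: real
  mu_v :: real
  perm :: real

definition poro_setting :: "poro \<Rightarrow> bool" where
  "poro_setting P \<longleftrightarrow>
     0 < T_end P \<and> bounded (Om P) \<and> lipschitz_domain (Om P) \<and>
     frontier (Om P) = Gam_D P \<union> Gam_N P \<and> Gam_D P \<inter> Gam_N P = {} \<and>
     Gam_D P = Gam_Dp P \<union> Gam_Dv P \<and>
     Gam_D P \<in> sets borel \<and> Gam_N P \<in> sets borel \<and> Gam_Dp P \<in> sets borel \<and> Gam_Dv P \<in> sets borel \<and>
     0 < emeasure (surface (frontier (Om P))) (Gam_D P) \<and>
     0 < emeasure (surface (frontier (Om P))) (Gam_Dp P) \<and>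
     0 < lam_e P \<and> 0 < mu_e P \<and> 0 < lam_v P \<and> 0 < mu_v P \<and> 0 < perm P"

definition disp_space :: "poro \<Rightarrow> (real^3 \<Rightarrow> real^3) set" where
  "disp_space P = H1_zero (Om P) (Gam_D P)"

definition pres_space :: "poro \<Rightarrow> (real^3 \<Rightarrow> real) set" where
  "pres_space P = H1_zero (Om P) (Gam_Dp P)"

definition stress ::
  "poro \<Rightarrow> real \<Rightarrow> (real^3 \<Rightarrow> real^3) \<Rightarrow> (real^3 \<Rightarrow> real^3) \<Rightarrow> (real^3 \<Rightarrow> real) \<Rightarrow> real^3 \<Rightarrow> real^3^3"
where
  "stress P \<delta> u ut p x =
     (\<delta> * mu_v P) *\<^sub>R (wgrad (Om P) ut x + transpose (wgrad (Om P) ut x))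
     + (\<delta> * lam_v P * wdiv (Om P) ut x) *\<^sub>R mat 1
     + mu_e P *\<^sub>R (wgrad (Om P) u x + transpose (wgrad (Om P) u x))
     + (lam_e P * wdiv (Om P) u x) *\<^sub>R mat 1
     - p x *\<^sub>R mat 1"

text \<open>On matrices, \<open>\<bullet>\<close> is the Frobenius product.  For \<open>\<delta> = 0\<close> the field \<open>ut\<close> is unconstrained,
  but \<open>stress\<close> does not depend on it.  The integrability required in the second equation only
  ensures that its integrals are genuine; it holds automatically (for the surface term, by the
  trace theorem).\<close>

definition weak_solution ::
  "poro \<Rightarrow> real \<Rightarrow> (real^3 \<Rightarrow> real^3) \<Rightarrow> (real \<Rightarrow> real^3 \<Rightarrow> real^3) \<Rightarrow> (real \<Rightarrow> real^3 \<Rightarrow> real) \<Rightarrow>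
   (real \<Rightarrow> real^3 \<Rightarrow> real^3) \<Rightarrow> (real \<Rightarrow> real^3 \<Rightarrow> real) \<Rightarrow>
   (real \<Rightarrow> real^3 \<Rightarrow> real^3) \<Rightarrow> (real \<Rightarrow> real^3 \<Rightarrow> real) \<Rightarrow> bool" where
  "weak_solution P \<delta> u0 F S g \<psi> u p \<longleftrightarrow>
     u \<in> bochner_L2 (T_end P) (disp_space P) (H1_norm (Om P)) \<and>
     p \<in> bochner_L2 (T_end P) (pres_space P) (H1_norm (Om P)) \<and>
     (\<exists>ut.
        (\<delta> > 0 \<longrightarrow>
           has_time_deriv (T_end P) (disp_space P) (H1_norm (Om P)) u ut \<and>
           has_time_value (T_end P) (disp_space P) (H1_norm (Om P)) u 0 u0) \<and>
        (AE t in interval (T_end P). \<forall>z\<in>disp_space P.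
           (LINT x|lebesgue_on (Om P). stress P \<delta> (u t) (ut t) (p t) x \<bullet> wgrad (Om P) z x)
           = (LINT x|lebesgue_on (Om P). F t x \<bullet> z x)
             + (LINT x|surface (Gam_N P). g t x \<bullet> bdry_trace (Om P) z x))) \<and>
     (\<forall>q qt q0.
        has_time_deriv (T_end P) (pres_space P) (H1_norm (Om P)) q qt \<and>
        has_time_value (T_end P) (pres_space P) (H1_norm (Om P)) q (T_end P) (\<lambda>_. 0) \<and>
        has_time_value (T_end P) (pres_space P) (H1_norm (Om P)) q 0 q0 \<longrightarrow>
        (let lhs = \<lambda>t. - L2_inner (lebesgue_on (Om P)) (wdiv (Om P) (u t)) (qt t)
                 + perm P * L2_inner (lebesgue_on (Om P)) (wgrad (Om P) (p t)) (wgrad (Om P) (q t));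
             rhs = \<lambda>t. L2_inner (lebesgue_on (Om P)) (S t) (q t)
                 - (LINT x|surface (Gam_Dv P). \<psi> t x * bdry_trace (Om P) (q t) x)
         in integrable (interval (T_end P)) lhs \<and> integrable (interval (T_end P)) rhs \<and>
            (LINT t|interval (T_end P). lhs t)
            = L2_inner (lebesgue_on (Om P)) (wdiv (Om P) u0) q0 + (LINT t|interval (T_end P). rhs t)))"

definition F_space :: "poro \<Rightarrow> real \<Rightarrow> (real \<Rightarrow> real^3 \<Rightarrow> real^3) set" where
  "F_space P \<delta> = (if \<delta> = 0 then bochner_H1 else bochner_L2)
     (T_end P) (L2_space (lebesgue_on (Om P))) (L2_norm (lebesgue_on (Om P)))"

definition F_norm :: "poro \<Rightarrow> real \<Rightarrow> (real \<Rightarrow> real^3 \<Rightarrow> real^3) \<Rightarrow> real" where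
  "F_norm P \<delta> F =
     (if \<delta> = 0
      then bochner_H1_norm (T_end P) (L2_space (lebesgue_on (Om P))) (L2_norm (lebesgue_on (Om P))) F
      else bochner_norm (T_end P) (L2_norm (lebesgue_on (Om P))) F)"

definition g_space :: "poro \<Rightarrow> real \<Rightarrow> (real \<Rightarrow> real^3 \<Rightarrow> real^3) set" where
  "g_space P \<delta> = (if \<delta> = 0 then bochner_H1 else bochner_L2)
     (T_end P) (Hhalf (Gam_N P)) (Hhalf_norm (Gam_N P))"

definition g_norm :: "poro \<Rightarrow> real \<Rightarrow> (real \<Rightarrow> real^3 \<Rightarrow> real^3) \<Rightarrow> real" where
  "g_norm P \<delta> g =
     (if \<delta> = 0 then bochner_H1_norm (T_end P) (Hhalf (Gam_N P)) (Hhalf_norm (Gam_N P)) g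
      else bochner_norm (T_end P) (Hhalf_norm (Gam_N P)) g)"

definition L2L2 :: "poro \<Rightarrow> (real \<Rightarrow> real^3 \<Rightarrow> 'b::euclidean_space) set" where
  "L2L2 P = bochner_L2 (T_end P) (L2_space (lebesgue_on (Om P))) (L2_norm (lebesgue_on (Om P)))"

definition L2L2_norm :: "poro \<Rightarrow> (real \<Rightarrow> real^3 \<Rightarrow> 'b::euclidean_space) \<Rightarrow> real" where
  "L2L2_norm P = bochner_norm (T_end P) (L2_norm (lebesgue_on (Om P)))"

definition L2L2_inner ::
  "poro \<Rightarrow> (real \<Rightarrow> real^3 \<Rightarrow> 'b::euclidean_space) \<Rightarrow> (real \<Rightarrow> real^3 \<Rightarrow> 'b) \<Rightarrow> real" where
  "L2L2_inner P f g = (LINT t|interval (T_end P). L2_inner (lebesgue_on (Om P)) (f t) (g t))"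

text \<open>The known well-posedness theorem for the data of the problem \<open>P\<close>.  The norm of \<open>u0\<close> enters
  squared: the left-hand side is quadratic, so by scaling the bound cannot hold with the
  first power and a constant independent of the data.\<close>

definition well_posed :: "poro \<Rightarrow> real \<Rightarrow> bool" where
  "well_posed P \<delta> \<longleftrightarrow> (\<exists>C>0. \<forall>u0 F S g w \<eta>.
     u0 \<in> disp_space P \<and> F \<in> F_space P \<delta> \<and> S \<in> L2L2 P \<and> g \<in> g_space P \<delta> \<and>
     w \<in> L2_space (interval (T_end P)) \<and> \<eta> \<in> L2_space (surface (Gam_Dv P)) \<longrightarrow>
     (\<exists>u p. weak_solution P \<delta> u0 F S g (\<lambda>t x. w t * \<eta> x) u p \<and>
        (\<forall>u' p'. weak_solution P \<delta> u0 F S g (\<lambda>t x. w t * \<eta> x) u' p' \<longrightarrow>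
           (AE t in interval (T_end P). AE x in lebesgue_on (Om P). u' t x = u t x \<and> p' t x = p t x)) \<and>
        (LINT t|interval (T_end P). (H1_norm (Om P) (p t))\<^sup>2 + (H1_norm (Om P) (u t))\<^sup>2)
        \<le> C * ((H1_norm (Om P) u0)\<^sup>2 + (F_norm P \<delta> F)\<^sup>2 + (L2L2_norm P S)\<^sup>2 + (g_norm P \<delta> g)\<^sup>2
               + (bochner_norm (T_end P) (L2_norm (surface (Gam_Dv P))) (\<lambda>t x. w t * \<eta> x))\<^sup>2)))"

section \<open>The control problem\<close>

datatype control_kind = Source_control | Flux_control

definition control_profile :: "poro \<Rightarrow> control_kind \<Rightarrow> (real^3 \<Rightarrow> real) set" where
  "control_profile P kind = (case kind of
       Source_control \<Rightarrow> L2_space (lebesgue_on (Om P))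
     | Flux_control \<Rightarrow> L2_space (surface (Gam_Dv P)))"

text \<open>\<open>with_control kind f S \<psi>\<close> is the pair of source and boundary flux in which \<open>f\<close> takes the
  place of the controlled one.\<close>

definition with_control ::
  "control_kind \<Rightarrow> (real \<Rightarrow> real^3 \<Rightarrow> real) \<Rightarrow> (real \<Rightarrow> real^3 \<Rightarrow> real) \<Rightarrow> (real \<Rightarrow> real^3 \<Rightarrow> real) \<Rightarrow>
   (real \<Rightarrow> real^3 \<Rightarrow> real) \<times> (real \<Rightarrow> real^3 \<Rightarrow> real)" where
  "with_control kind f S \<psi> = (case kind of Source_control \<Rightarrow> (f, \<psi>) | Flux_control \<Rightarrow> (S, f))"

definition controlled_solution ::
  "poro \<Rightarrow> real \<Rightarrow> control_kind \<Rightarrow> (real^3 \<Rightarrow> real) \<Rightarrow> (real \<Rightarrow> real) \<Rightarrow>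
   (real^3 \<Rightarrow> real^3) \<Rightarrow> (real \<Rightarrow> real^3 \<Rightarrow> real^3) \<Rightarrow> (real \<Rightarrow> real^3 \<Rightarrow> real) \<Rightarrow>
   (real \<Rightarrow> real^3 \<Rightarrow> real^3) \<Rightarrow> (real \<Rightarrow> real^3 \<Rightarrow> real) \<Rightarrow>
   (real \<Rightarrow> real^3 \<Rightarrow> real^3) \<Rightarrow> (real \<Rightarrow> real^3 \<Rightarrow> real) \<Rightarrow> bool" where
  "controlled_solution P \<delta> kind \<eta> w u0 F S g \<psi> u p \<longleftrightarrow>
     (case with_control kind (\<lambda>t x. w t * \<eta> x) S \<psi> of
        (S', \<psi>') \<Rightarrow> weak_solution P \<delta> u0 F S' g \<psi>' u p)"

text \<open>\<open>SOME\<close> selects a representative of the solution, which is unique almost everywhere.\<close>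

definition solution_op ::
  "poro \<Rightarrow> real \<Rightarrow> control_kind \<Rightarrow> (real^3 \<Rightarrow> real) \<Rightarrow> l2real \<Rightarrow>
   (real \<Rightarrow> real^3 \<Rightarrow> real^3) \<times> (real \<Rightarrow> real^3 \<Rightarrow> real)" where
  "solution_op P \<delta> kind \<eta> w = (SOME (u, p).
     controlled_solution P \<delta> kind \<eta> (rep_l2real w)
       (\<lambda>_. 0) (\<lambda>_ _. 0) (\<lambda>_ _. 0) (\<lambda>_ _. 0) (\<lambda>_ _. 0) u p)"

definition state_inner ::
  "poro \<Rightarrow> (real \<Rightarrow> real^3 \<Rightarrow> real^3) \<times> (real \<Rightarrow> real^3 \<Rightarrow> real) \<Rightarrow>
   (real \<Rightarrow> real^3 \<Rightarrow> real^3) \<times> (real \<Rightarrow> real^3 \<Rightarrow> real) \<Rightarrow> real" where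
  "state_inner P y z = L2L2_inner P (fst y) (fst z) + L2L2_inner P (snd y) (snd z)"

definition reduced_objective ::
  "poro \<Rightarrow> real \<Rightarrow> real \<Rightarrow> control_kind \<Rightarrow> (real^3 \<Rightarrow> real) \<Rightarrow>
   (real \<Rightarrow> real^3 \<Rightarrow> real^3) \<Rightarrow> (real \<Rightarrow> real^3 \<Rightarrow> real) \<Rightarrow>
   (real \<Rightarrow> real^3 \<Rightarrow> real^3) \<Rightarrow> (real \<Rightarrow> real^3 \<Rightarrow> real) \<Rightarrow> l2real \<Rightarrow> real" where
  "reduced_objective P \<delta> lam kind \<eta> u_tilde p_tilde u_d p_d w =
     (let (Gu, Gp) = solution_op P \<delta> kind \<eta> w;
          u = \<lambda>t x. Gu t x + u_tilde t x;
          p = \<lambda>t x. Gp t x + p_tilde t x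
      in 1/2 * (L2L2_norm P (\<lambda>t x. u t x - u_d t x))\<^sup>2
         + 1/2 * (L2L2_norm P (\<lambda>t x. p t x - p_d t x))\<^sup>2
         + lam/2 * (norm w)\<^sup>2)"

text \<open>For a subspace \<open>H\<close>, these are the Frechet derivatives of \<open>j\<close> as a function on \<open>H\<close>: only the
  restrictions of \<open>j' w\<close> to \<open>H\<close> and of \<open>j'' w\<close> to \<open>H \<times> H\<close> are determined (uniquely) by \<open>j\<close>.  If
  \<open>H\<close> is a closed subspace of a Hilbert space, derivatives on \<open>H\<close> extend to the whole space by
  composition with the orthogonal projection.\<close>

definition twice_cont_diff_on ::
  "'h::real_normed_vector set \<Rightarrow> ('h \<Rightarrow> real) \<Rightarrow> ('h \<Rightarrow> 'h \<Rightarrow>\<^sub>L real) \<Rightarrow>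
   ('h \<Rightarrow> 'h \<Rightarrow>\<^sub>L 'h \<Rightarrow>\<^sub>L real) \<Rightarrow> bool" where
  "twice_cont_diff_on H j j' j'' \<longleftrightarrow>
     (\<forall>w\<in>H. (j has_derivative blinfun_apply (j' w)) (at w within H)) \<and>
     (\<forall>w\<in>H. (j' has_derivative blinfun_apply (j'' w)) (at w within H)) \<and>
     continuous_on H j''"

end

theory Submission
  imports Defs
begin

text \<open>The solution operator \<open>G\<close> is linear, because weak solutions can be superposed and are
  unique, and it is bounded by the a priori estimate. Hence \<open>j\<close> is a quadratic
  functional on a Hilbert space whose second derivative is the constant bilinear form
  \<open>(G \<xi>, G \<phi>) + lam (\<xi>, \<phi>)\<close>. For \<open>lam > 0\<close> the pulses \<open>indicator (0,h)\<close> refute a bound by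
  \<open>L\<^sup>1\<close>-norms: on them the form is at least \<open>lam h\<close>, while the product of the norms is \<open>h\<^sup>2\<close>.

  Superposition rests on the linearity of the weak gradient up to null sets, that is, on the fundamental
  lemma of the calculus of variations. It is proved by approximating indicators of boxes by
  products of one-dimensional continuously differentiable ramps.\<close>

section \<open>The fundamental lemma of the calculus of variations\<close>

text \<open>Every space here consists of representatives, and \<open>wgrad\<close>,
  \<open>solution_op\<close> and \<open>rep_l2real\<close> pick them by choice. None of these is
  known to be linear pointwise: the gradient of a sum, the solution for a sum of controls and the
  representative of a sum of controls agree with the sums only up to null sets. Linearity of the
  solution operator is therefore stated after pairing with a state in \<open>state_inner\<close>,
  which does not see null sets and which is how \<open>j\<close> sees the operator. The second
  obstacle is measurability in time: strong measurability yields measurable norms, and inner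
  products have to be recovered from norms by polarisation. Superposition keeps the test functions
  fixed, so the boundary trace of a test function enters only as a fixed factor of the
  control.\<close>

definition cont_grad :: "('a::euclidean_space \<Rightarrow> real) \<Rightarrow> ('a \<Rightarrow> 'a) \<Rightarrow> bool" where
  "cont_grad \<phi> d\<phi> \<longleftrightarrow>
     (\<forall>x. (\<phi> has_derivative (\<lambda>h. d\<phi> x \<bullet> h)) (at x)) \<and> continuous_on UNIV d\<phi>"

lemma cont_grad_continuous: "cont_grad \<phi> d\<phi> \<Longrightarrow> continuous_on UNIV \<phi>"
  unfolding cont_grad_def
  by (intro continuous_at_imp_continuous_on ballI) (blast intro: has_derivative_continuous)

lemma cont_grad_mult:
  assumes "cont_grad \<phi> d\<phi>" "cont_grad \<psi> d\<psi>"
  shows "cont_grad (\<lambda>x. \<phi> x * \<psi> x) (\<lambda>x. \<phi> x *\<^sub>R d\<psi> x + \<psi> x *\<^sub>R d\<phi> x)"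
proof -
  have "((\<lambda>x. \<phi> x * \<psi> x) has_derivative (\<lambda>h. (\<phi> x *\<^sub>R d\<psi> x + \<psi> x *\<^sub>R d\<phi> x) \<bullet> h)) (at x)" for x
    using has_derivative_mult[of \<phi> "(\<bullet>) (d\<phi> x)" x UNIV \<psi> "(\<bullet>) (d\<psi> x)"] assms
    by (simp add: cont_grad_def inner_add_left mult.commute)
  moreover have "continuous_on UNIV (\<lambda>x. \<phi> x *\<^sub>R d\<psi> x + \<psi> x *\<^sub>R d\<phi> x)"
    using assms cont_grad_continuous[OF assms(1)] cont_grad_continuous[OF assms(2)]
    by (auto simp: cont_grad_def intro!: continuous_intros)
  ultimately show ?thesis
    by (simp add: cont_grad_def)
qed

lemma cont_grad_prod:
  fixes f :: "'i \<Rightarrow> 'a::euclidean_space \<Rightarrow> real"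
  assumes "finite I" "\<And>i. i \<in> I \<Longrightarrow> \<exists>d. cont_grad (f i) d"
  shows "\<exists>d. cont_grad (\<lambda>x. \<Prod>i\<in>I. f i x) d"
  using assms
proof (induction I rule: finite_induct)
  case empty
  have "cont_grad (\<lambda>x. 1) (\<lambda>x. 0 :: 'a)"
    by (auto simp: cont_grad_def)
  then show ?case by auto
next
  case (insert i I)
  then obtain d e where "cont_grad (f i) d" "cont_grad (\<lambda>x. \<Prod>i\<in>I. f i x) e"
    by (metis insertCI)
  from cont_grad_mult[OF this] insert show ?case by auto
qed

text \<open>A continuously differentiable function that vanishes exactly on \<open>s \<le> 0\<close>, and for which
  \<open>ramp (n * s)\<close> increases to the indicator of \<open>s > 0\<close>.\<close>

definition ramp :: "real \<Rightarrow> real" where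
  "ramp s = (max 0 s)\<^sup>2 / (1 + (max 0 s)\<^sup>2)"

lemma ramp_bounds: "0 \<le> ramp s" "ramp s \<le> 1"
  using zero_le_power2[of "max 0 s"] by (auto simp: ramp_def divide_le_eq_1 add_pos_nonneg simp del: zero_le_power2)

lemma ramp_eq_0: "s \<le> 0 \<Longrightarrow> ramp s = 0"
  by (simp add: ramp_def)

text \<open>Squaring removes the kink of the positive part: at 0 the difference quotient of the
  square is at most the absolute value of the increment, so it tends to 0 from both sides.\<close>

lemma square_positive_part_deriv:
  "((\<lambda>s::real. (max 0 s)\<^sup>2) has_field_derivative 2 * max 0 s) (at s)"
proof -
  consider "s < 0" | "s > 0" | "s = 0" by linarith
  then show ?thesis
  proof cases
    case 1
    have "((\<lambda>s::real. 0) has_field_derivative 2 * max 0 s) (at s)"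
      using 1 by (auto)
    then show ?thesis
      by (rule has_field_derivative_transform_within_open[where S = "{..<0}"]) (use 1 in auto)
  next
    case 2
    have "((\<lambda>s::real. s\<^sup>2) has_field_derivative 2 * max 0 s) (at s)"
      using 2 by (auto intro!: derivative_eq_intros)
    then show ?thesis
      by (rule has_field_derivative_transform_within_open[where S = "{0<..}"]) (use 2 in auto)
  next
    case 3
    have "((\<lambda>h::real. \<bar>h\<bar>) \<longlongrightarrow> 0) (at 0)"
      by (auto intro!: tendsto_eq_intros)
    then have "((\<lambda>h::real. (max 0 h)\<^sup>2 / h) \<longlongrightarrow> 0) (at 0)"
      by (rule Lim_null_comparison[rotated])
         (auto simp: eventually_at_filter max_def power2_eq_square)
    then show ?thesis
      using 3 by (simp add: DERIV_def)
  qed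
qed

lemma ramp_deriv:
  "(ramp has_field_derivative (2 * max 0 s / (1 + (max 0 s)\<^sup>2)\<^sup>2)) (at s)"
proof -
  have "0 < 1 + (max 0 s)\<^sup>2" by (intro add_pos_nonneg) auto
  then have nz: "1 + (max 0 s)\<^sup>2 \<noteq> 0" by simp
  have "((\<lambda>s. (max 0 s)\<^sup>2 / (1 + (max 0 s)\<^sup>2)) has_field_derivative
     (2 * max 0 s * (1 + (max 0 s)\<^sup>2) - (max 0 s)\<^sup>2 * (2 * max 0 s))
       / ((1 + (max 0 s)\<^sup>2) * (1 + (max 0 s)\<^sup>2))) (at s)"
    using DERIV_divide[OF square_positive_part_deriv
        DERIV_add[OF DERIV_const square_positive_part_deriv] nz] by (simp only: add_0)
  moreover have "2 * y * (1 + y\<^sup>2) - y\<^sup>2 * (2 * y) = 2 * y" for y :: real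
    by algebra
  ultimately show ?thesis
    unfolding ramp_def[abs_def] by (simp only: power2_eq_square[of "1 + _"])
qed

lemma ramp_affine_cont_grad: "\<exists>d. cont_grad (\<lambda>x::'a::euclidean_space. ramp (x \<bullet> v + c)) d"
proof
  let ?r = "\<lambda>s::real. 2 * max 0 s / (1 + (max 0 s)\<^sup>2)\<^sup>2"
  have "((\<lambda>x. ramp (x \<bullet> v + c)) has_derivative (\<lambda>h. (?r (x \<bullet> v + c) *\<^sub>R v) \<bullet> h)) (at x)" for x
  proof -
    have "((\<lambda>x. x \<bullet> v + c) has_derivative (\<lambda>h. h \<bullet> v)) (at x)"
      by (auto intro!: derivative_eq_intros)
    from has_derivative_compose[OF this ramp_deriv[unfolded has_field_derivative_def]]
    show ?thesis by (simp add: inner_commute mult.commute)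
  qed
  moreover have "continuous_on UNIV (\<lambda>x. ?r (x \<bullet> v + c) *\<^sub>R v)"
    by (intro continuous_intros) (auto simp: add_nonneg_eq_0_iff)
  ultimately show "cont_grad (\<lambda>x. ramp (x \<bullet> v + c)) (\<lambda>x. ?r (x \<bullet> v + c) *\<^sub>R v)"
    by (simp add: cont_grad_def)
qed

text \<open>With y = n * s the ramp is 1 - 1/(1 + y^2) for positive \<open>s\<close>, so only a
  denominator has to diverge. For \<open>s \<le> 0\<close> every term is 0; that this includes
  \<open>s = 0\<close> is what makes the limit the indicator of an open set.\<close>

lemma ramp_limit: "(\<lambda>n. ramp (real n * s)) \<longlonglongrightarrow> indicator {0<..} s"
proof (cases "s > 0")
  case True
  have "filterlim (\<lambda>n. 1 + (real n * s)\<^sup>2) at_top sequentially"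
    using True
    by (intro filterlim_tendsto_add_at_top[OF tendsto_const] filterlim_pow_at_top
        filterlim_at_top_mult_tendsto_pos[OF tendsto_const] filterlim_real_sequentially) auto
  then have "(\<lambda>n. 1 - inverse (1 + (real n * s)\<^sup>2)) \<longlonglongrightarrow> 1 - 0"
    by (intro tendsto_intros tendsto_inverse_0_at_top)
  moreover have "1 - inverse (1 + (real n * s)\<^sup>2) = ramp (real n * s)" for n
    using True by (simp add: ramp_def field_simps add_nonneg_eq_0_iff)
  ultimately show ?thesis using True by simp
next
  case False
  then show ?thesis by (auto simp: ramp_eq_0 mult_nonneg_nonpos not_less)
qed

text \<open>Two ramps per coordinate, one rising from \<open>a\<close> and one falling towards
  \<open>b\<close>, are for \<open>n > 0\<close> all positive exactly in the open box. So the
  approximation is from inside and the support stays in the closed box. The bound by 1 serves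
  dominated convergence.\<close>

lemma indicator_box_limit_of_test_funs:
  fixes a b :: "'a::euclidean_space"
  obtains \<phi> d\<phi> where
    "\<And>n U. cbox a b \<subseteq> U \<Longrightarrow> test_fun U (\<phi> n) (d\<phi> n)"
    "\<And>n x. \<bar>\<phi> n x\<bar> \<le> 1"
    "\<And>x. (\<lambda>n::nat. \<phi> n x) \<longlonglongrightarrow> indicator (box a b) x"
proof -
  define \<phi> where "\<phi> n x = (\<Prod>i\<in>Basis. ramp (real n * ((x - a) \<bullet> i)) * ramp (real n * ((b - x) \<bullet> i)))"
    for n :: nat and x
  have "\<exists>d. cont_grad (\<phi> n) d" for n
  proof -
    have "\<exists>d. cont_grad (\<lambda>x. ramp (real n * ((x - a) \<bullet> i)) * ramp (real n * ((b - x) \<bullet> i))) d" for i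
      using ramp_affine_cont_grad[of "real n *\<^sub>R i" "- real n * (a \<bullet> i)"]
        ramp_affine_cont_grad[of "- real n *\<^sub>R i" "real n * (b \<bullet> i)"] cont_grad_mult
      by (simp add: algebra_simps) blast
    then show ?thesis
      unfolding \<phi>_def[abs_def] by (intro cont_grad_prod) auto
  qed
  then obtain d\<phi> where d: "\<And>n. cont_grad (\<phi> n) (d\<phi> n)" by metis
  show ?thesis
  proof
    fix n U assume "cbox a b \<subseteq> U"
    \<comment> \<open>A single ramp has unbounded support, which is why \<open>cont_grad\<close>
      omits the support condition of \<open>test_fun\<close>. Only the product over all coordinates
      vanishes outside the closed box, because one factor does.\<close>
    moreover have "\<phi> n x = 0" if outside: "x \<notin> cbox a b" for x
    proof -
      obtain i where "i \<in> Basis" "x \<bullet> i < a \<bullet> i \<or> x \<bullet> i > b \<bullet> i"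
        using outside unfolding mem_box by (meson not_le)
      then have "ramp (real n * ((x - a) \<bullet> i)) * ramp (real n * ((b - x) \<bullet> i)) = 0"
        by (auto simp: inner_diff_left mult_nonneg_nonpos intro!: ramp_eq_0)
      with \<open>i \<in> Basis\<close> show ?thesis
        unfolding \<phi>_def by (intro prod_zero) auto
    qed
    ultimately show "test_fun U (\<phi> n) (d\<phi> n)"
      using d[of n] by (auto simp: test_fun_def cont_grad_def intro!: exI[of _ "cbox a b"])
  next
    fix n x
    have "0 \<le> \<phi> n x" "\<phi> n x \<le> 1"
      unfolding \<phi>_def by (auto intro!: prod_nonneg prod_le_1 mult_le_one mult_nonneg_nonneg ramp_bounds)
    then show "\<bar>\<phi> n x\<bar> \<le> 1" by simp
  next
    fix x
    have "(\<lambda>n. \<phi> n x) \<longlonglongrightarrow>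
        (\<Prod>i\<in>Basis. indicator {0<..} ((x - a) \<bullet> i) * indicator {0<..} ((b - x) \<bullet> i))"
      unfolding \<phi>_def by (intro tendsto_prod tendsto_mult ramp_limit)
    also have "(\<Prod>i\<in>Basis. indicator {0<..} ((x - a) \<bullet> i) * indicator {0<..} ((b - x) \<bullet> i))
        = (indicator (box a b) x :: real)"
    proof (cases "x \<in> box a b")
      case True
      then show ?thesis by (simp add: mem_box inner_diff_left)
    next
      case False
      then obtain i where "i \<in> Basis" "x \<bullet> i \<le> a \<bullet> i \<or> x \<bullet> i \<ge> b \<bullet> i"
        by (auto simp: mem_box not_less)
      then show ?thesis
        using False by (auto simp: inner_diff_left intro!: prod_zero bexI[of _ i])
    qed
    finally show "(\<lambda>n. \<phi> n x) \<longlonglongrightarrow> indicator (box a b) x" .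
  qed
qed

text \<open>Open boxes form an intersection-stable generator of the Borel sets, so Dynkin's argument
  carries vanishing integrals from boxes to all Borel sets; a function with only vanishing integrals
  is zero a.e.\<close>

lemma AE_zero_if_box_integrals_zero:
  fixes g :: "'a::euclidean_space \<Rightarrow> real"
  assumes g: "integrable lborel g"
    and box: "\<And>c d. box c d \<subseteq> box a b \<Longrightarrow> (LINT x|lborel. indicator (box c d) x * g x) = 0"
  shows "AE x in lborel. x \<in> box a b \<longrightarrow> g x = 0"
proof -
  have gm[measurable]: "g \<in> borel_measurable borel" using g by auto
  \<comment> \<open>Cutting \<open>g\<close> off outside \<open>box a b\<close> turns the integral
    over the whole space into a box integral, which the complement step of the induction needs to be
    0.\<close>
  define h where "h = (\<lambda>x. indicator (box a b) x * g x)"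
  have int: "integrable lborel (\<lambda>x. indicator A x * g x)" if "A \<in> sets borel" for A
    using integrable_mult_indicator[of A lborel g] that g by simp
  have zero: "(LINT x|lborel. indicator A x * h x) = 0" if "A \<in> sets borel" for A
  proof -
    let ?E = "range (\<lambda>(a, b). box a b :: 'a set)"
    have "Int_stable ?E"
      by (auto simp: Int_stable_def box_Int_box)
    moreover have "?E \<subseteq> Pow UNIV" by auto
    moreover have "A \<in> sigma_sets UNIV ?E"
      using that unfolding borel_eq_box by simp
    ultimately show ?thesis
    proof (induction rule: sigma_sets_induct_disjoint)
      case (basic A)
      then obtain c d where "A = box c d" by auto
      moreover obtain c' d' where "box c d \<inter> box a b = box c' d'"
        using box_Int_box by blast
      moreover have "indicator (box c d) x * h x = indicator (box c d \<inter> box a b) x * g x" for x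
        by (auto simp: h_def indicator_def)
      ultimately show ?case using box[of c' d'] by auto
    next
      case empty
      then show ?case by simp
    next
      case (compl A)
      then have "A \<in> sets borel" by (simp add: borel_eq_box)
      then have "integrable lborel (\<lambda>x. indicator (A \<inter> box a b) x * g x)"
        by (intro int) auto
      then have "integrable lborel (\<lambda>x. indicator A x * h x)"
        by (simp add: h_def indicator_inter_arith mult.assoc)
      moreover have "integrable lborel h"
        unfolding h_def by (intro int) auto
      moreover have "(\<lambda>x. indicator (UNIV - A) x * h x) = (\<lambda>x. h x - indicator A x * h x)"
        by (auto simp: indicator_def)
      moreover have "(LINT x|lborel. h x) = 0"
        unfolding h_def by (rule box) auto
      ultimately show ?case using compl by simp
    next
      case (union A)
      then have A: "A i \<in> sets borel" for i by (auto simp: borel_eq_box)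
      have "set_integrable lborel (\<Union>i. A i) h"
        unfolding set_integrable_def
        using int[of "(\<Union>i. A i) \<inter> box a b"] A
        by (simp add: h_def indicator_inter_arith mult.assoc)
      then have "(LINT x:(\<Union>i. A i)|lborel. h x) = (\<Sum>i. (LINT x:(A i)|lborel. h x))"
        using A union by (intro lebesgue_integral_countable_add) (auto simp: disjoint_family_on_def)
      then show ?case using union by (simp add: set_lebesgue_integral_def)
    qed
  qed
  have "AE x in lborel. h x = 0"
    by (rule sigma_finite_measure.density_zero[OF sigma_finite_lborel]) (use int zero in \<open>auto simp: set_lebesgue_integral_def h_def\<close>)
  then show ?thesis by eventually_elim (auto simp: h_def)
qed

text \<open>Dominated convergence passes from test functions to boxes whose closures lie in
  \<open>U\<close>. Vanishing box integrals force the function to be zero a.e. on each closed box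
  inside \<open>U\<close>, and countably many such boxes fill \<open>U\<close>.\<close>

lemma fundamental_lemma_calculus_of_variations:
  fixes f :: "'a::euclidean_space \<Rightarrow> real"
  assumes U: "open U" and f: "integrable (lebesgue_on U) f"
    and zero: "\<And>\<phi> d\<phi>. test_fun U \<phi> d\<phi> \<Longrightarrow> (LINT x|lebesgue_on U. \<phi> x * f x) = 0"
  shows "AE x in lebesgue_on U. f x = 0"
proof -
  have UL: "U \<in> sets lebesgue" using U by auto
  have ind: "integrable lebesgue (\<lambda>x. indicator U x * f x)"
    using f UL by (simp add: integrable_restrict_space)
  \<comment> \<open>\<open>f\<close> is only Lebesgue measurable, whereas the argument with boxes
    lives on Borel sets; \<open>g\<close> is a Borel function that agrees a.e. with \<open>f\<close>
    extended by 0.\<close>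
  then obtain g where gm: "g \<in> borel_measurable lborel"
    and gf: "AE x in lborel. indicator U x * f x = g x"
    using completion_ex_borel_measurable_real[of "\<lambda>x. indicator U x * f x" lborel] by auto
  have gf': "AE x in lebesgue. indicator U x * f x = g x"
    using gf by (rule AE_completion)
  have gmL[measurable]: "g \<in> borel_measurable lebesgue"
    using gm by (intro measurable_completion)
  have gi: "integrable lborel g"
    using ind integrable_cong_AE_imp[OF ind gmL] gf' integrable_completion[OF gm] by auto
  have box0: "AE x in lborel. x \<in> box a b \<longrightarrow> g x = 0" if ab: "cbox a b \<subseteq> U" for a b
  proof (rule AE_zero_if_box_integrals_zero[OF gi])
    fix c d assume cd: "box c d \<subseteq> box a b"
    show "(LINT x|lborel. indicator (box c d) x * g x) = 0"
    \<comment> \<open>Only for a nonempty open box is \<open>cbox c d\<close> its closure and hence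
      inside \<open>cbox a b\<close>. A degenerate open box is empty while its closed box may reach
      outside \<open>U\<close>; its integral is trivially 0.\<close>
    proof (cases "box c d = {}")
      case False
      then have "cbox c d \<subseteq> U"
        using cd ab by (metis closure_box closure_mono closure_cbox box_subset_cbox closed_cbox
            closure_closed subset_trans)
      obtain \<phi> d\<phi> where \<phi>:
        "\<And>n U. cbox c d \<subseteq> U \<Longrightarrow> test_fun U (\<phi> n) (d\<phi> n)"
        "\<And>n x. \<bar>\<phi> n x\<bar> \<le> 1"
        "\<And>x. (\<lambda>n::nat. \<phi> n x) \<longlonglongrightarrow> indicator (box c d) x"
        using indicator_box_limit_of_test_funs by blast
      have \<phi>m: "\<phi> n \<in> borel_measurable borel" for n
        using \<phi>(1)[of UNIV n] cont_grad_continuous[of "\<phi> n" "d\<phi> n"]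
        by (auto simp: test_fun_def cont_grad_def intro!: borel_measurable_continuous_onI)
      have "(LINT x|lborel. \<phi> n x * g x) = 0" for n
      proof -
        have "(LINT x|lborel. \<phi> n x * g x) = (LINT x|lebesgue. \<phi> n x * g x)"
          using gm \<phi>m[of n] by (intro integral_completion[symmetric]) auto
        also have "\<dots> = (LINT x|lebesgue. \<phi> n x * (indicator U x * f x))"
          using gf' gmL \<phi>m[of n] borel_measurable_integrable[OF ind]
          by (intro integral_cong_AE borel_measurable_times[of "\<phi> n"]) (auto intro: measurable_completion)
        also have "\<dots> = (LINT x|lebesgue_on U. \<phi> n x * f x)"
          using UL by (simp add: integral_restrict_space mult.left_commute)
        also have "\<dots> = 0"
          using zero \<phi>(1)[OF \<open>cbox c d \<subseteq> U\<close>] by blast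
        finally show ?thesis .
      qed
      moreover have "(\<lambda>n. LINT x|lborel. \<phi> n x * g x) \<longlonglongrightarrow> (LINT x|lborel. indicator (box c d) x * g x)"
      proof (rule integral_dominated_convergence[where w = "\<lambda>x. \<bar>g x\<bar>"])
        show "AE x in lborel. norm (\<phi> n x * g x) \<le> \<bar>g x\<bar>" for n
          using \<phi>(2)[of n] by (auto simp: abs_mult intro!: mult_left_le_one_le)
        show "AE x in lborel. (\<lambda>n. \<phi> n x * g x) \<longlonglongrightarrow> indicator (box c d) x * g x"
          by (intro AE_I2 tendsto_mult \<phi>(3) tendsto_const)
      qed (use gi gm \<phi>m in auto)
      ultimately show ?thesis
        by (simp add: LIMSEQ_const_iff)
    qed simp
  qed
  obtain \<D> where \<D>: "countable \<D>" "\<D> \<subseteq> Pow U" "\<And>X. X \<in> \<D> \<Longrightarrow> \<exists>a b. X = cbox a b" "\<Union>\<D> = U"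
    using open_countable_Union_open_cbox[OF U] by metis
  have "AE x in lborel. \<forall>X\<in>\<D>. x \<in> X \<longrightarrow> g x = 0"
  proof (subst AE_ball_countable[OF \<D>(1)], intro ballI)
    fix X assume "X \<in> \<D>"
    then obtain a b where X: "X = cbox a b" "cbox a b \<subseteq> U" using \<D> by blast
    \<comment> \<open>The box argument says nothing about the faces of the closed box, but these are
      negligible.\<close>
    have "AE x in lebesgue. x \<notin> cbox a b - box a b"
      using negligible_frontier_interval[of a b] by (intro AE_not_in) (simp add: negligible_iff_null_sets)
    then have "AE x in lborel. x \<notin> cbox a b - box a b"
      by (simp add: AE_completion_iff)
    with box0[OF X(2)] show "AE x in lborel. x \<in> X \<longrightarrow> g x = 0"
      by eventually_elim (auto simp: X)
  qed
  then have "AE x in lebesgue. \<forall>X\<in>\<D>. x \<in> X \<longrightarrow> g x = 0"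
    by (rule AE_completion)
  with gf' have "AE x in lebesgue. x \<in> U \<longrightarrow> f x = 0"
  proof eventually_elim
    case (elim x)
    show ?case
    proof
      assume "x \<in> U"
      then have "g x = 0" using elim(2) \<D>(4) by blast
      with elim(1) \<open>x \<in> U\<close> show "f x = 0" by simp
    qed
  qed
  then show ?thesis
    using UL by (simp add: AE_restrict_space_iff)
qed

section \<open>Square-integrable vector-valued functions\<close>

lemma norm_add_sq_le: "(norm (x + y))\<^sup>2 \<le> 2 * (norm x)\<^sup>2 + 2 * (norm y)\<^sup>2"
  for x y :: "'a::real_inner"
proof -
  have "(norm (x + y))\<^sup>2 + (norm (x - y))\<^sup>2 = 2 * (norm x)\<^sup>2 + 2 * (norm y)\<^sup>2"
    by (simp add: power2_norm_eq_inner inner_add inner_diff)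
  then show ?thesis
    using zero_le_power2[of "norm (x - y)"] by linarith
qed

lemma L2_space_measurable: "f \<in> L2_space M \<Longrightarrow> f \<in> borel_measurable M"
  by (simp add: L2_space_def)

lemma L2_space_zero: "(\<lambda>_. 0) \<in> L2_space M"
  by (simp add: L2_space_def)

text \<open>Covers every pointwise linear expression in the fields and their gradients: multiples,
  components, the divergence as a matrix trace, and the stress.\<close>

lemma L2_space_bounded_linear:
  assumes "f \<in> L2_space M" "bounded_linear L"
  shows "(\<lambda>x. L (f x)) \<in> L2_space M"
proof -
  obtain K where K: "\<And>x. norm (L x) \<le> norm x * K" "K \<ge> 0"
    using bounded_linear.nonneg_bounded[OF assms(2)] by blast
  have [measurable]: "f \<in> borel_measurable M" using assms(1) by (rule L2_space_measurable)
  have Lm: "L \<in> borel_measurable borel"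
    using assms(2) by (intro borel_measurable_continuous_onI linear_continuous_on)
  have m: "(\<lambda>x. L (f x)) \<in> borel_measurable M"
    by (rule measurable_compose[OF _ Lm]) simp
  have "integrable M (\<lambda>x. (norm (L (f x)))\<^sup>2)"
  proof (rule Bochner_Integration.integrable_bound)
    show "integrable M (\<lambda>x. K\<^sup>2 * (norm (f x))\<^sup>2)"
      using assms(1) by (simp add: L2_space_def)
    have "(norm (L y))\<^sup>2 \<le> K\<^sup>2 * (norm y)\<^sup>2" for y
      using power_mono[OF K(1)[of y], of 2] by (simp add: power_mult_distrib mult.commute)
    then show "AE x in M. norm ((norm (L (f x)))\<^sup>2) \<le> norm (K\<^sup>2 * (norm (f x))\<^sup>2)"
      by simp
  qed (use m in simp)
  with m show ?thesis by (simp add: L2_space_def)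
qed

lemma L2_space_plus:
  assumes "f \<in> L2_space M" "g \<in> L2_space M"
  shows "(\<lambda>x. f x + g x) \<in> L2_space M"
proof -
  have m: "f \<in> borel_measurable M" "g \<in> borel_measurable M"
    using assms by (auto intro: L2_space_measurable)
  have "integrable M (\<lambda>x. (norm (f x + g x))\<^sup>2)"
  proof (rule Bochner_Integration.integrable_bound)
    show "integrable M (\<lambda>x. 2 * (norm (f x))\<^sup>2 + 2 * (norm (g x))\<^sup>2)"
      using assms by (simp add: L2_space_def)
    show "AE x in M. norm ((norm (f x + g x))\<^sup>2) \<le> norm (2 * (norm (f x))\<^sup>2 + 2 * (norm (g x))\<^sup>2)"
      using norm_add_sq_le[of "f _" "g _"] by auto
  qed (use m in simp)
  with m show ?thesis by (simp add: L2_space_def)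
qed

lemma L2_space_scaleR: "f \<in> L2_space M \<Longrightarrow> (\<lambda>x. c *\<^sub>R f x) \<in> L2_space M"
  by (rule L2_space_bounded_linear[OF _ bounded_linear_scaleR_right])

lemma L2_space_lincomb:
  "f \<in> L2_space M \<Longrightarrow> g \<in> L2_space M \<Longrightarrow> (\<lambda>x. a *\<^sub>R f x + b *\<^sub>R g x) \<in> L2_space M"
  by (intro L2_space_plus L2_space_scaleR)

lemma L2_space_diff:
  "f \<in> L2_space M \<Longrightarrow> g \<in> L2_space M \<Longrightarrow> (\<lambda>x. f x - g x) \<in> L2_space M"
  using L2_space_lincomb[of f M g 1 "-1"] by simp

lemma L2_space_integrable_inner:
  assumes "f \<in> L2_space M" "g \<in> L2_space M"
  shows "integrable M (\<lambda>x. f x \<bullet> g x)"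
proof (rule Bochner_Integration.integrable_bound)
  show "integrable M (\<lambda>x. (norm (f x))\<^sup>2 + (norm (g x))\<^sup>2)"
    using assms by (simp add: L2_space_def)
  show "(\<lambda>x. f x \<bullet> g x) \<in> borel_measurable M"
    using assms by (auto dest!: L2_space_measurable)
  have "\<bar>x \<bullet> y\<bar> \<le> (norm x)\<^sup>2 + (norm y)\<^sup>2" for x y :: 'b
    using Cauchy_Schwarz_ineq2[of x y] sum_squares_bound[of "norm x" "norm y"]
      zero_le_power2[of "norm x"] zero_le_power2[of "norm y"] mult_nonneg_nonneg[of "norm x" "norm y"]
    by (simp add: mult.assoc)
  then show "AE x in M. norm (f x \<bullet> g x) \<le> norm ((norm (f x))\<^sup>2 + (norm (g x))\<^sup>2)"
    by simp
qed

lemma L2_inner_commute: "L2_inner M f g = L2_inner M g f"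
  by (simp add: L2_inner_def inner_commute)

lemma L2_inner_lincomb:
  assumes "f \<in> L2_space M" "g \<in> L2_space M" "h \<in> L2_space M"
  shows "L2_inner M (\<lambda>x. a *\<^sub>R f x + b *\<^sub>R g x) h = a * L2_inner M f h + b * L2_inner M g h"
  using assms by (simp add: L2_inner_def inner_add_left L2_space_integrable_inner)

lemma L2_norm_sq: "(L2_norm M f)\<^sup>2 = L2_inner M f f"
  by (simp add: L2_norm_def L2_inner_def power2_norm_eq_inner)

lemma L2_norm_nonneg: "0 \<le> L2_norm M f"
  by (simp add: L2_norm_def)

lemma L2_norm_sq_lincomb:
  assumes "f \<in> L2_space M" "g \<in> L2_space M"
  shows "(L2_norm M (\<lambda>x. a *\<^sub>R f x + b *\<^sub>R g x))\<^sup>2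
       = a\<^sup>2 * (L2_norm M f)\<^sup>2 + 2 * a * b * L2_inner M f g + b\<^sup>2 * (L2_norm M g)\<^sup>2"
proof -
  note L = L2_space_lincomb[OF assms]
  have "(L2_norm M (\<lambda>x. a *\<^sub>R f x + b *\<^sub>R g x))\<^sup>2
      = a * L2_inner M f (\<lambda>x. a *\<^sub>R f x + b *\<^sub>R g x) + b * L2_inner M g (\<lambda>x. a *\<^sub>R f x + b *\<^sub>R g x)"
    unfolding L2_norm_sq by (rule L2_inner_lincomb[OF assms L])
  also have "\<dots> = a * (a * L2_inner M f f + b * L2_inner M g f)
      + b * (a * L2_inner M f g + b * L2_inner M g g)"
    by (simp only: L2_inner_commute[of M f "\<lambda>x. a *\<^sub>R f x + b *\<^sub>R g x"]
        L2_inner_commute[of M g "\<lambda>x. a *\<^sub>R f x + b *\<^sub>R g x"] L2_inner_lincomb assms)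
  finally show ?thesis
    by (simp add: L2_norm_sq L2_inner_commute[of M g f] power2_eq_square[of a]
        power2_eq_square[of b] algebra_simps)
qed

text \<open>The functions form only a seminormed space, so the inequality is read off from the
  nonnegativity of the quadratic form in the coefficients \<open>a\<close>, \<open>b\<close>, with a
  separate case for a factor of seminorm 0.\<close>

lemma L2_Cauchy_Schwarz:
  assumes "f \<in> L2_space M" "g \<in> L2_space M"
  shows "\<bar>L2_inner M f g\<bar> \<le> L2_norm M f * L2_norm M g"
proof -
  let ?n = "(L2_norm M g)\<^sup>2" and ?m = "(L2_norm M f)\<^sup>2" and ?i = "L2_inner M f g"
  have nonneg: "0 \<le> a\<^sup>2 * ?m + 2 * a * b * ?i + b\<^sup>2 * ?n" for a b
    unfolding L2_norm_sq_lincomb[OF assms, symmetric] by simp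
  have "?i\<^sup>2 \<le> ?m * ?n"
  proof (cases "?n = 0")
    case True
    have "?i = 0"
    proof (rule ccontr)
      assume "?i \<noteq> 0"
      then show False
        \<comment> \<open>For \<open>?n = 0\<close> the form at (1, b) is m + 2 b i, where m and i
          stand for \<open>?m\<close> and \<open>?i\<close>. The chosen b makes it equal to
          -1.\<close>
        using nonneg[of 1 "- (?m + 1) / (2 * ?i)"] True by (simp add: field_simps)
    qed
    then show ?thesis by simp
  next
    case False
    then have "0 < ?n" by (simp add: less_le)
    have "0 \<le> ?n * (?m * ?n - ?i\<^sup>2)"
      \<comment> \<open>The coefficients (n, -i) are those of the component of \<open>f\<close>
        orthogonal to \<open>g\<close>, scaled by n to avoid a division.\<close>
      using nonneg[of ?n "- ?i"] by (simp add: power2_eq_square algebra_simps)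
    then show ?thesis
      using \<open>0 < ?n\<close> by (simp add: zero_le_mult_iff)
  qed
  then have "\<bar>?i\<bar>\<^sup>2 \<le> (L2_norm M f * L2_norm M g)\<^sup>2"
    by (simp add: power_mult_distrib)
  then show ?thesis
    by (rule power2_le_imp_le) (simp add: L2_norm_nonneg)
qed

lemma L2_norm_lincomb_le:
  assumes "f \<in> L2_space M" "g \<in> L2_space M"
  shows "L2_norm M (\<lambda>x. a *\<^sub>R f x + b *\<^sub>R g x) \<le> \<bar>a\<bar> * L2_norm M f + \<bar>b\<bar> * L2_norm M g"
proof (rule power2_le_imp_le)
  have "(a * b) * L2_inner M f g \<le> \<bar>a * b\<bar> * \<bar>L2_inner M f g\<bar>"
    by (metis abs_ge_self abs_mult)
  also have "\<dots> \<le> \<bar>a * b\<bar> * (L2_norm M f * L2_norm M g)"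
    by (intro mult_left_mono L2_Cauchy_Schwarz assms) simp
  finally show "(L2_norm M (\<lambda>x. a *\<^sub>R f x + b *\<^sub>R g x))\<^sup>2 \<le> (\<bar>a\<bar> * L2_norm M f + \<bar>b\<bar> * L2_norm M g)\<^sup>2"
    unfolding L2_norm_sq_lincomb[OF assms]
    by (simp add: power2_sum power_mult_distrib abs_mult mult_ac)
qed (simp add: L2_norm_nonneg)

section \<open>Bochner spaces over a seminormed space of functions\<close>

text \<open>Completeness of Lebesgue measure makes measurability of \<open>g\<close> a conclusion.
  This is what allows functions built from chosen representatives to be exchanged for a.e. equal
  ones before anything is known about their measurability.\<close>

lemma borel_measurable_lebesgue_on_AE:
  fixes f g :: "'a::euclidean_space \<Rightarrow> 'b::euclidean_space"
  assumes S: "S \<in> sets lebesgue" and f: "f \<in> borel_measurable (lebesgue_on S)"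
    and eq: "AE x in lebesgue_on S. f x = g x"
  shows "g \<in> borel_measurable (lebesgue_on S)"
proof -
  have "(\<lambda>x. if x \<in> S then f x else 0) \<in> borel_measurable lebesgue"
    using f S by (simp add: borel_measurable_if_I)
  moreover have "AE x in lebesgue. x \<in> S \<longrightarrow> f x = g x"
    using eq S by (simp add: AE_restrict_space_iff)
  then have "AE x in lebesgue. (if x \<in> S then f x else 0) = (if x \<in> S then g x else 0)"
    by eventually_elim simp
  ultimately have "(\<lambda>x. if x \<in> S then g x else 0) \<in> borel_measurable lebesgue"
    by (rule borel_measurable_AE)
  then show ?thesis by (rule borel_measurable_if_D)
qed

lemma integrable_lebesgue_on_cong_AE:
  fixes f g :: "'a::euclidean_space \<Rightarrow> 'b::euclidean_space"
  assumes "S \<in> sets lebesgue" "integrable (lebesgue_on S) f" "AE x in lebesgue_on S. f x = g x"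
  shows "integrable (lebesgue_on S) g" "integral\<^sup>L (lebesgue_on S) g = integral\<^sup>L (lebesgue_on S) f"
proof -
  have m: "f \<in> borel_measurable (lebesgue_on S)" using assms(2) by auto
  then have m': "g \<in> borel_measurable (lebesgue_on S)"
    using borel_measurable_lebesgue_on_AE assms by blast
  show "integrable (lebesgue_on S) g"
    using integrable_cong_AE[OF m m'] assms by blast
  show "integral\<^sup>L (lebesgue_on S) g = integral\<^sup>L (lebesgue_on S) f"
    using integral_cong_AE[OF m m'] assms by simp
qed

lemma finite_measure_interval: "finite_measure (interval T)"
  by (rule finite_measureI, cases "0 \<le> T") (simp_all add: emeasure_restrict_space)

definition simple_into :: "real \<Rightarrow> 'y set \<Rightarrow> (real \<Rightarrow> 'y) \<Rightarrow> bool" where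
  "simple_into T X s \<longleftrightarrow> simple_function (interval T) s \<and> s ` {0<..<T} \<subseteq> X"

lemma simple_into_AE: "simple_into T X s \<Longrightarrow> AE t in interval T. s t \<in> X"
  by (rule AE_I2) (auto simp: simple_into_def)

text \<open>The measurability half of \<open>bochner_L2\<close>, kept apart because
  \<open>has_bochner_value\<close> provides it too, without square integrability.\<close>

definition strongly_measurable ::
  "real \<Rightarrow> ('x \<Rightarrow> 'b::euclidean_space) set \<Rightarrow> (('x \<Rightarrow> 'b) \<Rightarrow> real) \<Rightarrow> (real \<Rightarrow> 'x \<Rightarrow> 'b) \<Rightarrow> bool" where
  "strongly_measurable T X N f \<longleftrightarrow> (AE t in interval T. f t \<in> X) \<and>
     (\<exists>s. (\<forall>n. simple_into T X (s n)) \<and>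
          (AE t in interval T. (\<lambda>n. N (\<lambda>x. f t x - s n t x)) \<longlonglongrightarrow> 0))"

lemma bochner_L2_iff:
  "f \<in> bochner_L2 T X N \<longleftrightarrow>
     strongly_measurable T X N f \<and> integrable (interval T) (\<lambda>t. (N (f t))\<^sup>2)"
  by (auto simp: bochner_L2_def strongly_measurable_def simple_into_def)

text \<open>This and the next two facts ask only for two properties of the zero function, so that
  they also apply to \<open>Hhalf\<close>, for which the seminorm laws below are not
  established.\<close>

lemma has_bochner_value_zero:
  assumes "(\<lambda>_. 0) \<in> X" "N (\<lambda>_. 0) = 0"
  shows "has_bochner_value T X N (\<lambda>_ _. 0) (\<lambda>_. 0)"
  unfolding has_bochner_value_def using assms by (auto intro!: exI[of _ "\<lambda>_ _ _. 0"])

lemma bochner_L2_zero: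
  assumes "(\<lambda>_. 0) \<in> X" "N (\<lambda>_. 0) = 0"
  shows "(\<lambda>_ _. 0) \<in> bochner_L2 T X N"
  unfolding bochner_L2_def using assms by (auto intro!: exI[of _ "\<lambda>_ _ _. 0"])

lemma bochner_H1_zero:
  assumes "(\<lambda>_. 0) \<in> X" "N (\<lambda>_. 0) = 0"
  shows "(\<lambda>_ _. 0) \<in> bochner_H1 T X N"
  unfolding bochner_H1_def has_time_deriv_def
  using bochner_L2_zero[where N = N, OF assms] has_bochner_value_zero[where N = N, OF assms]
  by (auto intro!: exI[of _ "\<lambda>_ _. 0"] exI[of _ "\<lambda>_. 0"])

text \<open>Instances are \<open>L2_space\<close>, \<open>disp_space\<close> and
  \<open>pres_space\<close>. \<open>N\<close> may vanish on nonzero functions, and nothing is known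
  about it outside \<open>X\<close>, so every estimate has to check membership first. One law for
  two-term combinations covers sums, differences and multiples.\<close>

locale seminormed_funs =
  fixes X :: "('x \<Rightarrow> 'b::euclidean_space) set" and N :: "('x \<Rightarrow> 'b) \<Rightarrow> real"
  assumes zero_in: "(\<lambda>_. 0) \<in> X"
    and lincomb_in: "\<And>f g a b. f \<in> X \<Longrightarrow> g \<in> X \<Longrightarrow> (\<lambda>x. a *\<^sub>R f x + b *\<^sub>R g x) \<in> X"
    and nonneg: "\<And>f. f \<in> X \<Longrightarrow> 0 \<le> N f"
    and lincomb_le: "\<And>f g a b. f \<in> X \<Longrightarrow> g \<in> X \<Longrightarrow>
      N (\<lambda>x. a *\<^sub>R f x + b *\<^sub>R g x) \<le> \<bar>a\<bar> * N f + \<bar>b\<bar> * N g"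
begin

lemma diff_in: "f \<in> X \<Longrightarrow> g \<in> X \<Longrightarrow> (\<lambda>x. f x - g x) \<in> X"
  using lincomb_in[of f g 1 "-1"] by simp

lemma scaleR_in: "f \<in> X \<Longrightarrow> (\<lambda>x. c *\<^sub>R f x) \<in> X"
  using lincomb_in[of f f c 0] by simp

lemma zero_N: "N (\<lambda>_. 0) = 0"
  using lincomb_le[OF zero_in zero_in, of 0 0] nonneg[OF zero_in] by simp

lemma scaleR_le: "f \<in> X \<Longrightarrow> N (\<lambda>x. c *\<^sub>R f x) \<le> \<bar>c\<bar> * N f"
  using lincomb_le[of f f c 0] by simp

lemma triangle: "f \<in> X \<Longrightarrow> g \<in> X \<Longrightarrow> \<bar>N f - N g\<bar> \<le> N (\<lambda>x. f x - g x)"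
  using lincomb_le[OF diff_in, of f g g 1 1] lincomb_le[OF diff_in, of f g f "-1" 1]
  by simp

lemma sum_in: "finite I \<Longrightarrow> (\<And>i. i \<in> I \<Longrightarrow> f i \<in> X) \<Longrightarrow> (\<lambda>x. \<Sum>i\<in>I. c i *\<^sub>R f i x) \<in> X"
proof (induction I rule: finite_induct)
  case empty
  then show ?case by (simp add: zero_in)
next
  case (insert i I)
  then show ?case using lincomb_in[of "f i" "\<lambda>x. \<Sum>i\<in>I. c i *\<^sub>R f i x" "c i" 1] by simp
qed

lemma lincomb_diff_le:
  assumes "f \<in> X" "g \<in> X" "f' \<in> X" "g' \<in> X"
  shows "N (\<lambda>x. (a *\<^sub>R f x + b *\<^sub>R g x) - (a *\<^sub>R f' x + b *\<^sub>R g' x))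
     \<le> \<bar>a\<bar> * N (\<lambda>x. f x - f' x) + \<bar>b\<bar> * N (\<lambda>x. g x - g' x)"
proof -
  have eq: "(\<lambda>x. (a *\<^sub>R f x + b *\<^sub>R g x) - (a *\<^sub>R f' x + b *\<^sub>R g' x))
    = (\<lambda>x. a *\<^sub>R (f x - f' x) + b *\<^sub>R (g x - g' x))"
    by (simp add: algebra_simps)
  show ?thesis unfolding eq by (intro lincomb_le diff_in assms)
qed

lemma simple_into_lincomb:
  assumes "simple_into T X s" "simple_into T X r"
  shows "simple_into T X (\<lambda>t x. a *\<^sub>R s t x + b *\<^sub>R r t x)"
  using assms simple_function_compose2[of "interval T" s r "\<lambda>f g x. a *\<^sub>R f x + b *\<^sub>R g x"]
  by (auto simp: simple_into_def intro!: lincomb_in)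

lemma simple_into_norm_measurable:
  assumes "simple_into T X s"
  shows "(\<lambda>t. N (s t)) \<in> borel_measurable (interval T)"
  using assms simple_function_compose1[of "interval T" s N]
  by (auto simp: simple_into_def intro: borel_measurable_simple_function)

text \<open>The laws for \<open>N\<close> hold only on \<open>X\<close>, so the error between such
  an integral and a Bochner value can be estimated only once the pointwise integral is known to lie
  in \<open>X\<close>. It does, being a finite combination of values weighted by the measures of the
  level sets.\<close>

lemma simple_into_integral_in:
  assumes "simple_into T X s"
  shows "(\<lambda>x. LINT t|interval T. s t x) \<in> X"
proof -
  let ?S = "s ` {0<..<T}" and ?A = "\<lambda>y. s -` {y} \<inter> {0<..<T}"
  interpret finite_measure "interval T" by (rule finite_measure_interval)
  have sf: "simple_function (interval T) s" using assms by (simp add: simple_into_def)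
  have fin: "finite ?S"
    using simple_functionD(1)[OF sf] by simp
  have meas: "?A y \<in> sets (interval T)" for y
    using simple_functionD(2)[OF sf, of "{y}"] by simp
  have "(LINT t|interval T. s t x) = (\<Sum>y\<in>?S. measure (interval T) (?A y) *\<^sub>R y x)" for x
  proof -
    have "(LINT t|interval T. s t x) = (LINT t|interval T. (\<Sum>y\<in>?S. indicator (?A y) t *\<^sub>R y x))"
    proof (rule Bochner_Integration.integral_cong[OF refl])
      fix t assume "t \<in> space (interval T)"
      then have t: "s t \<in> ?S" "t \<in> {0<..<T}" by auto
      have "(\<Sum>y\<in>?S. indicator (?A y) t *\<^sub>R y x) = (\<Sum>y\<in>?S. if y = s t then y x else 0)"
        using t by (intro sum.cong) (auto simp: indicator_def)
      then show "s t x = (\<Sum>y\<in>?S. indicator (?A y) t *\<^sub>R y x)"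
        using t fin by simp
    qed
    also have "\<dots> = (\<Sum>y\<in>?S. (LINT t|interval T. indicator (?A y) t *\<^sub>R y x))"
      using meas by (intro Bochner_Integration.integral_sum integrable_scaleR_left
          integrable_real_indicator) (auto simp: emeasure_eq_measure)
    also have "\<dots> = (\<Sum>y\<in>?S. measure (interval T) (?A y) *\<^sub>R y x)"
      using meas by (intro sum.cong refl)
        (subst integral_scaleR_left, auto simp: emeasure_eq_measure intro!: integrable_real_indicator)
    finally show ?thesis .
  qed
  then show ?thesis
    using sum_in[OF fin, of "\<lambda>y. y" "\<lambda>y. measure (interval T) (?A y)"] assms
    by (auto simp: simple_into_def)
qed

lemma simple_into_pointwise_integrable:
  assumes "simple_into T X s"
  shows "integrable (interval T) (\<lambda>t. s t x)"
proof -
  interpret finite_measure "interval T" by (rule finite_measure_interval)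
  have "simple_function (interval T) (\<lambda>t. s t x)"
    using assms simple_function_compose1[of "interval T" s "\<lambda>f. f x"] by (simp add: simple_into_def)
  then show ?thesis
    by (intro integrableI_simple_bochner_integrable simple_bochner_integrable.intros)
      (auto simp: emeasure_eq_measure)
qed

text \<open>The norms of the simple approximants are real simple functions, and by the reverse
  triangle inequality they converge a.e. to the norm of \<open>f\<close>; completeness then
  transfers measurability from the limit.\<close>

lemma strongly_measurable_norm:
  assumes "strongly_measurable T X N f"
  shows "(\<lambda>t. N (f t)) \<in> borel_measurable (interval T)"
proof -
  obtain s where s: "\<And>n. simple_into T X (s n)"
    "AE t in interval T. (\<lambda>n. N (\<lambda>x. f t x - s n t x)) \<longlonglongrightarrow> 0"
    and fX: "AE t in interval T. f t \<in> X"
    using assms by (auto simp: strongly_measurable_def)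
  \<comment> \<open>A single null set of times for all \<open>n\<close>, so that the laws for
    \<open>N\<close> apply along the whole sequence.\<close>
  have sX: "AE t in interval T. \<forall>n. s n t \<in> X"
    using s(1) by (simp add: AE_all_countable simple_into_AE)
  have "AE t in interval T. lim (\<lambda>n. N (s n t)) = N (f t)"
    using s(2) fX sX
  proof eventually_elim
    case (elim t)
    have "(\<lambda>n. N (s n t) - N (f t)) \<longlonglongrightarrow> 0"
      by (rule Lim_null_comparison[OF _ elim(1)])
        (use triangle elim in \<open>simp add: abs_minus_commute\<close>)
    then have "(\<lambda>n. N (s n t)) \<longlonglongrightarrow> N (f t)"
      by (rule LIM_zero_cancel)
    then show ?case by (rule limI)
  qed
  moreover have "(\<lambda>t. lim (\<lambda>n. N (s n t))) \<in> borel_measurable (interval T)"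
    by (intro borel_measurable_lim_metric simple_into_norm_measurable s)
  ultimately show ?thesis
    by (intro borel_measurable_lebesgue_on_AE[of "{0<..<T}" _ "\<lambda>t. N (f t)"]) auto
qed

lemma strongly_measurable_lincomb:
  assumes "strongly_measurable T X N f" "strongly_measurable T X N g"
  shows "strongly_measurable T X N (\<lambda>t x. a *\<^sub>R f t x + b *\<^sub>R g t x)"
proof -
  obtain s where s: "\<And>n. simple_into T X (s n)"
    "AE t in interval T. (\<lambda>n. N (\<lambda>x. f t x - s n t x)) \<longlonglongrightarrow> 0"
    and fX: "AE t in interval T. f t \<in> X"
    using assms(1) by (auto simp: strongly_measurable_def)
  obtain r where r: "\<And>n. simple_into T X (r n)"
    "AE t in interval T. (\<lambda>n. N (\<lambda>x. g t x - r n t x)) \<longlonglongrightarrow> 0"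
    and gX: "AE t in interval T. g t \<in> X"
    using assms(2) by (auto simp: strongly_measurable_def)
  have sX: "AE t in interval T. \<forall>n. s n t \<in> X" "AE t in interval T. \<forall>n. r n t \<in> X"
    using s(1) r(1) by (simp_all add: AE_all_countable simple_into_AE)
  have "AE t in interval T. (\<lambda>n. N (\<lambda>x. (a *\<^sub>R f t x + b *\<^sub>R g t x)
      - (a *\<^sub>R s n t x + b *\<^sub>R r n t x))) \<longlonglongrightarrow> 0"
    using s(2) r(2) fX gX sX
  proof eventually_elim
    case (elim t)
    have "(\<lambda>n. \<bar>a\<bar> * N (\<lambda>x. f t x - s n t x) + \<bar>b\<bar> * N (\<lambda>x. g t x - r n t x)) \<longlonglongrightarrow> \<bar>a\<bar> * 0 + \<bar>b\<bar> * 0"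
      by (intro tendsto_intros elim)
    then have lim: "(\<lambda>n. \<bar>a\<bar> * N (\<lambda>x. f t x - s n t x) + \<bar>b\<bar> * N (\<lambda>x. g t x - r n t x)) \<longlonglongrightarrow> 0"
      by simp
    have "norm (N (\<lambda>x. (a *\<^sub>R f t x + b *\<^sub>R g t x) - (a *\<^sub>R s n t x + b *\<^sub>R r n t x)))
        \<le> \<bar>a\<bar> * N (\<lambda>x. f t x - s n t x) + \<bar>b\<bar> * N (\<lambda>x. g t x - r n t x)" for n
      using lincomb_diff_le[of "f t" "g t" "s n t" "r n t" a b]
        nonneg[OF diff_in[OF lincomb_in lincomb_in], of "f t" "g t" "s n t" "r n t" a b a b] elim
      by simp
    then show ?case
      by (intro Lim_null_comparison[OF _ lim] always_eventually allI)
  qed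
  moreover have "AE t in interval T. (\<lambda>x. a *\<^sub>R f t x + b *\<^sub>R g t x) \<in> X"
    using fX gX by eventually_elim (rule lincomb_in)
  ultimately show ?thesis
    unfolding strongly_measurable_def
    using simple_into_lincomb[OF s(1) r(1)]
    by (intro conjI exI[of _ "\<lambda>n t x. a *\<^sub>R s n t x + b *\<^sub>R r n t x"]) auto
qed

lemma bochner_L2_lincomb:
  assumes "f \<in> bochner_L2 T X N" "g \<in> bochner_L2 T X N"
  shows "(\<lambda>t x. a *\<^sub>R f t x + b *\<^sub>R g t x) \<in> bochner_L2 T X N"
proof -
  have sm: "strongly_measurable T X N (\<lambda>t x. a *\<^sub>R f t x + b *\<^sub>R g t x)"
    using assms by (intro strongly_measurable_lincomb) (auto simp: bochner_L2_iff)
  have fX: "AE t in interval T. f t \<in> X" and gX: "AE t in interval T. g t \<in> X"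
    using assms by (auto simp: bochner_L2_iff strongly_measurable_def)
  have "integrable (interval T) (\<lambda>t. (N (\<lambda>x. a *\<^sub>R f t x + b *\<^sub>R g t x))\<^sup>2)"
  proof (rule Bochner_Integration.integrable_bound)
    show "integrable (interval T) (\<lambda>t. 2 * (a\<^sup>2 * (N (f t))\<^sup>2) + 2 * (b\<^sup>2 * (N (g t))\<^sup>2))"
      using assms by (auto simp: bochner_L2_iff)
    show "AE t in interval T. norm ((N (\<lambda>x. a *\<^sub>R f t x + b *\<^sub>R g t x))\<^sup>2)
        \<le> norm (2 * (a\<^sup>2 * (N (f t))\<^sup>2) + 2 * (b\<^sup>2 * (N (g t))\<^sup>2))"
      using fX gX
    proof eventually_elim
      case (elim t)
      have "(N (\<lambda>x. a *\<^sub>R f t x + b *\<^sub>R g t x))\<^sup>2 \<le> (\<bar>a\<bar> * N (f t) + \<bar>b\<bar> * N (g t))\<^sup>2"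
        using elim by (intro power_mono lincomb_le nonneg lincomb_in)
      also have "\<dots> \<le> 2 * (\<bar>a\<bar> * N (f t))\<^sup>2 + 2 * (\<bar>b\<bar> * N (g t))\<^sup>2"
        using norm_add_sq_le[of "\<bar>a\<bar> * N (f t)" "\<bar>b\<bar> * N (g t)"] by simp
      finally show ?case by (simp add: power_mult_distrib)
    qed
  qed (use strongly_measurable_norm[OF sm] in simp)
  with sm show ?thesis by (simp add: bochner_L2_iff)
qed

text \<open>Approximating the real factor \<open>w\<close> by simple functions and keeping \<eta>
  fixed gives simple functions with values in \<open>X\<close>. This makes a control acting as a
  source admissible data for \<open>well_posed\<close>.\<close>

lemma bochner_L2_separated:
  assumes w: "w \<in> L2_space (interval T)" and \<eta>: "\<eta> \<in> X"
  shows "(\<lambda>t x. w t *\<^sub>R \<eta> x) \<in> bochner_L2 T X N"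
proof -
  have wm: "w \<in> borel_measurable (interval T)" using w by (rule L2_space_measurable)
  obtain F where F: "\<forall>i. simple_function (interval T) (F i)"
    "\<forall>t\<in>{0<..<T}. (\<lambda>i. F i t) \<longlonglongrightarrow> w t"
    using borel_measurable_implies_sequence_metric[OF wm, of 0] by auto
  have sm: "strongly_measurable T X N (\<lambda>t x. w t *\<^sub>R \<eta> x)"
    unfolding strongly_measurable_def
  proof (intro conjI exI allI)
    show "AE t in interval T. (\<lambda>x. w t *\<^sub>R \<eta> x) \<in> X"
      using \<eta> by (simp add: scaleR_in)
    show "simple_into T X (\<lambda>t x. F n t *\<^sub>R \<eta> x)" for n
      using simple_function_compose1[OF F(1)[rule_format], of "\<lambda>c x. c *\<^sub>R \<eta> x" n] \<eta>
      by (auto simp: simple_into_def scaleR_in)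
    show "AE t in interval T. (\<lambda>n. N (\<lambda>x. w t *\<^sub>R \<eta> x - F n t *\<^sub>R \<eta> x)) \<longlonglongrightarrow> 0"
    proof (rule AE_I2)
      fix t assume "t \<in> space (interval T)"
      then have "(\<lambda>n. \<bar>w t - F n t\<bar> * N \<eta>) \<longlonglongrightarrow> \<bar>w t - w t\<bar> * N \<eta>"
        using F(2) by (intro tendsto_intros) auto
      then have lim: "(\<lambda>n. \<bar>w t - F n t\<bar> * N \<eta>) \<longlonglongrightarrow> 0" by simp
      have "norm (N (\<lambda>x. w t *\<^sub>R \<eta> x - F n t *\<^sub>R \<eta> x)) \<le> \<bar>w t - F n t\<bar> * N \<eta>" for n
        using scaleR_le[OF \<eta>, of "w t - F n t"] nonneg[OF scaleR_in[OF \<eta>, of "w t - F n t"]]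
        by (simp add: scaleR_diff_left)
      then show "(\<lambda>n. N (\<lambda>x. w t *\<^sub>R \<eta> x - F n t *\<^sub>R \<eta> x)) \<longlonglongrightarrow> 0"
        by (intro Lim_null_comparison[OF _ lim] always_eventually allI)
    qed
  qed
  have "integrable (interval T) (\<lambda>t. (N (\<lambda>x. w t *\<^sub>R \<eta> x))\<^sup>2)"
  proof (rule Bochner_Integration.integrable_bound)
    show "integrable (interval T) (\<lambda>t. (w t)\<^sup>2 * (N \<eta>)\<^sup>2)"
      using w by (simp add: L2_space_def)
    have "(N (\<lambda>x. c *\<^sub>R \<eta> x))\<^sup>2 \<le> c\<^sup>2 * (N \<eta>)\<^sup>2" for c
      using power_mono[OF scaleR_le[OF \<eta>, of c] nonneg[OF scaleR_in[OF \<eta>]], of 2]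
      by (simp add: power_mult_distrib)
    then show "AE t in interval T. norm ((N (\<lambda>x. w t *\<^sub>R \<eta> x))\<^sup>2) \<le> norm ((w t)\<^sup>2 * (N \<eta>)\<^sup>2)"
      by simp
  qed (use strongly_measurable_norm[OF sm] in simp)
  with sm show ?thesis by (simp add: bochner_L2_iff)
qed

text \<open>\<open>has_bochner_value\<close> supplies approximation in the mean, while strong
  measurability asks for approximation a.e.; a subsequence of the same simple functions bridges the
  two.\<close>

lemma L1_approximation_strongly_measurable:
  assumes fX: "AE t in interval T. f t \<in> X"
    and s: "\<And>n. simple_into T X (s n)"
    and int: "\<And>n. integrable (interval T) (\<lambda>t. N (\<lambda>x. f t x - s n t x))"
    and lim: "(\<lambda>n. LINT t|interval T. N (\<lambda>x. f t x - s n t x)) \<longlonglongrightarrow> 0"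
  shows "strongly_measurable T X N f"
proof -
  have "(LINT t|interval T. norm (N (\<lambda>x. f t x - s n t x))) = (LINT t|interval T. N (\<lambda>x. f t x - s n t x))"
    for n
  proof (rule integral_cong_AE)
    show "AE t in interval T. norm (N (\<lambda>x. f t x - s n t x)) = N (\<lambda>x. f t x - s n t x)"
    proof -
      have "AE t in interval T. s n t \<in> X"
        using s by (rule simple_into_AE)
      with fX show ?thesis by eventually_elim (simp add: nonneg diff_in)
    qed
  qed (use borel_measurable_integrable[OF int] in auto)
  with lim have "(\<lambda>n. LINT t|interval T. norm (N (\<lambda>x. f t x - s n t x))) \<longlonglongrightarrow> 0"
    by simp
  from tendsto_L1_AE_subseq[OF int this] obtain r where
    "AE t in interval T. (\<lambda>n. N (\<lambda>x. f t x - s (r n) t x)) \<longlonglongrightarrow> 0" by blast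
  then show ?thesis
    unfolding strongly_measurable_def using fX s by (intro conjI exI[of _ "\<lambda>n. s (r n)"]) auto
qed

text \<open>The approximants are combined. The delicate point is that the combined error must be
  integrable: domination by the two given errors does not make it measurable, so measurability is
  derived from the strong measurability of \<open>f\<close>, \<open>g\<close> and the
  approximants.\<close>

lemma has_bochner_value_lincomb:
  assumes "has_bochner_value T X N f I" "has_bochner_value T X N g J"
  shows "has_bochner_value T X N (\<lambda>t x. a *\<^sub>R f t x + b *\<^sub>R g t x) (\<lambda>x. a *\<^sub>R I x + b *\<^sub>R J x)"
proof -
  obtain s where s: "\<And>n. simple_into T X (s n)"
    "\<And>n. integrable (interval T) (\<lambda>t. N (\<lambda>x. f t x - s n t x))"
    "(\<lambda>n. LINT t|interval T. N (\<lambda>x. f t x - s n t x)) \<longlonglongrightarrow> 0"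
    "(\<lambda>n. N (\<lambda>x. (LINT t|interval T. s n t x) - I x)) \<longlonglongrightarrow> 0"
    and fX: "AE t in interval T. f t \<in> X" and I: "I \<in> X"
    using assms(1) by (auto simp: has_bochner_value_def simple_into_def)
  obtain r where r: "\<And>n. simple_into T X (r n)"
    "\<And>n. integrable (interval T) (\<lambda>t. N (\<lambda>x. g t x - r n t x))"
    "(\<lambda>n. LINT t|interval T. N (\<lambda>x. g t x - r n t x)) \<longlonglongrightarrow> 0"
    "(\<lambda>n. N (\<lambda>x. (LINT t|interval T. r n t x) - J x)) \<longlonglongrightarrow> 0"
    and gX: "AE t in interval T. g t \<in> X" and J: "J \<in> X"
    using assms(2) by (auto simp: has_bochner_value_def simple_into_def)
  let ?h = "\<lambda>t x. a *\<^sub>R f t x + b *\<^sub>R g t x" and ?q = "\<lambda>n t x. a *\<^sub>R s n t x + b *\<^sub>R r n t x"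
  let ?e = "\<lambda>n t. \<bar>a\<bar> * N (\<lambda>x. f t x - s n t x) + \<bar>b\<bar> * N (\<lambda>x. g t x - r n t x)"
  have q: "simple_into T X (?q n)" for n
    by (intro simple_into_lincomb s r)
  have hX: "AE t in interval T. ?h t \<in> X"
    using fX gX by eventually_elim (rule lincomb_in)
  have "strongly_measurable T X N f"
    by (rule L1_approximation_strongly_measurable[where s = s]) (fact fX s)+
  moreover have "strongly_measurable T X N g"
    by (rule L1_approximation_strongly_measurable[where s = r]) (fact gX r)+
  ultimately have "strongly_measurable T X N ?h"
    by (rule strongly_measurable_lincomb)
  \<comment> \<open>A simple function is its own approximating sequence.\<close>
  moreover have "strongly_measurable T X N (?q n)" for n
    unfolding strongly_measurable_def using q[of n] zero_N
    by (intro conjI exI[of _ "\<lambda>_. ?q n"]) (simp_all add: simple_into_AE)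
  ultimately have m: "(\<lambda>t. N (\<lambda>x. ?h t x - ?q n t x)) \<in> borel_measurable (interval T)" for n
    using strongly_measurable_norm[OF strongly_measurable_lincomb[of T ?h "?q n" 1 "-1"]]
    by (simp only: scaleR_one scaleR_minus1_left add_uminus_conv_diff)
  have bound: "AE t in interval T. 0 \<le> N (\<lambda>x. ?h t x - ?q n t x) \<and> N (\<lambda>x. ?h t x - ?q n t x) \<le> ?e n t" for n
  proof -
    have "AE t in interval T. s n t \<in> X" "AE t in interval T. r n t \<in> X"
      using s(1)[of n] r(1)[of n] by (simp_all add: simple_into_AE)
    with fX gX show ?thesis
    proof eventually_elim
      case (elim t)
      show ?case
        using nonneg[OF diff_in[OF lincomb_in[OF elim(1,2), of a b] lincomb_in[OF elim(3,4), of a b]]]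
          lincomb_diff_le[OF elim] by blast
    qed
  qed
  have e: "integrable (interval T) (?e n)" for n
    by (intro Bochner_Integration.integrable_add integrable_mult_right s r)
  have int: "integrable (interval T) (\<lambda>t. N (\<lambda>x. ?h t x - ?q n t x))" for n
    by (rule Bochner_Integration.integrable_bound[OF e[of n] m[of n]])
      (use bound[of n] in \<open>eventually_elim, simp\<close>)
  have lim: "(\<lambda>n. LINT t|interval T. N (\<lambda>x. ?h t x - ?q n t x)) \<longlonglongrightarrow> 0"
  proof (rule Lim_null_comparison)
    have "(\<lambda>n. \<bar>a\<bar> * (LINT t|interval T. N (\<lambda>x. f t x - s n t x))
        + \<bar>b\<bar> * (LINT t|interval T. N (\<lambda>x. g t x - r n t x))) \<longlonglongrightarrow> \<bar>a\<bar> * 0 + \<bar>b\<bar> * 0"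
      by (intro tendsto_intros s r)
    moreover have "(LINT t|interval T. ?e n t) = \<bar>a\<bar> * (LINT t|interval T. N (\<lambda>x. f t x - s n t x))
        + \<bar>b\<bar> * (LINT t|interval T. N (\<lambda>x. g t x - r n t x))" for n
      using s(2) r(2) by simp
    ultimately show "(\<lambda>n. LINT t|interval T. ?e n t) \<longlonglongrightarrow> 0" by simp
    have "norm (LINT t|interval T. N (\<lambda>x. ?h t x - ?q n t x)) \<le> (LINT t|interval T. ?e n t)" for n
    proof -
      have "0 \<le> (LINT t|interval T. N (\<lambda>x. ?h t x - ?q n t x))"
        by (rule integral_nonneg_AE) (use bound[of n] in \<open>eventually_elim, simp\<close>)
      moreover have "(LINT t|interval T. N (\<lambda>x. ?h t x - ?q n t x)) \<le> (LINT t|interval T. ?e n t)"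
        by (rule integral_mono_AE[OF int e]) (use bound[of n] in \<open>eventually_elim, simp\<close>)
      ultimately show ?thesis by simp
    qed
    then show "\<forall>\<^sub>F n in sequentially. norm (LINT t|interval T. N (\<lambda>x. ?h t x - ?q n t x))
        \<le> (LINT t|interval T. ?e n t)"
      by simp
  qed
  have val: "(\<lambda>n. N (\<lambda>x. (LINT t|interval T. ?q n t x) - (a *\<^sub>R I x + b *\<^sub>R J x))) \<longlonglongrightarrow> 0"
  proof (rule Lim_null_comparison)
    let ?s = "\<lambda>n x. LINT t|interval T. s n t x" and ?r = "\<lambda>n x. LINT t|interval T. r n t x"
    have "(\<lambda>n. \<bar>a\<bar> * N (\<lambda>x. ?s n x - I x) + \<bar>b\<bar> * N (\<lambda>x. ?r n x - J x)) \<longlonglongrightarrow> \<bar>a\<bar> * 0 + \<bar>b\<bar> * 0"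
      by (intro tendsto_intros s r)
    then show "(\<lambda>n. \<bar>a\<bar> * N (\<lambda>x. ?s n x - I x) + \<bar>b\<bar> * N (\<lambda>x. ?r n x - J x)) \<longlonglongrightarrow> 0"
      by simp
    have eq: "(LINT t|interval T. ?q n t x) = a *\<^sub>R ?s n x + b *\<^sub>R ?r n x" for n x
      using simple_into_pointwise_integrable[OF s(1)] simple_into_pointwise_integrable[OF r(1)]
      by simp
    have "norm (N (\<lambda>x. (LINT t|interval T. ?q n t x) - (a *\<^sub>R I x + b *\<^sub>R J x)))
       \<le> \<bar>a\<bar> * N (\<lambda>x. ?s n x - I x) + \<bar>b\<bar> * N (\<lambda>x. ?r n x - J x)" for n
    proof -
      note in_X = simple_into_integral_in[OF s(1)[of n]] simple_into_integral_in[OF r(1)[of n]]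
      show ?thesis
        unfolding eq
        using lincomb_diff_le[OF in_X I J, of a b]
          nonneg[OF diff_in[OF lincomb_in[OF in_X, of a b] lincomb_in[OF I J, of a b]]]
        by simp
    qed
    then show "\<forall>\<^sub>F n in sequentially.
       norm (N (\<lambda>x. (LINT t|interval T. ?q n t x) - (a *\<^sub>R I x + b *\<^sub>R J x)))
       \<le> \<bar>a\<bar> * N (\<lambda>x. ?s n x - I x) + \<bar>b\<bar> * N (\<lambda>x. ?r n x - J x)"
      by simp
  qed
  have approx: "\<forall>n. simple_function (interval T) (?q n) \<and> ?q n ` {0<..<T} \<subseteq> X \<and>
      integrable (interval T) (\<lambda>t. N (\<lambda>x. ?h t x - ?q n t x))"
    using q[unfolded simple_into_def, THEN conjunct1] q[unfolded simple_into_def, THEN conjunct2] int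
    by (intro allI conjI)
  show ?thesis
    unfolding has_bochner_value_def
    by (intro conjI[OF hX conjI[OF lincomb_in[OF I J] exI[of _ ?q]]] conjI approx lim val)
qed

lemma has_time_deriv_lincomb:
  assumes "has_time_deriv T X N f f'" "has_time_deriv T X N g g'"
  shows "has_time_deriv T X N (\<lambda>t x. a *\<^sub>R f t x + b *\<^sub>R g t x) (\<lambda>t x. a *\<^sub>R f' t x + b *\<^sub>R g' t x)"
  unfolding has_time_deriv_def
proof (intro conjI allI impI)
  fix \<phi> d\<phi> assume "test_fun {0<..<T} \<phi> d\<phi>"
  then obtain I J where
    I: "has_bochner_value T X N (\<lambda>t x. d\<phi> t *\<^sub>R f t x) I"
       "has_bochner_value T X N (\<lambda>t x. \<phi> t *\<^sub>R f' t x) (\<lambda>x. - I x)" and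
    J: "has_bochner_value T X N (\<lambda>t x. d\<phi> t *\<^sub>R g t x) J"
       "has_bochner_value T X N (\<lambda>t x. \<phi> t *\<^sub>R g' t x) (\<lambda>x. - J x)"
    using assms unfolding has_time_deriv_def by blast
  show "\<exists>I. has_bochner_value T X N (\<lambda>t x. d\<phi> t *\<^sub>R (a *\<^sub>R f t x + b *\<^sub>R g t x)) I \<and>
      has_bochner_value T X N (\<lambda>t x. \<phi> t *\<^sub>R (a *\<^sub>R f' t x + b *\<^sub>R g' t x)) (\<lambda>x. - I x)"
    using has_bochner_value_lincomb[OF I(1) J(1), of a b] has_bochner_value_lincomb[OF I(2) J(2), of a b]
    by (intro exI[of _ "\<lambda>x. a *\<^sub>R I x + b *\<^sub>R J x"]) (simp add: algebra_simps)
qed (use assms in \<open>auto simp: has_time_deriv_def intro!: bochner_L2_lincomb\<close>)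

text \<open>The combination of the two continuous representatives is a continuous representative of
  the combination. The condition on \<open>t\<close> guarantees that both representatives lie in
  \<open>X\<close> at \<open>t\<close>.\<close>

lemma has_time_value_lincomb:
  assumes "has_time_value T X N f t y" "has_time_value T X N g t z" "t \<in> {0..T}"
  shows "has_time_value T X N (\<lambda>t x. a *\<^sub>R f t x + b *\<^sub>R g t x) t (\<lambda>x. a *\<^sub>R y x + b *\<^sub>R z x)"
proof -
  obtain F where y: "y \<in> X" and F: "\<And>s. s \<in> {0..T} \<Longrightarrow> F s \<in> X"
    "\<And>s. s \<in> {0..T} \<Longrightarrow> ((\<lambda>r. N (\<lambda>x. F r x - F s x)) \<longlongrightarrow> 0) (at s within {0..T})"
    "AE s in interval T. f s \<in> X \<and> N (\<lambda>x. f s x - F s x) = 0" "N (\<lambda>x. F t x - y x) = 0"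
    using assms(1) unfolding has_time_value_def by blast
  obtain G where z: "z \<in> X" and G: "\<And>s. s \<in> {0..T} \<Longrightarrow> G s \<in> X"
    "\<And>s. s \<in> {0..T} \<Longrightarrow> ((\<lambda>r. N (\<lambda>x. G r x - G s x)) \<longlongrightarrow> 0) (at s within {0..T})"
    "AE s in interval T. g s \<in> X \<and> N (\<lambda>x. g s x - G s x) = 0" "N (\<lambda>x. G t x - z x) = 0"
    using assms(2) unfolding has_time_value_def by blast
  have vanish: "N (\<lambda>x. (a *\<^sub>R p x + b *\<^sub>R q x) - (a *\<^sub>R p' x + b *\<^sub>R q' x)) = 0"
    if "p \<in> X" "q \<in> X" "p' \<in> X" "q' \<in> X" "N (\<lambda>x. p x - p' x) = 0" "N (\<lambda>x. q x - q' x) = 0"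
    for p q p' q'
    using lincomb_diff_le[OF that(1-4), of a b]
      nonneg[OF diff_in[OF lincomb_in[OF that(1,2)] lincomb_in[OF that(3,4)]], of a b a b] that(5,6)
    by simp
  show ?thesis
    unfolding has_time_value_def
  proof (intro conjI exI[of _ "\<lambda>s x. a *\<^sub>R F s x + b *\<^sub>R G s x"] ballI)
    show "(\<lambda>x. a *\<^sub>R y x + b *\<^sub>R z x) \<in> X" by (intro lincomb_in y z)
    show "N (\<lambda>x. (a *\<^sub>R F t x + b *\<^sub>R G t x) - (a *\<^sub>R y x + b *\<^sub>R z x)) = 0"
      by (intro vanish F G y z assms(3))
    have "AE s in interval T. s \<in> {0..T}" by (auto intro!: AE_I2)
    with F(3) G(3) show "AE s in interval T. (\<lambda>x. a *\<^sub>R f s x + b *\<^sub>R g s x) \<in> X \<and>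
        N (\<lambda>x. (a *\<^sub>R f s x + b *\<^sub>R g s x) - (a *\<^sub>R F s x + b *\<^sub>R G s x)) = 0"
      by eventually_elim (use F(1) G(1) in \<open>blast intro: lincomb_in vanish\<close>)
    fix s assume s: "s \<in> {0..T}"
    show "(\<lambda>x. a *\<^sub>R F s x + b *\<^sub>R G s x) \<in> X" by (intro lincomb_in F G s)
    show "((\<lambda>r. N (\<lambda>x. (a *\<^sub>R F r x + b *\<^sub>R G r x) - (a *\<^sub>R F s x + b *\<^sub>R G s x))) \<longlongrightarrow> 0)
        (at s within {0..T})"
    proof (rule Lim_null_comparison)
      have "((\<lambda>r. \<bar>a\<bar> * N (\<lambda>x. F r x - F s x) + \<bar>b\<bar> * N (\<lambda>x. G r x - G s x)) \<longlongrightarrow> \<bar>a\<bar> * 0 + \<bar>b\<bar> * 0)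
          (at s within {0..T})"
        by (intro tendsto_intros F G s)
      then show "((\<lambda>r. \<bar>a\<bar> * N (\<lambda>x. F r x - F s x) + \<bar>b\<bar> * N (\<lambda>x. G r x - G s x)) \<longlongrightarrow> 0)
          (at s within {0..T})" by simp
      show "\<forall>\<^sub>F r in at s within {0..T}.
          norm (N (\<lambda>x. (a *\<^sub>R F r x + b *\<^sub>R G r x) - (a *\<^sub>R F s x + b *\<^sub>R G s x)))
          \<le> \<bar>a\<bar> * N (\<lambda>x. F r x - F s x) + \<bar>b\<bar> * N (\<lambda>x. G r x - G s x)"
        \<comment> \<open>This exposes that only \<open>r\<close> in \<open>{0..T}\<close> matter,
          where the representatives take values in \<open>X\<close>.\<close>
        unfolding eventually_at_filter
      proof (intro always_eventually allI impI)
        fix r assume r: "r \<in> {0..T}"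
        show "norm (N (\<lambda>x. (a *\<^sub>R F r x + b *\<^sub>R G r x) - (a *\<^sub>R F s x + b *\<^sub>R G s x)))
          \<le> \<bar>a\<bar> * N (\<lambda>x. F r x - F s x) + \<bar>b\<bar> * N (\<lambda>x. G r x - G s x)"
          using lincomb_diff_le[OF F(1)[OF r] G(1)[OF r] F(1)[OF s] G(1)[OF s], of a b]
            nonneg[OF diff_in[OF lincomb_in[OF F(1)[OF r] G(1)[OF r]] lincomb_in[OF F(1)[OF s] G(1)[OF s]]], of a b a b]
          by simp
      qed
    qed
  qed
qed

end

interpretation L2: seminormed_funs "L2_space M" "L2_norm M" for M
  by unfold_locales (auto intro: L2_space_zero L2_space_lincomb L2_norm_nonneg L2_norm_lincomb_le)

lemma bochner_L2_in: "f \<in> bochner_L2 T X N \<Longrightarrow> AE t in interval T. f t \<in> X"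
  by (simp add: bochner_L2_def)

text \<open>The same simple functions approximate in the weaker seminorm. It moves solutions from
  the \<open>H1_norm\<close> setting of the equations to the \<open>L2_norm\<close> setting of the
  objective.\<close>

lemma bochner_L2_weaken:
  assumes f: "f \<in> bochner_L2 T X N" and X: "seminormed_funs X N" and Y: "seminormed_funs Y K"
    and sub: "X \<subseteq> Y" and le: "\<And>g. g \<in> X \<Longrightarrow> K g \<le> N g"
  shows "f \<in> bochner_L2 T Y K"
proof -
  interpret X: seminormed_funs X N by fact
  interpret Y: seminormed_funs Y K by fact
  obtain s where s: "\<And>n. simple_into T X (s n)"
    "AE t in interval T. (\<lambda>n. N (\<lambda>x. f t x - s n t x)) \<longlonglongrightarrow> 0"
    and fX: "AE t in interval T. f t \<in> X"
    and int: "integrable (interval T) (\<lambda>t. (N (f t))\<^sup>2)"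
    using f by (auto simp: bochner_L2_iff strongly_measurable_def)
  have "AE t in interval T. \<forall>n. s n t \<in> X"
    using s(1) by (simp add: AE_all_countable simple_into_AE)
  with s(2) fX have "AE t in interval T. (\<lambda>n. K (\<lambda>x. f t x - s n t x)) \<longlonglongrightarrow> 0"
  proof eventually_elim
    case (elim t)
    have "norm (K (\<lambda>x. f t x - s n t x)) \<le> N (\<lambda>x. f t x - s n t x)" for n
      using elim X.diff_in[of "f t" "s n t"] le Y.nonneg sub by fastforce
    then show ?case
      by (intro Lim_null_comparison[OF _ elim(1)] always_eventually allI)
  qed
  moreover have "AE t in interval T. f t \<in> Y"
    using fX sub by auto
  ultimately have sm: "strongly_measurable T Y K f"
    unfolding strongly_measurable_def using s(1) sub
    by (intro conjI exI[of _ s]) (auto simp: simple_into_def)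
  have "integrable (interval T) (\<lambda>t. (K (f t))\<^sup>2)"
  proof (rule Bochner_Integration.integrable_bound[OF int])
    show "AE t in interval T. norm ((K (f t))\<^sup>2) \<le> norm ((N (f t))\<^sup>2)"
      using fX by eventually_elim (use le Y.nonneg sub in \<open>auto intro!: power_mono\<close>)
  qed (use Y.strongly_measurable_norm[OF sm] in simp)
  with sm show ?thesis by (simp add: bochner_L2_iff)
qed

text \<open>Polarisation: a quarter of the difference of the squared norms of f + g and f - g is the
  inner product, and squared norms of elements of the Bochner space are integrable in time.\<close>

lemma bochner_L2_inner_integrable:
  assumes "f \<in> bochner_L2 T (L2_space M) (L2_norm M)" "g \<in> bochner_L2 T (L2_space M) (L2_norm M)"
  shows "integrable (interval T) (\<lambda>t. L2_inner M (f t) (g t))"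
proof -
  let ?p = "\<lambda>c t x. 1 *\<^sub>R f t x + c *\<^sub>R g t x"
  have int: "integrable (interval T) (\<lambda>t. (L2_norm M (?p c t))\<^sup>2)" for c
    using L2.bochner_L2_lincomb[OF assms, of 1 c] by (simp add: bochner_L2_iff)
  have "integrable (interval T) (\<lambda>t. ((L2_norm M (?p 1 t))\<^sup>2 - (L2_norm M (?p (-1) t))\<^sup>2) / 4)"
    by (intro integrable_divide Bochner_Integration.integrable_diff int)
  moreover have "AE t in interval T.
      ((L2_norm M (?p 1 t))\<^sup>2 - (L2_norm M (?p (-1) t))\<^sup>2) / 4 = L2_inner M (f t) (g t)"
    using bochner_L2_in[OF assms(1)] bochner_L2_in[OF assms(2)]
    by eventually_elim (simp only: L2_norm_sq_lincomb, simp)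
  ultimately show ?thesis
    by (rule integrable_lebesgue_on_cong_AE(1)[rotated]) simp
qed

section \<open>Weak gradients and Sobolev spaces\<close>

lemma L2_inner_cong_AE:
  assumes "f \<in> L2_space M" "f' \<in> L2_space M" "g \<in> L2_space M" "g' \<in> L2_space M"
    "AE x in M. f x = f' x" "AE x in M. g x = g' x"
  shows "L2_inner M f g = L2_inner M f' g'"
  unfolding L2_inner_def
  by (rule integral_cong_AE)
     (use assms in \<open>auto dest!: L2_space_measurable intro!: borel_measurable_inner\<close>)

lemma L2_norm_cong_AE:
  assumes "f \<in> L2_space M" "g \<in> L2_space M" "AE x in M. f x = g x"
  shows "L2_norm M f = L2_norm M g"
proof -
  have "(L2_norm M f)\<^sup>2 = (L2_norm M g)\<^sup>2"
    unfolding L2_norm_sq by (intro L2_inner_cong_AE assms)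
  then show ?thesis
    by (simp add: power2_eq_iff_nonneg L2_norm_nonneg)
qed

lemma integral_lincomb:
  fixes f g :: "'a \<Rightarrow> 'b::euclidean_space"
  assumes "integrable M f" "integrable M g"
  shows "(LINT x|M. a *\<^sub>R f x + b *\<^sub>R g x) = a *\<^sub>R (LINT x|M. f x) + b *\<^sub>R (LINT x|M. g x)"
  using assms by simp

text \<open>The limit \<open>h\<close> is prescribed only a.e. so that it can be
  \<open>wgrad\<close> of a combination, a chosen function that equals the combination of the
  gradients up to a null set.\<close>

lemma L2_converges_lincomb:
  assumes m: "\<And>n. fs n \<in> borel_measurable M" "f \<in> borel_measurable M"
      "\<And>n. gs n \<in> borel_measurable M" "g \<in> borel_measurable M"
    and lim: "L2_converges M fs f" "L2_converges M gs g"
    and h: "AE x in M. h x = a *\<^sub>R f x + b *\<^sub>R g x"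
  shows "L2_converges M (\<lambda>n x. a *\<^sub>R fs n x + b *\<^sub>R gs n x) h"
proof -
  let ?A = "\<lambda>n. \<integral>\<^sup>+x. ennreal ((norm (fs n x - f x))\<^sup>2) \<partial>M"
  let ?B = "\<lambda>n. \<integral>\<^sup>+x. ennreal ((norm (gs n x - g x))\<^sup>2) \<partial>M"
  have bound: "(\<integral>\<^sup>+x. ennreal ((norm ((a *\<^sub>R fs n x + b *\<^sub>R gs n x) - h x))\<^sup>2) \<partial>M)
      \<le> ennreal (2 * a\<^sup>2) * ?A n + ennreal (2 * b\<^sup>2) * ?B n" for n
  proof -
    have "(\<integral>\<^sup>+x. ennreal ((norm ((a *\<^sub>R fs n x + b *\<^sub>R gs n x) - h x))\<^sup>2) \<partial>M)
      \<le> (\<integral>\<^sup>+x. ennreal (2 * a\<^sup>2) * ennreal ((norm (fs n x - f x))\<^sup>2)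
           + ennreal (2 * b\<^sup>2) * ennreal ((norm (gs n x - g x))\<^sup>2) \<partial>M)"
    proof (rule nn_integral_mono_AE)
      show "AE x in M. ennreal ((norm ((a *\<^sub>R fs n x + b *\<^sub>R gs n x) - h x))\<^sup>2)
          \<le> ennreal (2 * a\<^sup>2) * ennreal ((norm (fs n x - f x))\<^sup>2)
            + ennreal (2 * b\<^sup>2) * ennreal ((norm (gs n x - g x))\<^sup>2)"
        using h
      proof eventually_elim
        case (elim x)
        have "(a *\<^sub>R fs n x + b *\<^sub>R gs n x) - h x = a *\<^sub>R (fs n x - f x) + b *\<^sub>R (gs n x - g x)"
          by (simp add: elim algebra_simps)
        then have "(norm ((a *\<^sub>R fs n x + b *\<^sub>R gs n x) - h x))\<^sup>2
            \<le> 2 * a\<^sup>2 * (norm (fs n x - f x))\<^sup>2 + 2 * b\<^sup>2 * (norm (gs n x - g x))\<^sup>2"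
          using norm_add_sq_le[of "a *\<^sub>R (fs n x - f x)" "b *\<^sub>R (gs n x - g x)"]
          by (simp add: power_mult_distrib)
        then show ?case
          by (simp add: ennreal_mult'[symmetric] ennreal_plus[symmetric] del: ennreal_plus)
      qed
    qed
    also have "\<dots> = ennreal (2 * a\<^sup>2) * ?A n + ennreal (2 * b\<^sup>2) * ?B n"
      using m by (subst nn_integral_add) (auto simp: nn_integral_cmult)
    finally show ?thesis .
  qed
  have "(\<lambda>n. ennreal (2 * a\<^sup>2) * ?A n + ennreal (2 * b\<^sup>2) * ?B n)
      \<longlonglongrightarrow> ennreal (2 * a\<^sup>2) * 0 + ennreal (2 * b\<^sup>2) * 0"
    using lim unfolding L2_converges_def by (intro tendsto_add ennreal_tendsto_cmult) simp_all
  then have lim0: "(\<lambda>n. ennreal (2 * a\<^sup>2) * ?A n + ennreal (2 * b\<^sup>2) * ?B n) \<longlonglongrightarrow> 0"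
    by (simp only: mult_zero_right add_0)
  show ?thesis
    unfolding L2_converges_def
    by (rule tendsto_sandwich[OF _ _ tendsto_const lim0]) (simp_all only: bound zero_le eventually_True)
qed

locale bounded_open =
  fixes \<Omega> :: "(real^3) set"
  assumes open_\<Omega>: "open \<Omega>" and bounded_\<Omega>: "bounded \<Omega>"
begin

abbreviation "M \<equiv> lebesgue_on \<Omega>"

lemma sets_\<Omega>: "\<Omega> \<in> sets lebesgue"
  using open_\<Omega> by auto

lemma finite_measure_\<Omega>: "finite_measure M"
proof (rule finite_measureI)
  have "\<Omega> \<in> lmeasurable"
    using bounded_\<Omega> open_\<Omega> by (rule lmeasurable_open)
  then show "emeasure M (space M) \<noteq> \<infinity>"
    using sets_\<Omega> by (auto simp: emeasure_restrict_space fmeasurable_def)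
qed

lemma continuous_measurable:
  fixes f :: "real^3 \<Rightarrow> 'b::euclidean_space"
  assumes "continuous_on UNIV f"
  shows "f \<in> borel_measurable M"
  using assms sets_\<Omega>
  by (intro continuous_imp_measurable_on_sets_lebesgue) (auto intro: continuous_on_subset)

text \<open>A continuous factor is bounded on the compact closure of \<Omega>, and |f| is at most 1
  + |f|^2, which is integrable because \<Omega> has finite measure. It makes the pairings with test
  functions split into sums.\<close>

lemma continuous_times_L2_integrable:
  fixes f :: "real^3 \<Rightarrow> 'b::euclidean_space" and c :: "real^3 \<Rightarrow> real"
  assumes c: "continuous_on UNIV c" and f: "f \<in> L2_space M"
  shows "integrable M (\<lambda>x. c x *\<^sub>R f x)"
proof -
  interpret finite_measure M by (rule finite_measure_\<Omega>)
  have "compact (c ` closure \<Omega>)"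
    using bounded_\<Omega> c by (intro compact_continuous_image) (auto intro: continuous_on_subset)
  then obtain K where K: "\<And>x. x \<in> \<Omega> \<Longrightarrow> \<bar>c x\<bar> \<le> K"
    using compact_imp_bounded[of "c ` closure \<Omega>"] closure_subset
    by (metis bounded_iff imageI real_norm_def subsetD)
  show ?thesis
  proof (rule Bochner_Integration.integrable_bound)
    show "integrable M (\<lambda>x. K * (1 + (norm (f x))\<^sup>2))"
      using f by (simp add: L2_space_def)
    show "(\<lambda>x. c x *\<^sub>R f x) \<in> borel_measurable M"
      using continuous_measurable[OF c] f by (auto dest: L2_space_measurable)
    show "AE x in M. norm (c x *\<^sub>R f x) \<le> norm (K * (1 + (norm (f x))\<^sup>2))"
    proof (rule AE_I2)
      fix x assume "x \<in> space M"
      then have "\<bar>c x\<bar> \<le> K" using K by simp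
      moreover have "norm (f x) \<le> 1 + (norm (f x))\<^sup>2"
        using sum_squares_bound[of 1 "norm (f x)"] norm_ge_zero[of "f x"] by (simp del: norm_ge_zero)
      ultimately have "\<bar>c x\<bar> * norm (f x) \<le> K * (1 + (norm (f x))\<^sup>2)"
        by (intro mult_mono) auto
      then show "norm (c x *\<^sub>R f x) \<le> norm (K * (1 + (norm (f x))\<^sup>2))" by simp
    qed
  qed
qed

lemma test_fun_continuous:
  assumes "test_fun \<Omega> \<phi> d\<phi>"
  shows "continuous_on UNIV \<phi>" "continuous_on UNIV (\<lambda>x. d\<phi> x $ i)"
  using assms cont_grad_continuous[of \<phi> d\<phi>]
  by (auto simp: test_fun_def cont_grad_def intro!: continuous_intros)

lemma component_L2: "G \<in> L2_space M \<Longrightarrow> (\<lambda>x. G x $ i) \<in> L2_space M"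
  by (rule L2_space_bounded_linear[OF _ bounded_linear_vec_nth])

lemma has_weak_grad_lincomb:
  assumes "has_weak_grad \<Omega> v G" "has_weak_grad \<Omega> w H"
  shows "has_weak_grad \<Omega> (\<lambda>x. a *\<^sub>R v x + b *\<^sub>R w x) (\<lambda>x. a *\<^sub>R G x + b *\<^sub>R H x)"
  unfolding has_weak_grad_def
proof (intro conjI allI impI)
  note L2 = assms[unfolded has_weak_grad_def]
  show "(\<lambda>x. a *\<^sub>R v x + b *\<^sub>R w x) \<in> L2_space M" "(\<lambda>x. a *\<^sub>R G x + b *\<^sub>R H x) \<in> L2_space M"
    using L2 by (auto intro: L2_space_lincomb)
  fix \<phi> d\<phi> and i :: 3 assume \<phi>: "test_fun \<Omega> \<phi> d\<phi>"
  note int = continuous_times_L2_integrable[OF test_fun_continuous(2)[OF \<phi>, of i]]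
    continuous_times_L2_integrable[OF test_fun_continuous(1)[OF \<phi>]]
  have "(LINT x|M. (d\<phi> x $ i) *\<^sub>R v x) = - (LINT x|M. \<phi> x *\<^sub>R (G x $ i))"
    "(LINT x|M. (d\<phi> x $ i) *\<^sub>R w x) = - (LINT x|M. \<phi> x *\<^sub>R (H x $ i))"
    using L2 \<phi> by blast+
  moreover have "(\<lambda>x. (d\<phi> x $ i) *\<^sub>R (a *\<^sub>R v x + b *\<^sub>R w x))
      = (\<lambda>x. a *\<^sub>R ((d\<phi> x $ i) *\<^sub>R v x) + b *\<^sub>R ((d\<phi> x $ i) *\<^sub>R w x))"
    "(\<lambda>x. \<phi> x *\<^sub>R ((a *\<^sub>R G x + b *\<^sub>R H x) $ i))
      = (\<lambda>x. a *\<^sub>R (\<phi> x *\<^sub>R (G x $ i)) + b *\<^sub>R (\<phi> x *\<^sub>R (H x $ i)))"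
    by (simp_all add: scaleR_add_right mult.commute)
  ultimately show "(LINT x|M. (d\<phi> x $ i) *\<^sub>R (a *\<^sub>R v x + b *\<^sub>R w x))
      = - (LINT x|M. \<phi> x *\<^sub>R ((a *\<^sub>R G x + b *\<^sub>R H x) $ i))"
    using integral_lincomb[OF int(1)[of v] int(1)[of w], of a b]
      integral_lincomb[OF int(2)[OF component_L2, of G i] int(2)[OF component_L2, of H i], of a b] L2
    by simp
qed

text \<open>Against each test function both gradients give minus the same integral of
  \<open>v\<close> times a partial derivative, so each scalar component of their difference falls to
  the fundamental lemma. Finitely many components leave one null set. This makes the choice in
  \<open>wgrad\<close> harmless.\<close>

lemma weak_grad_unique:
  fixes v :: "real^3 \<Rightarrow> 'b::euclidean_space"
  assumes "has_weak_grad \<Omega> v G" "has_weak_grad \<Omega> v H"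
  shows "AE x in M. G x = H x"
proof -
  have L2: "G \<in> L2_space M" "H \<in> L2_space M"
    using assms by (auto simp: has_weak_grad_def)
  have "AE x in M. (G x $ i - H x $ i) \<bullet> e = 0" for i e
  proof (rule fundamental_lemma_calculus_of_variations[OF open_\<Omega>])
    note int = continuous_times_L2_integrable[OF _ component_L2[OF L2(1)], of _ i]
      continuous_times_L2_integrable[OF _ component_L2[OF L2(2)], of _ i]
    show "integrable M (\<lambda>x. (G x $ i - H x $ i) \<bullet> e)"
      using int[of "\<lambda>_. 1"] by simp
    fix \<phi> d\<phi> assume \<phi>: "test_fun \<Omega> \<phi> d\<phi>"
    note int\<phi> = int[OF test_fun_continuous(1)[OF \<phi>]]
    have "(LINT x|M. (d\<phi> x $ i) *\<^sub>R v x) = - (LINT x|M. \<phi> x *\<^sub>R (G x $ i))"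
      "(LINT x|M. (d\<phi> x $ i) *\<^sub>R v x) = - (LINT x|M. \<phi> x *\<^sub>R (H x $ i))"
      using assms[unfolded has_weak_grad_def] \<phi> by blast+
    then have "(LINT x|M. \<phi> x *\<^sub>R (G x $ i) - \<phi> x *\<^sub>R (H x $ i)) \<bullet> e = 0"
      using int\<phi> by simp
    moreover have "(LINT x|M. \<phi> x *\<^sub>R (G x $ i) - \<phi> x *\<^sub>R (H x $ i)) \<bullet> e
        = (LINT x|M. (\<phi> x *\<^sub>R (G x $ i) - \<phi> x *\<^sub>R (H x $ i)) \<bullet> e)"
      using int\<phi> by (intro integral_inner_left[symmetric]) auto
    ultimately show "(LINT x|M. \<phi> x * ((G x $ i - H x $ i) \<bullet> e)) = 0"
      by (simp add: inner_diff_left right_diff_distrib)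
  qed
  then have "AE x in M. \<forall>i. \<forall>e\<in>Basis. (G x $ i - H x $ i) \<bullet> e = 0"
    by (intro eventually_all_finite eventually_ball_finite ballI) auto
  then show ?thesis
  proof eventually_elim
    case (elim x)
    then have "G x $ i - H x $ i = 0" for i
      by (simp add: euclidean_all_zero_iff)
    then show ?case by (simp add: vec_eq_iff)
  qed
qed

lemma has_weak_grad_wgrad: "v \<in> H1 \<Omega> \<Longrightarrow> has_weak_grad \<Omega> v (wgrad \<Omega> v)"
  unfolding H1_def wgrad_def by (simp add: some_eq_ex)

lemma H1_L2: "v \<in> H1 \<Omega> \<Longrightarrow> v \<in> L2_space M" "v \<in> H1 \<Omega> \<Longrightarrow> wgrad \<Omega> v \<in> L2_space M"
  using has_weak_grad_wgrad[of v] by (auto simp: has_weak_grad_def)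

lemma H1_lincomb: "v \<in> H1 \<Omega> \<Longrightarrow> w \<in> H1 \<Omega> \<Longrightarrow> (\<lambda>x. a *\<^sub>R v x + b *\<^sub>R w x) \<in> H1 \<Omega>"
  unfolding H1_def using has_weak_grad_lincomb by blast

lemma wgrad_lincomb:
  assumes "v \<in> H1 \<Omega>" "w \<in> H1 \<Omega>"
  shows "AE x in M. wgrad \<Omega> (\<lambda>x. a *\<^sub>R v x + b *\<^sub>R w x) x = a *\<^sub>R wgrad \<Omega> v x + b *\<^sub>R wgrad \<Omega> w x"
  by (intro weak_grad_unique[OF has_weak_grad_wgrad has_weak_grad_lincomb] has_weak_grad_wgrad
      H1_lincomb assms)

lemma has_weak_grad_zero: "has_weak_grad \<Omega> (\<lambda>_. 0) (\<lambda>_. 0)"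
  by (simp add: has_weak_grad_def L2_space_zero)

lemma H1_zero_fun: "(\<lambda>_. 0) \<in> H1 \<Omega>"
  using has_weak_grad_zero by (auto simp: H1_def)

lemma wgrad_zero: "AE x in M. wgrad \<Omega> (\<lambda>_. 0 :: 'b::euclidean_space) x = 0"
  using weak_grad_unique[OF has_weak_grad_wgrad[OF H1_zero_fun] has_weak_grad_zero] by simp

lemma H1_norm_lincomb_le:
  assumes "v \<in> H1 \<Omega>" "w \<in> H1 \<Omega>"
  shows "H1_norm \<Omega> (\<lambda>x. a *\<^sub>R v x + b *\<^sub>R w x) \<le> \<bar>a\<bar> * H1_norm \<Omega> v + \<bar>b\<bar> * H1_norm \<Omega> w"
proof -
  let ?N = "L2_norm M" and ?g = "wgrad \<Omega>"
  have "?N (?g (\<lambda>x. a *\<^sub>R v x + b *\<^sub>R w x)) = ?N (\<lambda>x. a *\<^sub>R ?g v x + b *\<^sub>R ?g w x)"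
    by (intro L2_norm_cong_AE wgrad_lincomb assms H1_L2 H1_lincomb L2_space_lincomb)
  then have "H1_norm \<Omega> (\<lambda>x. a *\<^sub>R v x + b *\<^sub>R w x)
      \<le> sqrt ((\<bar>a\<bar> * ?N v + \<bar>b\<bar> * ?N w)\<^sup>2 + (\<bar>a\<bar> * ?N (?g v) + \<bar>b\<bar> * ?N (?g w))\<^sup>2)"
    unfolding H1_norm_def using assms
    by (auto intro!: add_mono power_mono L2_norm_lincomb_le L2_norm_nonneg H1_L2)
  \<comment> \<open>\<open>H1_norm\<close> is the Euclidean length of the pair of norms of the
    function and its gradient, so this is the triangle inequality in the plane.\<close>
  also have "\<dots> \<le> sqrt ((\<bar>a\<bar> * ?N v)\<^sup>2 + (\<bar>a\<bar> * ?N (?g v))\<^sup>2) + sqrt ((\<bar>b\<bar> * ?N w)\<^sup>2 + (\<bar>b\<bar> * ?N (?g w))\<^sup>2)"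
    by (rule real_sqrt_sum_squares_triangle_ineq)
  also have "\<dots> = \<bar>a\<bar> * H1_norm \<Omega> v + \<bar>b\<bar> * H1_norm \<Omega> w"
    by (simp add: H1_norm_def power_mult_distrib real_sqrt_mult flip: distrib_left)
  finally show ?thesis .
qed

section \<open>Boundary traces and the spaces with vanishing trace\<close>

lemma surface_measurable:
  fixes f :: "real^3 \<Rightarrow> 'b::euclidean_space"
  assumes "continuous_on UNIV f"
  shows "f \<in> borel_measurable (surface \<Gamma>)"
proof -
  have "f \<in> borel_measurable borel"
    using assms by (rule borel_measurable_continuous_onI)
  \<comment> \<open>Measurability sees only the sigma-algebra, which \<open>measure_of\<close> takes
    from the Borel sets whatever set function it is given.\<close>
  moreover have "sets (measure_of UNIV (sets borel) hausdorff2) = sets (borel :: (real^3) measure)"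
    using sets.sigma_sets_eq[of borel] by (simp add: sets_measure_of_conv)
  ultimately have "f \<in> borel_measurable (measure_of UNIV (sets borel) hausdorff2)"
    using measurable_cong_sets by blast
  then show ?thesis
    unfolding surface_def by (rule measurable_restrict_space1)
qed

text \<open>One combined sequence of continuously differentiable functions serves all three limits:
  the functions, their gradients, and the values on the boundary. It gives closure of
  \<open>H1_zero\<close> under combinations.\<close>

lemma is_bdry_trace_lincomb:
  fixes v w :: "real^3 \<Rightarrow> 'b::euclidean_space"
  assumes "is_bdry_trace \<Omega> v g" "is_bdry_trace \<Omega> w h"
  shows "is_bdry_trace \<Omega> (\<lambda>x. a *\<^sub>R v x + b *\<^sub>R w x) (\<lambda>x. a *\<^sub>R g x + b *\<^sub>R h x)"
proof -
  let ?S = "surface (frontier \<Omega>)"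
  obtain vs Ds where v: "v \<in> H1 \<Omega>" "g \<in> L2_space ?S"
    "\<And>n x. (vs n has_derivative (\<lambda>h. \<Sum>i\<in>UNIV. (h $ i) *\<^sub>R (Ds n x $ i))) (at x)"
    "\<And>n. continuous_on UNIV (Ds n)" "L2_converges M vs v"
    "L2_converges M Ds (wgrad \<Omega> v)" "L2_converges ?S vs g"
    using assms(1) unfolding is_bdry_trace_def by blast
  obtain ws Es where w: "w \<in> H1 \<Omega>" "h \<in> L2_space ?S"
    "\<And>n x. (ws n has_derivative (\<lambda>h. \<Sum>i\<in>UNIV. (h $ i) *\<^sub>R (Es n x $ i))) (at x)"
    "\<And>n. continuous_on UNIV (Es n)" "L2_converges M ws w"
    "L2_converges M Es (wgrad \<Omega> w)" "L2_converges ?S ws h"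
    using assms(2) unfolding is_bdry_trace_def by blast
  have cont: "continuous_on UNIV (vs n)" "continuous_on UNIV (ws n)" for n
    using v(3) w(3) by (auto intro!: continuous_at_imp_continuous_on has_derivative_continuous)
  note vw = H1_L2(1)[OF v(1), THEN L2_space_measurable] H1_L2(1)[OF w(1), THEN L2_space_measurable]
    H1_L2(2)[OF v(1), THEN L2_space_measurable] H1_L2(2)[OF w(1), THEN L2_space_measurable]
  let ?vs = "\<lambda>n x. a *\<^sub>R vs n x + b *\<^sub>R ws n x" and ?Ds = "\<lambda>n x. a *\<^sub>R Ds n x + b *\<^sub>R Es n x"
  have deriv: "(?vs n has_derivative (\<lambda>h. \<Sum>i\<in>UNIV. (h $ i) *\<^sub>R (?Ds n x $ i))) (at x)" for n x
  proof -
    have "(?vs n has_derivative (\<lambda>h. a *\<^sub>R (\<Sum>i\<in>UNIV. (h $ i) *\<^sub>R (Ds n x $ i))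
        + b *\<^sub>R (\<Sum>i\<in>UNIV. (h $ i) *\<^sub>R (Es n x $ i)))) (at x)"
      by (intro has_derivative_add has_derivative_scaleR_right v w)
    then show ?thesis
      by (simp add: scaleR_sum_right scaleR_add_right sum.distrib mult.commute)
  qed
  have cont_D: "continuous_on UNIV (?Ds n)" for n
    by (intro continuous_intros v w)
  have lim_v: "L2_converges M ?vs (\<lambda>x. a *\<^sub>R v x + b *\<^sub>R w x)"
    by (intro L2_converges_lincomb[OF _ _ _ _ v(5) w(5)] continuous_measurable cont vw) simp
  have lim_D: "L2_converges M ?Ds (wgrad \<Omega> (\<lambda>x. a *\<^sub>R v x + b *\<^sub>R w x))"
    by (intro L2_converges_lincomb[OF _ _ _ _ v(6) w(6)] continuous_measurable wgrad_lincomb vw v w)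
  have lim_S: "L2_converges ?S ?vs (\<lambda>x. a *\<^sub>R g x + b *\<^sub>R h x)"
    by (intro L2_converges_lincomb[OF _ _ _ _ v(7) w(7)] surface_measurable cont
        L2_space_measurable v w) simp
  show ?thesis
    unfolding is_bdry_trace_def
    by (intro conjI exI[of _ ?vs] exI[of _ ?Ds] allI H1_lincomb v(1) w(1) L2_space_lincomb v(2) w(2)
        deriv cont_D lim_v lim_D lim_S)
qed

lemma is_bdry_trace_zero: "is_bdry_trace \<Omega> (\<lambda>_. 0 :: 'b::euclidean_space) (\<lambda>_. 0)"
proof -
  \<comment> \<open>The gradient chosen for the zero function need only be 0 a.e., so convergence of
    the zero sequence to it is checked through the integral.\<close>
  have "(\<integral>\<^sup>+x. ennreal ((norm (0 - wgrad \<Omega> (\<lambda>_. 0 :: 'b) x))\<^sup>2) \<partial>M) = (\<integral>\<^sup>+x. 0 \<partial>M)"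
    by (rule nn_integral_cong_AE) (use wgrad_zero[where 'b = 'b] in \<open>eventually_elim, simp\<close>)
  then have "L2_converges M (\<lambda>_ _. 0) (wgrad \<Omega> (\<lambda>_. 0 :: 'b))"
    by (simp add: L2_converges_def)
  then show ?thesis
    unfolding is_bdry_trace_def
    by (intro conjI H1_zero_fun L2_space_zero exI[of _ "\<lambda>_ _. 0"]) (auto simp: L2_converges_def)
qed

lemma H1_zero_sub: "v \<in> H1_zero \<Omega> \<Gamma> \<Longrightarrow> v \<in> H1 \<Omega>"
  by (simp add: H1_zero_def)

lemma seminormed_H1_zero:
  "seminormed_funs (H1_zero \<Omega> \<Gamma> :: (real^3 \<Rightarrow> 'b::euclidean_space) set) (H1_norm \<Omega>)"
proof
  show "(\<lambda>_. 0) \<in> H1_zero \<Omega> \<Gamma>"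
    using H1_zero_fun is_bdry_trace_zero by (auto simp: H1_zero_def intro!: exI[of _ "\<lambda>_. 0"])
  fix v w :: "real^3 \<Rightarrow> 'b" and a b assume vw: "v \<in> H1_zero \<Omega> \<Gamma>" "w \<in> H1_zero \<Omega> \<Gamma>"
  show "H1_norm \<Omega> (\<lambda>x. a *\<^sub>R v x + b *\<^sub>R w x) \<le> \<bar>a\<bar> * H1_norm \<Omega> v + \<bar>b\<bar> * H1_norm \<Omega> w"
    by (intro H1_norm_lincomb_le H1_zero_sub[OF vw(1)] H1_zero_sub[OF vw(2)])
  obtain g h where g: "is_bdry_trace \<Omega> v g" "AE x in surface (frontier \<Omega>). x \<in> \<Gamma> \<longrightarrow> g x = 0"
    and h: "is_bdry_trace \<Omega> w h" "AE x in surface (frontier \<Omega>). x \<in> \<Gamma> \<longrightarrow> h x = 0"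
    using vw unfolding H1_zero_def by blast
  have "AE x in surface (frontier \<Omega>). x \<in> \<Gamma> \<longrightarrow> a *\<^sub>R g x + b *\<^sub>R h x = 0"
    using g(2) h(2) by eventually_elim simp
  with is_bdry_trace_lincomb[OF g(1) h(1), of a b]
    H1_lincomb[OF H1_zero_sub[OF vw(1)] H1_zero_sub[OF vw(2)], of a b]
  show "(\<lambda>x. a *\<^sub>R v x + b *\<^sub>R w x) \<in> H1_zero \<Omega> \<Gamma>"
    unfolding H1_zero_def by blast
qed (simp add: H1_norm_def)

lemma L2_norm_le_H1_norm: "L2_norm M v \<le> H1_norm \<Omega> v"
  unfolding H1_norm_def by (rule real_le_rsqrt) simp

lemma bochner_H1_zero_L2:
  "f \<in> bochner_L2 T (H1_zero \<Omega> \<Gamma>) (H1_norm \<Omega>) \<Longrightarrow> f \<in> bochner_L2 T (L2_space M) (L2_norm M)"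
  by (rule bochner_L2_weaken[OF _ seminormed_H1_zero L2.seminormed_funs_axioms])
     (auto intro: L2_norm_le_H1_norm H1_L2 dest: H1_zero_sub)

end

section \<open>Space-time inner products\<close>

lemma AE_lebesgue_imp_interval: "AE t in lebesgue. Q t \<Longrightarrow> AE t in interval T. Q t"
  by (subst AE_restrict_space_iff) auto

lemma integrable_interval_restrict:
  fixes f :: "real \<Rightarrow> real"
  assumes "integrable lebesgue f"
  shows "integrable (interval T) f"
  using assms integrable_mult_indicator[of "{0<..<T}" lebesgue f]
  by (subst integrable_restrict_space) auto

text \<open>Elements of \<open>l2real\<close> live on the whole line; restriction to (0,T) keeps
  them square-integrable and does not increase the norm.\<close>

lemma L2_space_interval:
  fixes f :: "real \<Rightarrow> real"
  assumes "f \<in> L2_space lebesgue"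
  shows "f \<in> L2_space (interval T)"
    "(LINT t|interval T. (f t)\<^sup>2) \<le> L2_inner lebesgue f f"
proof -
  have f: "f \<in> borel_measurable lebesgue" "integrable lebesgue (\<lambda>t. (f t)\<^sup>2)"
    using assms by (auto simp: L2_space_def)
  show "f \<in> L2_space (interval T)"
    using f integrable_interval_restrict[OF f(2), of T]
    by (auto simp: L2_space_def measurable_restrict_space1)
  have "(LINT t|interval T. (f t)\<^sup>2) = (LINT t|lebesgue. indicator {0<..<T} t * (f t)\<^sup>2)"
    by (subst integral_restrict_space) auto
  also have "\<dots> \<le> (LINT t|lebesgue. (f t)\<^sup>2)"
    using f(2) integrable_mult_indicator[of "{0<..<T}" lebesgue "\<lambda>t. (f t)\<^sup>2"]
    by (intro integral_mono) (auto simp: indicator_def)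
  finally show "(LINT t|interval T. (f t)\<^sup>2) \<le> L2_inner lebesgue f f"
    by (simp add: L2_inner_def power2_eq_square)
qed

lemma l2_eq_rep: "l2_eq (rep_l2real w) (rep_l2real w)"
  using Quotient_l2real by (rule Quotient_rep_reflp)

lemma rep_l2real_L2: "rep_l2real w \<in> L2_space lebesgue"
  using l2_eq_rep by (simp add: l2_eq_def)

lemma rep_abs_l2real:
  assumes "f \<in> L2_space lebesgue"
  shows "AE t in lebesgue. rep_l2real (abs_l2real f) t = f t"
proof -
  have "l2_eq f f" using assms by (simp add: l2_eq_def)
  then have "l2_eq (rep_l2real (abs_l2real f)) f"
    by (rule Quotient_rep_abs[OF Quotient_l2real])
  then show ?thesis by (simp add: l2_eq_def)
qed

text \<open>Operations on classes are computed on representatives, but the representative chosen for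
  the result is determined only up to a null set.\<close>

lemma rep_l2real_lincomb:
  "AE t in lebesgue. rep_l2real (a *\<^sub>R v + b *\<^sub>R w) t = a * rep_l2real v t + b * rep_l2real w t"
proof -
  have L2: "(\<lambda>t. a * rep_l2real v t) \<in> L2_space lebesgue" "(\<lambda>t. b * rep_l2real w t) \<in> L2_space lebesgue"
    by (intro L2_space_scale rep_l2real_L2)+
  have "a *\<^sub>R v = abs_l2real (\<lambda>t. a * rep_l2real v t)" "b *\<^sub>R w = abs_l2real (\<lambda>t. b * rep_l2real w t)"
    using scaleR_l2real.abs_eq[OF l2_eq_rep, of a v] scaleR_l2real.abs_eq[OF l2_eq_rep, of b w]
    by (simp_all add: Quotient_abs_rep[OF Quotient_l2real])
  then have "a *\<^sub>R v + b *\<^sub>R w = abs_l2real (\<lambda>t. a * rep_l2real v t + b * rep_l2real w t)"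
    using L2 by (simp add: plus_l2real.abs_eq l2_eq_def)
  then show ?thesis
    using rep_abs_l2real[OF L2_space_add[OF L2]] by simp
qed

section \<open>The semi-inner product on pairs of displacement and pressure\<close>

context
  fixes P :: poro
begin

abbreviation (input) "M \<equiv> lebesgue_on (Om P)"

lemma L2L2_integrable:
  "f \<in> L2L2 P \<Longrightarrow> g \<in> L2L2 P \<Longrightarrow> integrable (interval (T_end P)) (\<lambda>t. L2_inner M (f t) (g t))"
  unfolding L2L2_def by (rule bochner_L2_inner_integrable)

lemma L2L2_lincomb:
  "f \<in> L2L2 P \<Longrightarrow> g \<in> L2L2 P \<Longrightarrow> (\<lambda>t x. a *\<^sub>R f t x + b *\<^sub>R g t x) \<in> L2L2 P"
  unfolding L2L2_def by (rule L2.bochner_L2_lincomb)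

lemma L2L2_inner_commute: "L2L2_inner P f g = L2L2_inner P g f"
  unfolding L2L2_inner_def by (subst L2_inner_commute) (rule refl)

lemma L2L2_norm_sq: "(L2L2_norm P f)\<^sup>2 = L2L2_inner P f f"
  by (simp add: L2L2_norm_def bochner_norm_def L2L2_inner_def flip: L2_norm_sq)

lemma L2L2_inner_nonneg: "0 \<le> L2L2_inner P f f"
  unfolding L2L2_norm_sq[symmetric] by simp

lemma L2L2_inner_cong:
  assumes L2: "f \<in> L2L2 P" "f' \<in> L2L2 P" "g \<in> L2L2 P"
    and eq: "AE t in interval (T_end P). AE x in M. f t x = f' t x"
  shows "L2L2_inner P f g = L2L2_inner P f' g"
  unfolding L2L2_inner_def
proof (rule integral_cong_AE)
  have "AE t in interval (T_end P). f t \<in> L2_space M" "AE t in interval (T_end P). f' t \<in> L2_space M"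
      "AE t in interval (T_end P). g t \<in> L2_space M"
    using L2 by (auto simp: L2L2_def bochner_L2_in)
  with eq show "AE t in interval (T_end P). L2_inner M (f t) (g t) = L2_inner M (f' t) (g t)"
    by eventually_elim (intro L2_inner_cong_AE, auto)
qed (use L2 in \<open>auto intro: borel_measurable_integrable L2L2_integrable\<close>)

lemma L2L2_inner_lincomb:
  assumes "f \<in> L2L2 P" "g \<in> L2L2 P" "h \<in> L2L2 P"
  shows "L2L2_inner P (\<lambda>t x. a *\<^sub>R f t x + b *\<^sub>R g t x) h = a * L2L2_inner P f h + b * L2L2_inner P g h"
proof -
  have in_L2: "AE t in interval (T_end P). f t \<in> L2_space M" "AE t in interval (T_end P). g t \<in> L2_space M"
      "AE t in interval (T_end P). h t \<in> L2_space M"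
    using assms by (auto simp: L2L2_def bochner_L2_in)
  have "L2L2_inner P (\<lambda>t x. a *\<^sub>R f t x + b *\<^sub>R g t x) h
      = (LINT t|interval (T_end P). a * L2_inner M (f t) (h t) + b * L2_inner M (g t) (h t))"
    unfolding L2L2_inner_def
  proof (rule integral_cong_AE)
    show "AE t in interval (T_end P). L2_inner M (\<lambda>x. a *\<^sub>R f t x + b *\<^sub>R g t x) (h t)
        = a * L2_inner M (f t) (h t) + b * L2_inner M (g t) (h t)"
      using in_L2 by eventually_elim (rule L2_inner_lincomb)
    show "(\<lambda>t. L2_inner M (\<lambda>x. a *\<^sub>R f t x + b *\<^sub>R g t x) (h t)) \<in> borel_measurable (interval (T_end P))"
      by (intro borel_measurable_integrable L2L2_integrable L2L2_lincomb assms)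
    show "(\<lambda>t. a * L2_inner M (f t) (h t) + b * L2_inner M (g t) (h t)) \<in> borel_measurable (interval (T_end P))"
      by (intro borel_measurable_integrable Bochner_Integration.integrable_add integrable_mult_right
          L2L2_integrable assms)
  qed
  also have "\<dots> = a * L2L2_inner P f h + b * L2L2_inner P g h"
    using integral_lincomb[OF L2L2_integrable[OF assms(1,3)] L2L2_integrable[OF assms(2,3)], of a b]
    by (simp add: L2L2_inner_def)
  finally show ?thesis .
qed

definition state_space :: "((real \<Rightarrow> real^3 \<Rightarrow> real^3) \<times> (real \<Rightarrow> real^3 \<Rightarrow> real)) set" where
  "state_space = L2L2 P \<times> L2L2 P"

definition state_lincomb ::
  "real \<Rightarrow> (real \<Rightarrow> real^3 \<Rightarrow> real^3) \<times> (real \<Rightarrow> real^3 \<Rightarrow> real) \<Rightarrow>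
   real \<Rightarrow> (real \<Rightarrow> real^3 \<Rightarrow> real^3) \<times> (real \<Rightarrow> real^3 \<Rightarrow> real) \<Rightarrow>
   (real \<Rightarrow> real^3 \<Rightarrow> real^3) \<times> (real \<Rightarrow> real^3 \<Rightarrow> real)" where
  "state_lincomb a y b z =
     (\<lambda>t x. a *\<^sub>R fst y t x + b *\<^sub>R fst z t x, \<lambda>t x. a *\<^sub>R snd y t x + b *\<^sub>R snd z t x)"

lemma state_lincomb_in:
  "y \<in> state_space \<Longrightarrow> z \<in> state_space \<Longrightarrow> state_lincomb a y b z \<in> state_space"
  unfolding state_space_def state_lincomb_def mem_Times_iff
  by (auto simp del: real_scaleR_def intro!: L2L2_lincomb)

lemma state_inner_commute: "state_inner P y z = state_inner P z y"
  unfolding state_inner_def by (simp only: L2L2_inner_commute)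

lemma state_inner_nonneg: "0 \<le> state_inner P y y"
  unfolding state_inner_def by (intro add_nonneg_nonneg L2L2_inner_nonneg)

lemma state_inner_lincomb:
  assumes "y \<in> state_space" "z \<in> state_space" "r \<in> state_space"
  shows "state_inner P (state_lincomb a y b z) r = a * state_inner P y r + b * state_inner P z r"
proof -
  have m: "fst y \<in> L2L2 P" "fst z \<in> L2L2 P" "fst r \<in> L2L2 P"
    "snd y \<in> L2L2 P" "snd z \<in> L2L2 P" "snd r \<in> L2L2 P"
    using assms by (auto simp: state_space_def)
  show ?thesis
    unfolding state_inner_def state_lincomb_def fst_conv snd_conv
      L2L2_inner_lincomb[OF m(1-3)] L2L2_inner_lincomb[OF m(4-6)]
    by (simp add: algebra_simps)
qed

lemma state_inner_lincomb_sq: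
  assumes "y \<in> state_space" "z \<in> state_space"
  shows "state_inner P (state_lincomb a y b z) (state_lincomb a y b z)
     = a\<^sup>2 * state_inner P y y + 2 * a * b * state_inner P y z + b\<^sup>2 * state_inner P z z"
proof -
  let ?l = "state_lincomb a y b z"
  have "state_inner P ?l ?l = a * state_inner P ?l y + b * state_inner P ?l z"
    unfolding state_inner_lincomb[OF assms state_lincomb_in[OF assms]]
    by (simp only: state_inner_commute[of y ?l] state_inner_commute[of z ?l])
  also have "\<dots> = a * (a * state_inner P y y + b * state_inner P y z)
      + b * (a * state_inner P y z + b * state_inner P z z)"
    unfolding state_inner_lincomb[OF assms assms(1)] state_inner_lincomb[OF assms assms(2)]
      state_inner_commute[of z y] ..
  finally show ?thesis
    by (simp add: power2_eq_square algebra_simps)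
qed

text \<open>An additive form of the Cauchy-Schwarz inequality, from the squares of y + z and y - z.
  It suffices because a bound by products of norms is recovered later by scaling.\<close>

lemma abs_state_inner_le:
  assumes "y \<in> state_space" "z \<in> state_space"
  shows "\<bar>state_inner P y z\<bar> \<le> (state_inner P y y + state_inner P z z) / 2"
  using state_inner_nonneg[of "state_lincomb 1 y 1 z"] state_inner_nonneg[of "state_lincomb 1 y (-1) z"]
  unfolding state_inner_lincomb_sq[OF assms] by simp

text \<open>Uniqueness of solutions is a.e. in space at a.e. time; this lets any solution stand in
  for the one selected by \<open>solution_op\<close>.\<close>

lemma state_inner_cong:
  assumes "y \<in> state_space" "y' \<in> state_space" "r \<in> state_space"
    and eq: "AE t in interval (T_end P). AE x in M. fst y t x = fst y' t x \<and> snd y t x = snd y' t x"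
  shows "state_inner P y r = state_inner P y' r"
proof -
  have "AE t in interval (T_end P). AE x in M. fst y t x = fst y' t x"
    "AE t in interval (T_end P). AE x in M. snd y t x = snd y' t x"
    using eq by (auto elim!: eventually_mono)
  then have "L2L2_inner P (fst y) (fst r) = L2L2_inner P (fst y') (fst r)"
    "L2L2_inner P (snd y) (snd r) = L2L2_inner P (snd y') (snd r)"
    using assms(1-3) by (auto simp: state_space_def intro: L2L2_inner_cong)
  then show ?thesis by (simp add: state_inner_def)
qed

end

section \<open>Superposition for weak solutions\<close>

lemma bounded_linear_transpose: "bounded_linear (transpose :: real^'n^'m \<Rightarrow> real^'m^'n)"
  by (intro linear_conv_bounded_linear[THEN iffD1] linearI) (auto simp: transpose_def vec_eq_iff)

lemma bounded_linear_trace: "bounded_linear (trace :: real^'n^'n \<Rightarrow> real)"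
  by (intro linear_conv_bounded_linear[THEN iffD1] linearI) (auto simp: trace_def sum.distrib sum_distrib_left)

text \<open>Hooke's law of an isotropic medium with Lame parameters \<open>m\<close> (shear) and
  \<open>l\<close>. The viscous and the elastic part of the stress both have this form, with the
  gradients of velocity and displacement as \<open>A\<close>.\<close>

definition isotropic_stress :: "real \<Rightarrow> real \<Rightarrow> real^3^3 \<Rightarrow> real^3^3" where
  "isotropic_stress m l A = m *\<^sub>R (A + transpose A) + (l * trace A) *\<^sub>R mat 1"

lemma bounded_linear_isotropic_stress: "bounded_linear (isotropic_stress m l)"
proof -
  have "bounded_linear (\<lambda>A. m *\<^sub>R (A + transpose A) + (l *\<^sub>R trace A) *\<^sub>R (mat 1 :: real^3^3))"
    by (intro bounded_linear_add bounded_linear_const_scaleR bounded_linear_scaleR_const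
        bounded_linear_ident bounded_linear_transpose bounded_linear_trace)
  then show ?thesis by (simp add: isotropic_stress_def[abs_def])
qed

locale poro_problem =
  fixes P :: poro
  assumes setting: "poro_setting P"
begin

sublocale bounded_open "Om P"
  by unfold_locales (use setting in \<open>auto simp: poro_setting_def lipschitz_domain_def\<close>)

sublocale disp: seminormed_funs "disp_space P" "H1_norm (Om P)"
  unfolding disp_space_def by (rule seminormed_H1_zero)

sublocale pres: seminormed_funs "pres_space P" "H1_norm (Om P)"
  unfolding pres_space_def by (rule seminormed_H1_zero)

lemma disp_H1: "z \<in> disp_space P \<Longrightarrow> z \<in> H1 (Om P)"
  unfolding disp_space_def by (rule H1_zero_sub)

lemma pres_H1: "q \<in> pres_space P \<Longrightarrow> q \<in> H1 (Om P)"
  unfolding pres_space_def by (rule H1_zero_sub)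

lemma disp_AE_H1:
  assumes "u \<in> bochner_L2 T (disp_space P) N"
  shows "AE t in interval T. u t \<in> H1 (Om P)"
  using bochner_L2_in[OF assms] by eventually_elim (rule disp_H1)

lemma pres_AE_H1:
  assumes "p \<in> bochner_L2 T (pres_space P) N"
  shows "AE t in interval T. p t \<in> H1 (Om P)"
  using bochner_L2_in[OF assms] by eventually_elim (rule pres_H1)

lemma stress_eq:
  "stress P \<delta> u ut p x = isotropic_stress (\<delta> * mu_v P) (\<delta> * lam_v P) (wgrad (Om P) ut x)
     + isotropic_stress (mu_e P) (lam_e P) (wgrad (Om P) u x) - p x *\<^sub>R mat 1"
  by (simp add: stress_def isotropic_stress_def wdiv_def)

lemma stress_0: "stress P 0 u ut p = stress P 0 u ut' p"
  by (rule ext) (simp add: stress_def)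

lemma stress_L2:
  assumes "u \<in> H1 (Om P)" "ut \<in> H1 (Om P)" "p \<in> H1 (Om P)"
  shows "stress P \<delta> u ut p \<in> L2_space M"
  unfolding stress_eq[abs_def]
  by (intro L2_space_diff L2_space_plus L2_space_bounded_linear[OF _ bounded_linear_isotropic_stress]
      L2_space_bounded_linear[OF _ bounded_linear_scaleR_left] H1_L2 assms)

lemma stress_lincomb:
  assumes "u1 \<in> H1 (Om P)" "u2 \<in> H1 (Om P)" "ut1 \<in> H1 (Om P)" "ut2 \<in> H1 (Om P)"
  shows "AE x in M. stress P \<delta> (\<lambda>x. a *\<^sub>R u1 x + b *\<^sub>R u2 x) (\<lambda>x. a *\<^sub>R ut1 x + b *\<^sub>R ut2 x)
       (\<lambda>x. a *\<^sub>R p1 x + b *\<^sub>R p2 x) x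
     = a *\<^sub>R stress P \<delta> u1 ut1 p1 x + b *\<^sub>R stress P \<delta> u2 ut2 p2 x"
  using wgrad_lincomb[OF assms(1,2), of a b] wgrad_lincomb[OF assms(3,4), of a b]
proof eventually_elim
  case (elim x)
  have lin: "linear (isotropic_stress m l)" for m l
    using bounded_linear_isotropic_stress by (rule bounded_linear.linear)
  show ?case
    unfolding stress_eq elim linear_add[OF lin] linear_scale[OF lin]
    by (simp add: algebra_simps)
qed

lemma stress_test_lincomb:
  assumes "u1 \<in> H1 (Om P)" "u2 \<in> H1 (Om P)" "ut1 \<in> H1 (Om P)" "ut2 \<in> H1 (Om P)"
    "p1 \<in> H1 (Om P)" "p2 \<in> H1 (Om P)" "z \<in> H1 (Om P)"
  shows "L2_inner M (stress P \<delta> (\<lambda>x. a *\<^sub>R u1 x + b *\<^sub>R u2 x) (\<lambda>x. a *\<^sub>R ut1 x + b *\<^sub>R ut2 x)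
       (\<lambda>x. a *\<^sub>R p1 x + b *\<^sub>R p2 x)) (wgrad (Om P) z)
     = a * L2_inner M (stress P \<delta> u1 ut1 p1) (wgrad (Om P) z)
       + b * L2_inner M (stress P \<delta> u2 ut2 p2) (wgrad (Om P) z)"
proof -
  have "L2_inner M (stress P \<delta> (\<lambda>x. a *\<^sub>R u1 x + b *\<^sub>R u2 x) (\<lambda>x. a *\<^sub>R ut1 x + b *\<^sub>R ut2 x)
       (\<lambda>x. a *\<^sub>R p1 x + b *\<^sub>R p2 x)) (wgrad (Om P) z)
      = L2_inner M (\<lambda>x. a *\<^sub>R stress P \<delta> u1 ut1 p1 x + b *\<^sub>R stress P \<delta> u2 ut2 p2 x) (wgrad (Om P) z)"
    by (intro L2_inner_cong_AE stress_L2 L2_space_lincomb H1_lincomb H1_L2 stress_lincomb assms AE_I2 refl)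
  also have "\<dots> = a * L2_inner M (stress P \<delta> u1 ut1 p1) (wgrad (Om P) z)
       + b * L2_inner M (stress P \<delta> u2 ut2 p2) (wgrad (Om P) z)"
    by (intro L2_inner_lincomb stress_L2 H1_L2 assms)
  finally show ?thesis .
qed

definition flow_form ::
  "(real^3 \<Rightarrow> real^3) \<Rightarrow> (real^3 \<Rightarrow> real) \<Rightarrow> (real^3 \<Rightarrow> real) \<Rightarrow> (real^3 \<Rightarrow> real) \<Rightarrow> real" where
  "flow_form u p q qt = - L2_inner M (wdiv (Om P) u) qt
     + perm P * L2_inner M (wgrad (Om P) p) (wgrad (Om P) q)"

lemma wdiv_L2: "u \<in> H1 (Om P) \<Longrightarrow> wdiv (Om P) u \<in> L2_space M"
  unfolding wdiv_def[abs_def] by (intro L2_space_bounded_linear[OF _ bounded_linear_trace] H1_L2)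

lemma wdiv_lincomb:
  assumes "u1 \<in> H1 (Om P)" "u2 \<in> H1 (Om P)"
  shows "AE x in M. wdiv (Om P) (\<lambda>x. a *\<^sub>R u1 x + b *\<^sub>R u2 x) x
     = a *\<^sub>R wdiv (Om P) u1 x + b *\<^sub>R wdiv (Om P) u2 x"
  using wgrad_lincomb[OF assms, of a b]
  by eventually_elim (simp add: wdiv_def trace_def sum.distrib sum_distrib_left)

lemma flow_form_lincomb:
  assumes u: "u1 \<in> H1 (Om P)" "u2 \<in> H1 (Om P)" and p: "p1 \<in> H1 (Om P)" "p2 \<in> H1 (Om P)"
    and q: "q \<in> H1 (Om P)" "qt \<in> H1 (Om P)"
  shows "flow_form (\<lambda>x. a *\<^sub>R u1 x + b *\<^sub>R u2 x) (\<lambda>x. a *\<^sub>R p1 x + b *\<^sub>R p2 x) q qt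
     = a * flow_form u1 p1 q qt + b * flow_form u2 p2 q qt"
proof -
  have "L2_inner M (wdiv (Om P) (\<lambda>x. a *\<^sub>R u1 x + b *\<^sub>R u2 x)) qt
      = L2_inner M (\<lambda>x. a *\<^sub>R wdiv (Om P) u1 x + b *\<^sub>R wdiv (Om P) u2 x) qt"
    by (intro L2_inner_cong_AE wdiv_L2 L2_space_lincomb H1_lincomb H1_L2 wdiv_lincomb u q AE_I2 refl)
  also have "\<dots> = a * L2_inner M (wdiv (Om P) u1) qt + b * L2_inner M (wdiv (Om P) u2) qt"
    by (intro L2_inner_lincomb wdiv_L2 H1_L2 u q)
  finally have div: "L2_inner M (wdiv (Om P) (\<lambda>x. a *\<^sub>R u1 x + b *\<^sub>R u2 x)) qt
      = a * L2_inner M (wdiv (Om P) u1) qt + b * L2_inner M (wdiv (Om P) u2) qt" .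
  have "L2_inner M (wgrad (Om P) (\<lambda>x. a *\<^sub>R p1 x + b *\<^sub>R p2 x)) (wgrad (Om P) q)
      = L2_inner M (\<lambda>x. a *\<^sub>R wgrad (Om P) p1 x + b *\<^sub>R wgrad (Om P) p2 x) (wgrad (Om P) q)"
    by (intro L2_inner_cong_AE L2_space_lincomb H1_lincomb H1_L2 wgrad_lincomb p q AE_I2 refl)
  also have "\<dots> = a * L2_inner M (wgrad (Om P) p1) (wgrad (Om P) q)
      + b * L2_inner M (wgrad (Om P) p2) (wgrad (Om P) q)"
    by (intro L2_inner_lincomb H1_L2 p q)
  finally show ?thesis
    unfolding flow_form_def div by (simp add: algebra_simps)
qed

text \<open>What the spatial profile contributes to the right-hand side of the flow equation once
  the time factor of the control is pulled out. The flux carries the minus sign of the weak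
  formulation.\<close>

definition load :: "control_kind \<Rightarrow> (real^3 \<Rightarrow> real) \<Rightarrow> (real^3 \<Rightarrow> real) \<Rightarrow> real" where
  "load kind \<eta> q = (case kind of
       Source_control \<Rightarrow> L2_inner M \<eta> q
     | Flux_control \<Rightarrow> - (LINT x|surface (Gam_Dv P). \<eta> x * bdry_trace (Om P) q x))"

abbreviation zero_data_solution where
  "zero_data_solution \<delta> kind \<eta> w u p \<equiv> controlled_solution P \<delta> kind \<eta> w
     (\<lambda>_. 0) (\<lambda>_ _. 0) (\<lambda>_ _. 0) (\<lambda>_ _. 0) (\<lambda>_ _. 0) u p"

text \<open>Disposes of the initial-value term for zero initial displacement, whose chosen
  divergence is 0 only almost everywhere.\<close>

lemma wdiv_zero_inner: "L2_inner M (wdiv (Om P) (\<lambda>_. 0)) q = 0"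
  unfolding L2_inner_def
  by (rule integral_eq_zero_AE)
     (use wgrad_zero[where 'b = "real^3"] in \<open>eventually_elim, simp add: wdiv_def trace_def\<close>)

text \<open>With the zero terms removed and both kinds of control written through
  \<open>load\<close>, the weak formulation is visibly homogeneous, and superposition needs only one
  proof.\<close>

lemma zero_data_solution_iff:
  "zero_data_solution \<delta> kind \<eta> w u p \<longleftrightarrow>
     u \<in> bochner_L2 (T_end P) (disp_space P) (H1_norm (Om P)) \<and>
     p \<in> bochner_L2 (T_end P) (pres_space P) (H1_norm (Om P)) \<and>
     (\<exists>ut.
        (\<delta> > 0 \<longrightarrow>
           has_time_deriv (T_end P) (disp_space P) (H1_norm (Om P)) u ut \<and>
           has_time_value (T_end P) (disp_space P) (H1_norm (Om P)) u 0 (\<lambda>_. 0)) \<and>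
        (AE t in interval (T_end P). \<forall>z\<in>disp_space P.
           L2_inner M (stress P \<delta> (u t) (ut t) (p t)) (wgrad (Om P) z) = 0)) \<and>
     (\<forall>q qt q0.
        has_time_deriv (T_end P) (pres_space P) (H1_norm (Om P)) q qt \<and>
        has_time_value (T_end P) (pres_space P) (H1_norm (Om P)) q (T_end P) (\<lambda>_. 0) \<and>
        has_time_value (T_end P) (pres_space P) (H1_norm (Om P)) q 0 q0 \<longrightarrow>
          integrable (interval (T_end P)) (\<lambda>t. flow_form (u t) (p t) (q t) (qt t)) \<and>
          integrable (interval (T_end P)) (\<lambda>t. w t * load kind \<eta> (q t)) \<and>
          (LINT t|interval (T_end P). flow_form (u t) (p t) (q t) (qt t))
            = (LINT t|interval (T_end P). w t * load kind \<eta> (q t)))"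
proof -
  have zero: "L2_inner N (\<lambda>_. 0) q = 0" for N :: "(real^3) measure" and q :: "real^3 \<Rightarrow> real"
    by (simp add: L2_inner_def)
  have source: "L2_inner N (\<lambda>x. c * \<eta> x) q = c * L2_inner N \<eta> q"
    for N :: "(real^3) measure" and q :: "real^3 \<Rightarrow> real" and c
    by (simp add: L2_inner_def mult.assoc)
  have flux: "(LINT x|N. c * \<eta> x * g x) = c * (LINT x|N. \<eta> x * g x)"
    for N :: "(real^3) measure" and g c
    by (simp add: mult.assoc)
  show ?thesis
    unfolding controlled_solution_def with_control_def weak_solution_def Let_def
    by (cases kind)
       (simp_all add: zero source flux wdiv_zero_inner flow_form_def load_def flip: L2_inner_def)
qed

text \<open>For \<open>\<delta> = 0\<close> the stress does not depend on the time derivative, which may therefore be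
  replaced by zero.\<close>

lemma zero_data_solution_equilibrium:
  assumes "zero_data_solution \<delta> kind \<eta> w u p" "0 \<le> \<delta>"
  obtains ut where "AE t in interval (T_end P). ut t \<in> disp_space P"
    "\<delta> > 0 \<longrightarrow> has_time_deriv (T_end P) (disp_space P) (H1_norm (Om P)) u ut \<and>
       has_time_value (T_end P) (disp_space P) (H1_norm (Om P)) u 0 (\<lambda>_. 0)"
    "AE t in interval (T_end P). \<forall>z\<in>disp_space P.
       L2_inner M (stress P \<delta> (u t) (ut t) (p t)) (wgrad (Om P) z) = 0"
proof -
  obtain ut where ut: "\<delta> > 0 \<longrightarrow> has_time_deriv (T_end P) (disp_space P) (H1_norm (Om P)) u ut \<and>
       has_time_value (T_end P) (disp_space P) (H1_norm (Om P)) u 0 (\<lambda>_. 0)"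
    "AE t in interval (T_end P). \<forall>z\<in>disp_space P.
       L2_inner M (stress P \<delta> (u t) (ut t) (p t)) (wgrad (Om P) z) = 0"
    using assms(1) unfolding zero_data_solution_iff by blast
  show ?thesis
  proof (cases "\<delta> > 0")
    case True
    then have "AE t in interval (T_end P). ut t \<in> disp_space P"
      using ut(1) by (auto simp: has_time_deriv_def bochner_L2_in)
    then show ?thesis using ut by (rule that)
  next
    case False
    then have \<delta>: "\<delta> = 0" using assms(2) by simp
    show ?thesis
    proof (rule that)
      show "AE t in interval (T_end P). (\<lambda>t _. 0) t \<in> disp_space P"
        using disp.zero_in by simp
      show "AE t in interval (T_end P). \<forall>z\<in>disp_space P.
          L2_inner M (stress P \<delta> (u t) ((\<lambda>t _. 0) t) (p t)) (wgrad (Om P) z) = 0"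
      proof -
        have "stress P \<delta> (u t) (ut t) (p t) = stress P \<delta> (u t) (\<lambda>_. 0) (p t)" for t
          unfolding \<delta> by (rule stress_0)
        with ut(2) show ?thesis by simp
      qed
    qed (use False in simp)
  qed
qed

text \<open>For fixed test functions both equations are linear in the fields and the control. The
  relation between the controls is assumed only a.e., since it will be applied to chosen
  representatives.\<close>

lemma zero_data_solution_lincomb:
  assumes s1: "zero_data_solution \<delta> kind \<eta> w1 u1 p1" and s2: "zero_data_solution \<delta> kind \<eta> w2 u2 p2"
    and w: "AE t in interval (T_end P). w t = a * w1 t + b * w2 t" and "0 \<le> \<delta>"
  shows "zero_data_solution \<delta> kind \<eta> w
    (\<lambda>t x. a *\<^sub>R u1 t x + b *\<^sub>R u2 t x) (\<lambda>t x. a *\<^sub>R p1 t x + b *\<^sub>R p2 t x)"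
proof -
  let ?I = "interval (T_end P)" and ?N = "H1_norm (Om P)"
  let ?u = "\<lambda>t x. a *\<^sub>R u1 t x + b *\<^sub>R u2 t x" and ?p = "\<lambda>t x. a *\<^sub>R p1 t x + b *\<^sub>R p2 t x"
  have T: "0 < T_end P" using setting by (simp add: poro_setting_def)
  note s = s1[unfolded zero_data_solution_iff] s2[unfolded zero_data_solution_iff]
  have u12: "u1 \<in> bochner_L2 (T_end P) (disp_space P) ?N" "u2 \<in> bochner_L2 (T_end P) (disp_space P) ?N"
    and p12: "p1 \<in> bochner_L2 (T_end P) (pres_space P) ?N" "p2 \<in> bochner_L2 (T_end P) (pres_space P) ?N"
    using s by blast+
  have u_in: "AE t in ?I. u1 t \<in> H1 (Om P)" "AE t in ?I. u2 t \<in> H1 (Om P)"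
    by (fact disp_AE_H1[OF u12(1)] disp_AE_H1[OF u12(2)])+
  have p_in: "AE t in ?I. p1 t \<in> H1 (Om P)" "AE t in ?I. p2 t \<in> H1 (Om P)"
    by (fact pres_AE_H1[OF p12(1)] pres_AE_H1[OF p12(2)])+
  obtain v1 where v1: "AE t in ?I. v1 t \<in> disp_space P"
    "\<delta> > 0 \<longrightarrow> has_time_deriv (T_end P) (disp_space P) ?N u1 v1 \<and>
       has_time_value (T_end P) (disp_space P) ?N u1 0 (\<lambda>_. 0)"
    "AE t in ?I. \<forall>z\<in>disp_space P. L2_inner M (stress P \<delta> (u1 t) (v1 t) (p1 t)) (wgrad (Om P) z) = 0"
    by (rule zero_data_solution_equilibrium[OF s1 \<open>0 \<le> \<delta>\<close>])
  obtain v2 where v2: "AE t in ?I. v2 t \<in> disp_space P"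
    "\<delta> > 0 \<longrightarrow> has_time_deriv (T_end P) (disp_space P) ?N u2 v2 \<and>
       has_time_value (T_end P) (disp_space P) ?N u2 0 (\<lambda>_. 0)"
    "AE t in ?I. \<forall>z\<in>disp_space P. L2_inner M (stress P \<delta> (u2 t) (v2 t) (p2 t)) (wgrad (Om P) z) = 0"
    by (rule zero_data_solution_equilibrium[OF s2 \<open>0 \<le> \<delta>\<close>])
  let ?v = "\<lambda>t x. a *\<^sub>R v1 t x + b *\<^sub>R v2 t x"
  have time: "has_time_deriv (T_end P) (disp_space P) ?N ?u ?v \<and>
       has_time_value (T_end P) (disp_space P) ?N ?u 0 (\<lambda>_. 0)" if "\<delta> > 0"
    using disp.has_time_deriv_lincomb[of "T_end P" u1 v1 u2 v2 a b]
      disp.has_time_value_lincomb[of "T_end P" u1 0 "\<lambda>_. 0" u2 "\<lambda>_. 0" a b] v1(2) v2(2) that T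
    by simp
  \<comment> \<open>The exceptional times must not depend on \<open>z\<close>: at every time at
    which all the fields are in \<open>H1\<close>, linearity of the stress holds for all test
    functions at once.\<close>
  have equil: "AE t in ?I. \<forall>z\<in>disp_space P.
      L2_inner M (stress P \<delta> (?u t) (?v t) (?p t)) (wgrad (Om P) z) = 0"
    using u_in p_in v1(1,3) v2(1,3)
  proof eventually_elim
    case (elim t)
    show ?case
    proof
      fix z assume z: "z \<in> disp_space P"
      have zero: "L2_inner M (stress P \<delta> (u1 t) (v1 t) (p1 t)) (wgrad (Om P) z) = 0"
        "L2_inner M (stress P \<delta> (u2 t) (v2 t) (p2 t)) (wgrad (Om P) z) = 0"
        using elim(6,8) z by blast+
      show "L2_inner M (stress P \<delta> (?u t) (?v t) (?p t)) (wgrad (Om P) z) = 0"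
        unfolding stress_test_lincomb[OF elim(1,2) disp_H1[OF elim(5)] disp_H1[OF elim(7)]
            elim(3,4) disp_H1[OF z]] zero by simp
    qed
  qed
  have flow: "integrable ?I (\<lambda>t. flow_form (?u t) (?p t) (q t) (qt t)) \<and>
      integrable ?I (\<lambda>t. w t * load kind \<eta> (q t)) \<and>
      (LINT t|?I. flow_form (?u t) (?p t) (q t) (qt t)) = (LINT t|?I. w t * load kind \<eta> (q t))"
    if q: "has_time_deriv (T_end P) (pres_space P) ?N q qt \<and>
        has_time_value (T_end P) (pres_space P) ?N q (T_end P) (\<lambda>_. 0) \<and>
        has_time_value (T_end P) (pres_space P) ?N q 0 q0" for q qt q0
  proof -
    have 1: "integrable ?I (\<lambda>t. flow_form (u1 t) (p1 t) (q t) (qt t))"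
      "integrable ?I (\<lambda>t. w1 t * load kind \<eta> (q t))"
      "(LINT t|?I. flow_form (u1 t) (p1 t) (q t) (qt t)) = (LINT t|?I. w1 t * load kind \<eta> (q t))"
      using s(1) q by blast+
    have 2: "integrable ?I (\<lambda>t. flow_form (u2 t) (p2 t) (q t) (qt t))"
      "integrable ?I (\<lambda>t. w2 t * load kind \<eta> (q t))"
      "(LINT t|?I. flow_form (u2 t) (p2 t) (q t) (qt t)) = (LINT t|?I. w2 t * load kind \<eta> (q t))"
      using s(2) q by blast+
    have S: "{0<..<T_end P} \<in> sets lebesgue" by simp
    let ?f = "\<lambda>t. a * flow_form (u1 t) (p1 t) (q t) (qt t) + b * flow_form (u2 t) (p2 t) (q t) (qt t)"
    let ?l = "\<lambda>t. a * (w1 t * load kind \<eta> (q t)) + b * (w2 t * load kind \<eta> (q t))"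
    have f: "integrable ?I ?f" "integrable ?I ?l"
      using 1 2 by auto
    have eq: "(LINT t|?I. ?f t) = (LINT t|?I. ?l t)"
      using 1 2 by simp
    have "AE t in ?I. q t \<in> pres_space P" "AE t in ?I. qt t \<in> pres_space P"
      using q by (auto simp: has_time_deriv_def bochner_L2_in)
    with u_in p_in have flow_eq: "AE t in ?I. ?f t = flow_form (?u t) (?p t) (q t) (qt t)"
      by eventually_elim (rule flow_form_lincomb[symmetric], auto intro: pres_H1)
    have load_eq: "AE t in ?I. ?l t = w t * load kind \<eta> (q t)"
      using w by eventually_elim (simp add: algebra_simps)
    show ?thesis
      \<comment> \<open>The integrands for the combined fields and for \<open>w\<close> inherit
        integrability from a.e. equal combinations of integrable ones.\<close>
      using integrable_lebesgue_on_cong_AE[OF S f(1) flow_eq]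
        integrable_lebesgue_on_cong_AE[OF S f(2) load_eq] eq by simp
  qed
  show ?thesis
    unfolding zero_data_solution_iff
    by (intro conjI[OF disp.bochner_L2_lincomb[OF u12]] conjI[OF pres.bochner_L2_lincomb[OF p12]]
        conjI[OF exI[of _ ?v]] conjI[OF impI[OF time] equil] allI impI flow)
qed

end

section \<open>The solution operator\<close>

lemma bochner_norm_separated:
  "(bochner_norm T (L2_norm N) (\<lambda>t x. w t * \<eta> x))\<^sup>2
     = (LINT t|interval T. (w t)\<^sup>2) * (L2_norm N \<eta>)\<^sup>2"
proof -
  have "(L2_norm N (\<lambda>x. c * \<eta> x))\<^sup>2 = c\<^sup>2 * (L2_norm N \<eta>)\<^sup>2" for c
    by (simp add: L2_norm_def power_mult_distrib)
  then show ?thesis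
    by (simp add: bochner_norm_def)
qed

context poro_problem
begin

lemma F_space_zero: "(\<lambda>_ _. 0) \<in> F_space P \<delta>"
  unfolding F_space_def
  by (cases "\<delta> = 0") (simp_all add: bochner_H1_zero bochner_L2_zero L2.zero_in L2.zero_N)

lemma g_space_zero: "(\<lambda>_ _. 0) \<in> g_space P \<delta>"
proof -
  have "(\<lambda>_. 0) \<in> Hhalf (Gam_N P)" "Hhalf_norm (Gam_N P) (\<lambda>_. 0) = 0"
    by (simp_all add: Hhalf_def Hhalf_norm_def Hhalf_sq_def)
  then show ?thesis
    unfolding g_space_def
    using bochner_H1_zero[where N = "Hhalf_norm (Gam_N P)"] bochner_L2_zero[where N = "Hhalf_norm (Gam_N P)"]
    by (cases "\<delta> = 0") simp_all
qed

lemma L2L2_zero: "(\<lambda>_ _. 0) \<in> L2L2 P"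
  unfolding L2L2_def by (rule bochner_L2_zero[where N = "L2_norm M", OF L2.zero_in L2.zero_N])

lemma disp_L2L2: "u \<in> bochner_L2 (T_end P) (disp_space P) (H1_norm (Om P)) \<Longrightarrow> u \<in> L2L2 P"
  unfolding L2L2_def disp_space_def by (rule bochner_H1_zero_L2)

lemma pres_L2L2: "p \<in> bochner_L2 (T_end P) (pres_space P) (H1_norm (Om P)) \<Longrightarrow> p \<in> L2L2 P"
  unfolding L2L2_def pres_space_def by (rule bochner_H1_zero_L2)

lemma controlled_solution_L2L2:
  assumes "controlled_solution P \<delta> kind \<eta> w u0 F S g \<psi> u p"
  shows "u \<in> L2L2 P" "p \<in> L2L2 P"
  using assms disp_L2L2 pres_L2L2
  by (auto simp: controlled_solution_def weak_solution_def split: prod.splits)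

lemma L2L2_norm_le_H1:
  assumes "u \<in> bochner_L2 (T_end P) (disp_space P) (H1_norm (Om P))"
    and "p \<in> bochner_L2 (T_end P) (pres_space P) (H1_norm (Om P))"
  shows "L2L2_inner P u u + L2L2_inner P p p
    \<le> (LINT t|interval (T_end P). (H1_norm (Om P) (p t))\<^sup>2 + (H1_norm (Om P) (u t))\<^sup>2)"
proof -
  have int: "integrable (interval (T_end P)) (\<lambda>t. (H1_norm (Om P) (u t))\<^sup>2)"
    "integrable (interval (T_end P)) (\<lambda>t. (H1_norm (Om P) (p t))\<^sup>2)"
    using assms by (auto simp: bochner_L2_def)
  have "L2L2_inner P u u + L2L2_inner P p p
      = (LINT t|interval (T_end P). L2_inner M (u t) (u t) + L2_inner M (p t) (p t))"
    unfolding L2L2_inner_def using assms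
    by (intro Bochner_Integration.integral_add[symmetric] L2L2_integrable disp_L2L2 pres_L2L2)
  also have "\<dots> \<le> (LINT t|interval (T_end P). (H1_norm (Om P) (p t))\<^sup>2 + (H1_norm (Om P) (u t))\<^sup>2)"
  proof (rule integral_mono)
    fix t
    have "(L2_norm M (u t))\<^sup>2 \<le> (H1_norm (Om P) (u t))\<^sup>2" "(L2_norm M (p t))\<^sup>2 \<le> (H1_norm (Om P) (p t))\<^sup>2"
      by (intro power_mono L2_norm_le_H1_norm L2_norm_nonneg)+
    then show "L2_inner M (u t) (u t) + L2_inner M (p t) (p t)
        \<le> (H1_norm (Om P) (p t))\<^sup>2 + (H1_norm (Om P) (u t))\<^sup>2"
      by (simp add: L2_norm_sq)
  qed (use assms int in \<open>auto intro!: L2L2_integrable disp_L2L2 pres_L2L2\<close>)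
  finally show ?thesis .
qed

text \<open>\<open>K\<close> collects the terms of the a priori bound that stem from the zero data. These are harmless,
  because a linear map that is bounded by an affine function of the squared norm is bounded; so there
  is no need to show that the weak time derivative chosen in \<open>bochner_H1_norm\<close> vanishes for zero data.\<close>

lemma zero_data_well_posed:
  assumes "well_posed P \<delta>" and \<eta>: "\<eta> \<in> control_profile P kind"
  obtains K C where "0 \<le> C"
    "\<And>w. w \<in> L2_space (interval (T_end P)) \<Longrightarrow>
       \<exists>u p. zero_data_solution \<delta> kind \<eta> w u p \<and>
         (\<forall>u' p'. zero_data_solution \<delta> kind \<eta> w u' p' \<longrightarrow>
            (AE t in interval (T_end P). AE x in M. u' t x = u t x \<and> p' t x = p t x)) \<and>
         L2L2_inner P u u + L2L2_inner P p p \<le> K + C * (LINT t|interval (T_end P). (w t)\<^sup>2)"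
proof -
  let ?I = "interval (T_end P)" and ?\<Gamma> = "surface (Gam_Dv P)"
  obtain C where "C > 0" and C: "\<And>u0 F S g w \<eta>.
     u0 \<in> disp_space P \<Longrightarrow> F \<in> F_space P \<delta> \<Longrightarrow> S \<in> L2L2 P \<Longrightarrow> g \<in> g_space P \<delta> \<Longrightarrow>
     w \<in> L2_space ?I \<Longrightarrow> \<eta> \<in> L2_space ?\<Gamma> \<Longrightarrow>
     \<exists>u p. weak_solution P \<delta> u0 F S g (\<lambda>t x. w t * \<eta> x) u p \<and>
        (\<forall>u' p'. weak_solution P \<delta> u0 F S g (\<lambda>t x. w t * \<eta> x) u' p' \<longrightarrow>
           (AE t in ?I. AE x in M. u' t x = u t x \<and> p' t x = p t x)) \<and>
        (LINT t|?I. (H1_norm (Om P) (p t))\<^sup>2 + (H1_norm (Om P) (u t))\<^sup>2)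
        \<le> C * ((H1_norm (Om P) u0)\<^sup>2 + (F_norm P \<delta> F)\<^sup>2 + (L2L2_norm P S)\<^sup>2 + (g_norm P \<delta> g)\<^sup>2
               + (bochner_norm (T_end P) (L2_norm ?\<Gamma>) (\<lambda>t x. w t * \<eta> x))\<^sup>2)"
    using assms(1) unfolding well_posed_def by blast
  define z where "z = (H1_norm (Om P) (\<lambda>_. 0 :: real^3))\<^sup>2 + (F_norm P \<delta> (\<lambda>_ _. 0))\<^sup>2 + (g_norm P \<delta> (\<lambda>_ _. 0))\<^sup>2"
  note C0 = C[OF disp.zero_in F_space_zero _ g_space_zero]
  show ?thesis
  proof (cases kind)
    case Source_control
    then have \<eta>L: "\<eta> \<in> L2_space M" using \<eta> by (simp add: control_profile_def)
    show ?thesis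
    proof (rule that[of "C * (L2_norm M \<eta>)\<^sup>2" "C * (z + (bochner_norm (T_end P) (L2_norm ?\<Gamma>) (\<lambda>_ _. 0 :: real))\<^sup>2)"])
      fix w :: "real \<Rightarrow> real" assume w: "w \<in> L2_space ?I"
      have wL: "(\<lambda>t x. w t * \<eta> x) \<in> L2L2 P"
        unfolding L2L2_def using L2.bochner_L2_separated[OF w \<eta>L] by simp
      have sol: "zero_data_solution \<delta> kind \<eta> w u p \<longleftrightarrow>
          weak_solution P \<delta> (\<lambda>_. 0) (\<lambda>_ _. 0) (\<lambda>t x. w t * \<eta> x) (\<lambda>_ _. 0) (\<lambda>_ _. 0) u p" for u p
        by (simp add: controlled_solution_def with_control_def Source_control)
      have norm: "(L2L2_norm P (\<lambda>t x. w t * \<eta> x))\<^sup>2 = (LINT t|?I. (w t)\<^sup>2) * (L2_norm M \<eta>)\<^sup>2"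
        unfolding L2L2_norm_def by (rule bochner_norm_separated)
      obtain u p where up: "zero_data_solution \<delta> kind \<eta> w u p"
        "\<forall>u' p'. zero_data_solution \<delta> kind \<eta> w u' p' \<longrightarrow>
            (AE t in ?I. AE x in M. u' t x = u t x \<and> p' t x = p t x)"
        "(LINT t|?I. (H1_norm (Om P) (p t))\<^sup>2 + (H1_norm (Om P) (u t))\<^sup>2)
        \<le> C * ((H1_norm (Om P) (\<lambda>_. 0 :: real^3))\<^sup>2 + (F_norm P \<delta> (\<lambda>_ _. 0))\<^sup>2
          + (LINT t|?I. (w t)\<^sup>2) * (L2_norm M \<eta>)\<^sup>2 + (g_norm P \<delta> (\<lambda>_ _. 0))\<^sup>2
          + (bochner_norm (T_end P) (L2_norm ?\<Gamma>) (\<lambda>_ _. 0 :: real))\<^sup>2)"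
        \<comment> \<open>\<open>well_posed\<close> takes the flux in product form, so zero flux is
          entered as a zero time factor times a zero profile.\<close>
        using C0[OF wL L2_space_zero L2_space_zero] unfolding sol norm mult_zero_left by blast
      have "L2L2_inner P u u + L2L2_inner P p p
          \<le> C * (z + (bochner_norm (T_end P) (L2_norm ?\<Gamma>) (\<lambda>_ _. 0 :: real))\<^sup>2)
            + C * (L2_norm M \<eta>)\<^sup>2 * (LINT t|?I. (w t)\<^sup>2)"
        using L2L2_norm_le_H1[of u p] up(1,3) unfolding zero_data_solution_iff
        by (simp add: z_def algebra_simps)
      with up(1,2) show "\<exists>u p. zero_data_solution \<delta> kind \<eta> w u p \<and>
         (\<forall>u' p'. zero_data_solution \<delta> kind \<eta> w u' p' \<longrightarrow>
            (AE t in ?I. AE x in M. u' t x = u t x \<and> p' t x = p t x)) \<and>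
         L2L2_inner P u u + L2L2_inner P p p
          \<le> C * (z + (bochner_norm (T_end P) (L2_norm ?\<Gamma>) (\<lambda>_ _. 0 :: real))\<^sup>2)
            + C * (L2_norm M \<eta>)\<^sup>2 * (LINT t|?I. (w t)\<^sup>2)"
        by blast
    qed (use \<open>C > 0\<close> in simp)
  next
    case Flux_control
    then have \<eta>L: "\<eta> \<in> L2_space ?\<Gamma>" using \<eta> by (simp add: control_profile_def)
    show ?thesis
    proof (rule that[of "C * (L2_norm ?\<Gamma> \<eta>)\<^sup>2" "C * (z + (L2L2_norm P (\<lambda>_ _. 0 :: real))\<^sup>2)"])
      fix w :: "real \<Rightarrow> real" assume w: "w \<in> L2_space ?I"
      have sol: "zero_data_solution \<delta> kind \<eta> w u p \<longleftrightarrow>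
          weak_solution P \<delta> (\<lambda>_. 0) (\<lambda>_ _. 0) (\<lambda>_ _. 0) (\<lambda>_ _. 0) (\<lambda>t x. w t * \<eta> x) u p" for u p
        by (simp add: controlled_solution_def with_control_def Flux_control)
      obtain u p where up: "zero_data_solution \<delta> kind \<eta> w u p"
        "\<forall>u' p'. zero_data_solution \<delta> kind \<eta> w u' p' \<longrightarrow>
            (AE t in ?I. AE x in M. u' t x = u t x \<and> p' t x = p t x)"
        "(LINT t|?I. (H1_norm (Om P) (p t))\<^sup>2 + (H1_norm (Om P) (u t))\<^sup>2)
        \<le> C * ((H1_norm (Om P) (\<lambda>_. 0 :: real^3))\<^sup>2 + (F_norm P \<delta> (\<lambda>_ _. 0))\<^sup>2
          + (L2L2_norm P (\<lambda>_ _. 0 :: real))\<^sup>2 + (g_norm P \<delta> (\<lambda>_ _. 0))\<^sup>2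
          + (LINT t|?I. (w t)\<^sup>2) * (L2_norm ?\<Gamma> \<eta>)\<^sup>2)"
        using C0[OF L2L2_zero w \<eta>L] unfolding sol bochner_norm_separated by blast
      have "L2L2_inner P u u + L2L2_inner P p p
          \<le> C * (z + (L2L2_norm P (\<lambda>_ _. 0 :: real))\<^sup>2)
            + C * (L2_norm ?\<Gamma> \<eta>)\<^sup>2 * (LINT t|?I. (w t)\<^sup>2)"
        using L2L2_norm_le_H1[of u p] up(1,3) unfolding zero_data_solution_iff
        by (simp add: z_def algebra_simps)
      with up(1,2) show "\<exists>u p. zero_data_solution \<delta> kind \<eta> w u p \<and>
         (\<forall>u' p'. zero_data_solution \<delta> kind \<eta> w u' p' \<longrightarrow>
            (AE t in ?I. AE x in M. u' t x = u t x \<and> p' t x = p t x)) \<and>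
         L2L2_inner P u u + L2L2_inner P p p
          \<le> C * (z + (L2L2_norm P (\<lambda>_ _. 0 :: real))\<^sup>2)
            + C * (L2_norm ?\<Gamma> \<eta>)\<^sup>2 * (LINT t|?I. (w t)\<^sup>2)"
        by blast
    qed (use \<open>C > 0\<close> in simp)
  qed
qed

end

locale control_problem = poro_problem +
  fixes \<delta> :: real and kind :: control_kind and \<eta> :: "real^3 \<Rightarrow> real"
  assumes \<delta>: "0 \<le> \<delta>" and well_posed: "well_posed P \<delta>" and profile: "\<eta> \<in> control_profile P kind"
begin

abbreviation "G \<equiv> solution_op P \<delta> kind \<eta>"

text \<open>The equations see a control only through its restriction to (0,T), so existence,
  uniqueness and the bound hold for every element of \<open>l2real\<close>. Hence \<open>j\<close>
  is a quadratic functional on the whole type, and its derivatives on \<open>control_space\<close>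
  are obtained by restriction.\<close>

lemma zero_data_problem:
  obtains K C where "0 \<le> C"
    "\<forall>w. \<exists>u p. zero_data_solution \<delta> kind \<eta> (rep_l2real w) u p \<and>
       (\<forall>u' p'. zero_data_solution \<delta> kind \<eta> (rep_l2real w) u' p' \<longrightarrow>
          (AE t in interval (T_end P). AE x in M. u' t x = u t x \<and> p' t x = p t x)) \<and>
       L2L2_inner P u u + L2L2_inner P p p \<le> K + C * (norm w)\<^sup>2"
proof (rule zero_data_well_posed[OF well_posed profile])
  fix K C
  assume "0 \<le> C" and KC: "\<And>w. w \<in> L2_space (interval (T_end P)) \<Longrightarrow>
       \<exists>u p. zero_data_solution \<delta> kind \<eta> w u p \<and>
         (\<forall>u' p'. zero_data_solution \<delta> kind \<eta> w u' p' \<longrightarrow>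
            (AE t in interval (T_end P). AE x in M. u' t x = u t x \<and> p' t x = p t x)) \<and>
         L2L2_inner P u u + L2L2_inner P p p \<le> K + C * (LINT t|interval (T_end P). (w t)\<^sup>2)"
  have le: "K + C * (LINT t|interval (T_end P). (rep_l2real w t)\<^sup>2) \<le> K + C * (norm w)\<^sup>2" for w
    using L2_space_interval(2)[OF rep_l2real_L2, of "T_end P" w] \<open>0 \<le> C\<close>
    by (intro add_left_mono mult_left_mono) (simp_all add: power2_norm_eq_inner inner_l2real.rep_eq)
  show thesis
  proof (rule that[OF \<open>0 \<le> C\<close>], rule allI)
    fix w
    from KC[OF L2_space_interval(1)[OF rep_l2real_L2]] le[of w]
    show "\<exists>u p. zero_data_solution \<delta> kind \<eta> (rep_l2real w) u p \<and>
       (\<forall>u' p'. zero_data_solution \<delta> kind \<eta> (rep_l2real w) u' p' \<longrightarrow>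
          (AE t in interval (T_end P). AE x in M. u' t x = u t x \<and> p' t x = p t x)) \<and>
       L2L2_inner P u u + L2L2_inner P p p \<le> K + C * (norm w)\<^sup>2"
      by (blast intro: order_trans)
  qed
qed

lemma solution_op_solves:
  "zero_data_solution \<delta> kind \<eta> (rep_l2real w) (fst (G w)) (snd (G w))"
proof -
  obtain u p where "zero_data_solution \<delta> kind \<eta> (rep_l2real w) u p"
    by (rule zero_data_problem) blast
  then have "\<exists>y. case y of (u, p) \<Rightarrow> zero_data_solution \<delta> kind \<eta> (rep_l2real w) u p"
    by auto
  from someI_ex[OF this] show ?thesis
    unfolding solution_op_def by (simp add: case_prod_unfold)
qed

lemma solution_unique:
  assumes "zero_data_solution \<delta> kind \<eta> (rep_l2real w) u p"
    "zero_data_solution \<delta> kind \<eta> (rep_l2real w) u' p'"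
  shows "AE t in interval (T_end P). AE x in M. u t x = u' t x \<and> p t x = p' t x"
proof -
  obtain v q where vq: "\<And>u' p'. zero_data_solution \<delta> kind \<eta> (rep_l2real w) u' p' \<Longrightarrow>
      (AE t in interval (T_end P). AE x in M. u' t x = v t x \<and> p' t x = q t x)"
    by (rule zero_data_problem) blast
  from vq[OF assms(1)] vq[OF assms(2)] show ?thesis
  proof eventually_elim
    case (elim t)
    from elim show ?case by eventually_elim simp
  qed
qed

lemma solution_in_state_space:
  "zero_data_solution \<delta> kind \<eta> w u p \<Longrightarrow> (u, p) \<in> state_space P"
  using controlled_solution_L2L2 by (auto simp: state_space_def)

lemma G_in: "G w \<in> state_space P"
  using solution_in_state_space[OF solution_op_solves] by simp

text \<open>\<open>G\<close> returns selected representatives, so the solution for a combined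
  control and the combined solutions may differ as functions. By superposition and uniqueness they
  agree a.e., and no pairing with a state \<open>r\<close> can tell them apart.\<close>

lemma G_lincomb:
  assumes r: "r \<in> state_space P"
  shows "state_inner P (G (a *\<^sub>R v + b *\<^sub>R w)) r
     = a * state_inner P (G v) r + b * state_inner P (G w) r"
proof -
  let ?y = "state_lincomb a (G v) b (G w)"
  have "zero_data_solution \<delta> kind \<eta> (rep_l2real (a *\<^sub>R v + b *\<^sub>R w)) (fst ?y) (snd ?y)"
    unfolding state_lincomb_def fst_conv snd_conv
    by (intro zero_data_solution_lincomb[OF solution_op_solves solution_op_solves _ \<delta>]
        AE_lebesgue_imp_interval rep_l2real_lincomb)
  from solution_unique[OF solution_op_solves this]
  have "state_inner P (G (a *\<^sub>R v + b *\<^sub>R w)) r = state_inner P ?y r"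
    by (intro state_inner_cong G_in state_lincomb_in r)
  also have "\<dots> = a * state_inner P (G v) r + b * state_inner P (G w) r"
    by (intro state_inner_lincomb G_in r)
  finally show ?thesis .
qed

text \<open>The a priori bound is available for some solution; uniqueness transfers it to the one
  that \<open>G\<close> selects.\<close>

lemma G_quadratic_bound:
  obtains K C where "0 \<le> C" "\<And>w. state_inner P (G w) (G w) \<le> K + C * (norm w)\<^sup>2"
proof -
  obtain K C where "0 \<le> C" and KC: "\<forall>w. \<exists>u p. zero_data_solution \<delta> kind \<eta> (rep_l2real w) u p \<and>
       (\<forall>u' p'. zero_data_solution \<delta> kind \<eta> (rep_l2real w) u' p' \<longrightarrow>
          (AE t in interval (T_end P). AE x in M. u' t x = u t x \<and> p' t x = p t x)) \<and>
       L2L2_inner P u u + L2L2_inner P p p \<le> K + C * (norm w)\<^sup>2"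
    by (rule zero_data_problem)
  have "state_inner P (G w) (G w) \<le> K + C * (norm w)\<^sup>2" for w
  proof -
    obtain u p where up: "zero_data_solution \<delta> kind \<eta> (rep_l2real w) u p"
      "L2L2_inner P u u + L2L2_inner P p p \<le> K + C * (norm w)\<^sup>2"
      using KC by blast
    have "AE t in interval (T_end P). AE x in M. fst (G w) t x = fst (u, p) t x \<and> snd (G w) t x = snd (u, p) t x"
      using solution_unique[OF solution_op_solves up(1)] by simp
    then have eq: "state_inner P (G w) r = state_inner P (u, p) r" if "r \<in> state_space P" for r
      by (intro state_inner_cong G_in solution_in_state_space[OF up(1)] that)
    \<comment> \<open>The exchange is possible in the first argument, so it is made twice with the
      symmetry of the form in between.\<close>
    have "state_inner P (G w) (G w) = state_inner P (u, p) (u, p)"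
      using eq[OF G_in, of w] eq[OF solution_in_state_space[OF up(1)]] state_inner_commute[of P "(u, p)" "G w"]
      by simp
    also have "\<dots> = L2L2_inner P u u + L2L2_inner P p p"
      by (simp add: state_inner_def)
    also have "\<dots> \<le> K + C * (norm w)\<^sup>2"
      by (rule up(2))
    finally show ?thesis .
  qed
  with \<open>0 \<le> C\<close> show ?thesis by (rule that)
qed

end

section \<open>Quadratic functionals\<close>

text \<open>On unit vectors the bound is the constant K + C, and homogeneity spreads it to all
  vectors; an additive constant in a quadratic bound therefore costs nothing.\<close>

lemma bounded_linear_if_affine_bound:
  fixes f :: "'a::real_normed_vector \<Rightarrow> real"
  assumes lin: "linear f" and le: "\<And>x. \<bar>f x\<bar> \<le> K + C * (norm x)\<^sup>2"
  shows "bounded_linear f"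
proof -
  have "norm (f x) \<le> norm x * (K + C)" for x
  proof (cases "x = 0")
    case False
    have "f ((1 / norm x) *\<^sub>R x) = (1 / norm x) * f x"
      by (simp add: linear_scale[OF lin] real_scaleR_def[symmetric] del: real_scaleR_def)
    then have "\<bar>f x\<bar> / norm x \<le> K + C"
      using le[of "(1 / norm x) *\<^sub>R x"] False by (simp add: abs_mult)
    then show ?thesis
      using False by (simp add: divide_le_eq mult.commute)
  qed (simp add: linear_0[OF lin])
  then show ?thesis
    using lin by (auto simp: bounded_linear_def bounded_linear_axioms_def)
qed

text \<open>Both arguments are scaled to unit length, where the bound becomes K + 2 C. This also
  turns an additive estimate into one by the product of the norms.\<close>

lemma bounded_bilinear_if_affine_bound:
  fixes B :: "'a::real_normed_vector \<Rightarrow> 'a \<Rightarrow> real"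
  assumes lin: "\<And>y. linear (\<lambda>x. B x y)" "\<And>x. linear (B x)"
    and le: "\<And>x y. \<bar>B x y\<bar> \<le> K + C * ((norm x)\<^sup>2 + (norm y)\<^sup>2)"
  shows "bounded_bilinear B"
proof -
  have "norm (B x y) \<le> norm x * norm y * (K + 2 * C)" for x y
  proof (cases "x = 0 \<or> y = 0")
    case True
    then show ?thesis
      using linear_0[OF lin(1)] linear_0[OF lin(2)] by auto
  next
    case False
    let ?x = "(1 / norm x) *\<^sub>R x" and ?y = "(1 / norm y) *\<^sub>R y"
    have "B ?x ?y = B x y / (norm x * norm y)"
      using linear_scale[OF lin(1), of "1 / norm x" x ?y] linear_scale[OF lin(2), of x "1 / norm y" y]
      by simp
    then have "\<bar>B x y\<bar> / (norm x * norm y) \<le> K + 2 * C"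
      using le[of ?x ?y] False by (simp add: abs_mult)
    then show ?thesis
      using False by (simp add: divide_le_eq mult.commute)
  qed
  then show ?thesis
    using linear_add[OF lin(1)] linear_add[OF lin(2)] linear_scale[OF lin(1)] linear_scale[OF lin(2)]
    by (intro bounded_bilinear.intro exI[of _ "K + 2 * C"] allI) simp_all
qed

text \<open>The first derivative at w is Q(w, .) + l, which is affine in w, so the second derivative
  is the same form at every point. The formulas hold on the whole type, hence relative to any
  \<open>H\<close>.\<close>

lemma quadratic_twice_cont_diff_on:
  fixes Q :: "'h::real_normed_vector \<Rightarrow> 'h \<Rightarrow> real"
  assumes Q: "bounded_bilinear Q" and sym: "\<And>x y. Q x y = Q y x" and l: "bounded_linear l"
  obtains j' j'' where
    "twice_cont_diff_on H (\<lambda>w. Q w w / 2 + l w + c) j' j''"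
    "\<forall>w x y. blinfun_apply (blinfun_apply (j'' w) x) y = Q x y"
proof -
  interpret Q: bounded_bilinear Q by fact
  obtain K where K: "0 \<le> K" "\<And>x y. \<bar>Q x y\<bar> \<le> norm x * norm y * K"
    using Q.nonneg_bounded by auto
  have ap: "blinfun_apply (Blinfun (Q x)) = Q x" for x
    by (intro bounded_linear_Blinfun_apply Q.bounded_linear_right)
  have apl: "blinfun_apply (Blinfun l) = l"
    using l by (rule bounded_linear_Blinfun_apply)
  have lin: "bounded_linear (\<lambda>x. Blinfun (Q x))"
  proof (rule bounded_linear_intro)
    show "Blinfun (Q (x + y)) = Blinfun (Q x) + Blinfun (Q y)" for x y
      by (rule blinfun_eqI) (simp add: ap blinfun.add_left Q.add_left)
    show "Blinfun (Q (r *\<^sub>R x)) = r *\<^sub>R Blinfun (Q x)" for r x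
      by (rule blinfun_eqI) (simp add: ap blinfun.scaleR_left Q.scaleR_left)
    show "norm (Blinfun (Q x)) \<le> norm x * K" for x
    proof (rule norm_blinfun_bound)
      show "norm (blinfun_apply (Blinfun (Q x)) y) \<le> norm x * K * norm y" for y
        using K(2)[of x y] by (simp add: ap mult_ac)
    qed (use K(1) in simp)
  qed
  define j' where "j' w = Blinfun (Q w) + Blinfun l" for w
  define j'' where "j'' w = Blinfun (\<lambda>x. Blinfun (Q x))" for w :: 'h
  have ap2: "blinfun_apply (j'' w) = (\<lambda>x. Blinfun (Q x))" for w
    unfolding j''_def by (rule bounded_linear_Blinfun_apply[OF lin])
  show ?thesis
  proof
    show "\<forall>w x y. blinfun_apply (blinfun_apply (j'' w) x) y = Q x y"
      by (simp add: ap2 ap)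
    have "((\<lambda>w. Q w w / 2 + l w + c) has_derivative (\<lambda>h. (Q w h + Q h w) / 2 + l h + 0)) (at w within H)" for w
      by (intro has_derivative_add has_derivative_const bounded_linear.has_derivative[OF l]
          bounded_linear.has_derivative[OF bounded_linear_divide] Q.FDERIV has_derivative_ident)
    \<comment> \<open>Symmetry of \<open>Q\<close> merges the two halves that the product rule
      produces.\<close>
    moreover have "(\<lambda>h. (Q w h + Q h w) / 2 + l h + 0) = blinfun_apply (j' w)" for w
      using sym[of _ w] by (auto simp: j'_def blinfun.add_left ap apl)
    ultimately have "((\<lambda>w. Q w w / 2 + l w + c) has_derivative blinfun_apply (j' w)) (at w within H)" for w
      by simp
    moreover have "(j' has_derivative blinfun_apply (j'' w)) (at w within H)" for w
    proof -
      have "(j' has_derivative (\<lambda>x. Blinfun (Q x) + 0)) (at w within H)"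
        unfolding j'_def[abs_def]
        by (intro has_derivative_add has_derivative_const bounded_linear.has_derivative[OF lin] has_derivative_ident)
      then show ?thesis by (simp add: ap2)
    qed
    moreover have "continuous_on H j''"
      unfolding j''_def[abs_def] by (rule continuous_on_const)
    ultimately show "twice_cont_diff_on H (\<lambda>w. Q w w / 2 + l w + c) j' j''"
      by (simp add: twice_cont_diff_on_def)
  qed
qed

section \<open>Pulses\<close>

definition pulse :: "real \<Rightarrow> l2real" where
  "pulse h = abs_l2real (indicator {0<..<h})"

lemma pulse:
  assumes "0 < h" "h \<le> T"
  shows "pulse h \<in> control_space T" "(norm (pulse h))\<^sup>2 = h" "L1_norm T (pulse h) = h"
proof -
  let ?i = "indicator {0<..<h} :: real \<Rightarrow> real"
  have int: "integrable lebesgue ?i"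
    using assms by (simp add: integrable_indicator_iff emeasure_lborel_Ioo)
  \<comment> \<open>An indicator equals its square, so the squared norm and the
    \<open>L1_norm\<close> reduce to the same integral \<open>h\<close>.\<close>
  have sq: "(\<lambda>t. (?i t)\<^sup>2) = ?i"
    by (auto simp: indicator_def)
  have i: "?i \<in> L2_space lebesgue"
    using int by (auto simp: L2_space_def sq)
  note rep = rep_abs_l2real[OF i, folded pulse_def]
  have val: "(LINT t|lebesgue. ?i t) = h"
    using assms by simp
  show "pulse h \<in> control_space T"
    unfolding control_space_def mem_Collect_eq
    using rep by eventually_elim (use assms in \<open>auto simp: indicator_def\<close>)
  have "(norm (pulse h))\<^sup>2 = L2_inner lebesgue (rep_l2real (pulse h)) (rep_l2real (pulse h))"
    by (simp add: power2_norm_eq_inner inner_l2real.rep_eq)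
  also have "\<dots> = L2_inner lebesgue ?i ?i"
    by (intro L2_inner_cong_AE rep_l2real_L2 i rep)
  also have "\<dots> = h"
    using val sq by (simp add: L2_inner_def power2_eq_square)
  finally show "(norm (pulse h))\<^sup>2 = h" .
  have "L1_norm T (pulse h) = (LINT t|interval T. ?i t)"
    unfolding L1_norm_def
  proof (rule integral_cong_AE)
    show "AE t in interval T. \<bar>rep_l2real (pulse h) t\<bar> = ?i t"
      using AE_lebesgue_imp_interval[OF rep] by eventually_elim simp
    show "(\<lambda>t. \<bar>rep_l2real (pulse h) t\<bar>) \<in> borel_measurable (interval T)"
      by (intro borel_measurable_abs L2_space_measurable L2_space_interval(1) rep_l2real_L2)
    show "?i \<in> borel_measurable (interval T)"
      using L2_space_interval(1)[OF i] by (rule L2_space_measurable)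
  qed
  also have "\<dots> = (LINT t|lebesgue. indicator {0<..<T} t * ?i t)"
    by (subst integral_restrict_space) auto
  also have "(\<lambda>t. indicator {0<..<T} t * ?i t) = ?i"
    using assms by (auto simp: indicator_def)
  finally show "L1_norm T (pulse h) = h" using val by simp
qed

theorem proposition5p4:
  fixes P :: poro and \<delta> lam :: real and kind :: control_kind
    and \<eta> \<eta>0 :: "real^3 \<Rightarrow> real" and u0 :: "real^3 \<Rightarrow> real^3" and \<omega> :: "real \<Rightarrow> real"
    and F g u_tilde u_d :: "real \<Rightarrow> real^3 \<Rightarrow> real^3"
    and S p_tilde p_d :: "real \<Rightarrow> real^3 \<Rightarrow> real"
  assumes setting: "poro_setting P" and "0 \<le> \<delta>" and "0 \<le> lam"
    and well_posed: "well_posed P \<delta>"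
    and profile: "\<eta> \<in> control_profile P kind"
    and data: "u0 \<in> disp_space P" "F \<in> F_space P \<delta>" "g \<in> g_space P \<delta>" "S \<in> L2L2 P"
      "\<omega> \<in> L2_space (interval (T_end P))" "\<eta>0 \<in> L2_space (surface (Gam_Dv P))"
    and tilde: "controlled_solution P \<delta> kind \<eta> (\<lambda>_. 0) u0 F S g (\<lambda>t x. \<omega> t * \<eta>0 x) u_tilde p_tilde"
    and targets: "u_d \<in> L2L2 P" "p_d \<in> L2L2 P"
  defines "L2T \<equiv> control_space (T_end P)"
    and "G \<equiv> solution_op P \<delta> kind \<eta>"
    and "j \<equiv> reduced_objective P \<delta> lam kind \<eta> u_tilde p_tilde u_d p_d"
  shows "\<exists>j' j''. twice_cont_diff_on L2T j j' j'' \<and>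
     (\<forall>w\<in>L2T. \<forall>\<xi>\<in>L2T. \<forall>\<phi>\<in>L2T.
        \<bar>j'' w \<xi> \<phi>\<bar> = \<bar>state_inner P (G \<xi>) (G \<phi>) + lam * (\<xi> \<bullet> \<phi>)\<bar>) \<and>
     (\<exists>C>0. \<forall>w\<in>L2T. \<forall>\<xi>\<in>L2T. \<forall>\<phi>\<in>L2T. \<bar>j'' w \<xi> \<phi>\<bar> \<le> C * norm \<xi> * norm \<phi>) \<and>
     (lam > 0 \<longrightarrow>
        \<not> (\<exists>C>0. \<forall>w\<in>L2T. \<forall>\<psi>\<in>L2T. \<forall>\<phi>\<in>L2T.
             \<bar>j'' w \<psi> \<phi>\<bar> \<le> C * L1_norm (T_end P) \<psi> * L1_norm (T_end P) \<phi>))"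
proof -
  interpret control_problem P \<delta> kind \<eta>
    by unfold_locales fact+
  have T: "0 < T_end P" using setting by (simp add: poro_setting_def)
  \<comment> \<open>\<open>r\<close> is the part of the tracking error that does not depend on the
    control, so the error is G w + r. Expanding its square and adding the regularisation yields the
    quadratic part \<open>Q\<close>, the linear part \<open>l\<close> and the constant
    \<open>c\<close>.\<close>
  define r where "r = state_lincomb 1 (u_tilde, p_tilde) (-1) (u_d, p_d)"
  have r: "r \<in> state_space P"
    unfolding r_def using controlled_solution_L2L2[OF tilde] targets
    by (intro state_lincomb_in) (auto simp: state_space_def)
  define Q where "Q x y = state_inner P (G x) (G y) + lam * (x \<bullet> y)" for x y
  define l where "l w = state_inner P (G w) r" for w
  define c where "c = state_inner P r r / 2"
  obtain K C where "0 \<le> C" and KC: "\<And>w. state_inner P (G w) (G w) \<le> K + C * (norm w)\<^sup>2"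
    using G_quadratic_bound unfolding G_def by blast
  note G_in = G_in[folded G_def] and G_lin = G_lincomb[folded G_def]
  have lin: "linear (\<lambda>w. state_inner P (G w) s)" if "s \<in> state_space P" for s
    using G_lin[OF that, of 1 _ 1] G_lin[OF that, of _ _ 0] by (intro linearI) simp_all
  have sym: "Q x y = Q y x" for x y
    by (simp add: Q_def inner_commute state_inner_commute[of P "G x"])
  have "linear (\<lambda>x. Q x y)" for y
    unfolding Q_def using linear_add[OF lin[OF G_in]] linear_scale[OF lin[OF G_in]]
    by (intro linearI) (simp_all add: inner_add_left algebra_simps)
  moreover from this have "linear (Q x)" for x
  proof -
    have "Q x = (\<lambda>y. Q y x)"
      by (rule ext) (rule sym)
    with \<open>linear (\<lambda>y. Q y x)\<close> show ?thesis by simp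
  qed
  \<comment> \<open>Averaging the bounds for G x and G y gives K and C/2; estimating the inner
    product of x and y by half the sum of their squared norms adds lam/2.\<close>
  moreover have "\<bar>Q x y\<bar> \<le> K + (C / 2 + lam / 2) * ((norm x)\<^sup>2 + (norm y)\<^sup>2)" for x y
  proof -
    have "\<bar>state_inner P (G x) (G y)\<bar> \<le> K + C / 2 * ((norm x)\<^sup>2 + (norm y)\<^sup>2)"
      using abs_state_inner_le[OF G_in G_in, of x y] KC[of x] KC[of y] by (simp add: algebra_simps)
    moreover have "\<bar>x \<bullet> y\<bar> \<le> ((norm x)\<^sup>2 + (norm y)\<^sup>2) / 2"
      using Cauchy_Schwarz_ineq2[of x y] sum_squares_bound[of "norm x" "norm y"] by simp
    then have "\<bar>lam * (x \<bullet> y)\<bar> \<le> lam * (((norm x)\<^sup>2 + (norm y)\<^sup>2) / 2)"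
      unfolding abs_mult abs_of_nonneg[OF \<open>0 \<le> lam\<close>] using \<open>0 \<le> lam\<close> by (rule mult_left_mono)
    ultimately show ?thesis
      unfolding Q_def by (simp add: algebra_simps)
  qed
  ultimately have Q: "bounded_bilinear Q"
    by (rule bounded_bilinear_if_affine_bound)
  \<comment> \<open>Averaging the bound for G w with the squared seminorm of \<open>r\<close>, half
    of which is exactly \<open>c\<close>.\<close>
  have "\<bar>l w\<bar> \<le> (K / 2 + c) + C / 2 * (norm w)\<^sup>2" for w
    unfolding l_def c_def using abs_state_inner_le[OF G_in r, of w] KC[of w] by (simp add: algebra_simps)
  with lin[OF r] have l: "bounded_linear l"
    unfolding l_def[abs_def] by (rule bounded_linear_if_affine_bound)
  have j: "j w = Q w w / 2 + l w + c" for w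
  proof -
    have "j w = state_inner P (state_lincomb 1 (G w) 1 r) (state_lincomb 1 (G w) 1 r) / 2 + lam / 2 * (norm w)\<^sup>2"
    proof -
      let ?y = "state_lincomb 1 (G w) 1 r"
      have y: "fst ?y = (\<lambda>t x. fst (G w) t x + u_tilde t x - u_d t x)"
        "snd ?y = (\<lambda>t x. snd (G w) t x + p_tilde t x - p_d t x)"
        by (simp_all add: state_lincomb_def r_def fun_eq_iff)
      have "j w = 1/2 * (L2L2_norm P (fst ?y))\<^sup>2 + 1/2 * (L2L2_norm P (snd ?y))\<^sup>2 + lam/2 * (norm w)\<^sup>2"
        unfolding y unfolding j_def reduced_objective_def G_def by (simp only: Let_def case_prod_beta)
      then show ?thesis by (simp add: state_inner_def L2L2_norm_sq)
    qed
    also have "\<dots> = Q w w / 2 + l w + c"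
      unfolding state_inner_lincomb_sq[OF G_in r]
      by (simp add: Q_def l_def c_def power2_norm_eq_inner field_simps)
    finally show ?thesis .
  qed
  obtain j' j'' where j': "twice_cont_diff_on L2T (\<lambda>w. Q w w / 2 + l w + c) j' j''"
    and j'': "\<forall>w x y. blinfun_apply (blinfun_apply (j'' w) x) y = Q x y"
    by (rule quadratic_twice_cont_diff_on[OF Q sym l])
  obtain B where B: "B > 0" "\<And>x y. \<bar>Q x y\<bar> \<le> norm x * norm y * B"
    using bounded_bilinear.pos_bounded[OF Q] by auto
  have no_L1_bound: False
    if "lam > 0" "C > 0" and L1: "\<And>x y. x \<in> L2T \<Longrightarrow> y \<in> L2T \<Longrightarrow>
      \<bar>Q x y\<bar> \<le> C * L1_norm (T_end P) x * L1_norm (T_end P) y" for C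
  proof -
    \<comment> \<open>The pulse has to fit into (0,T). The supposed bound gives
      \<open>lam \<le> C * h\<close> after division by \<open>h\<close>, and the second term of the
      minimum makes \<open>C * h\<close> at most lam/2.\<close>
    define h where "h = min (T_end P) (lam / (2 * C))"
    have h: "0 < h" "h \<le> T_end P" "h \<le> lam / (2 * C)"
      using T that by (auto simp: h_def)
    note e = pulse[OF h(1,2)]
    \<comment> \<open>The state part of \<open>Q\<close> is nonnegative on the diagonal, so the
      regularisation alone bounds it from below.\<close>
    have "lam * h \<le> Q (pulse h) (pulse h)"
      using state_inner_nonneg[of P "G (pulse h)"] e(2) by (simp add: Q_def flip: power2_norm_eq_inner)
    also have "\<dots> \<le> C * h * h"
      using L1[of "pulse h" "pulse h"] e by (simp add: L2T_def)
    finally have "lam \<le> C * h" using h(1) by simp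
    also have "\<dots> \<le> lam / 2" using h(3) that(2) by (simp add: field_simps)
    finally show False using that(1) by simp
  qed
  show ?thesis
  proof (intro exI[of _ j'] exI[of _ j''] conjI)
    show "twice_cont_diff_on L2T j j' j''"
      using j' by (simp add: j[abs_def])
    show "\<forall>w\<in>L2T. \<forall>\<xi>\<in>L2T. \<forall>\<phi>\<in>L2T. \<bar>j'' w \<xi> \<phi>\<bar> = \<bar>state_inner P (G \<xi>) (G \<phi>) + lam * (\<xi> \<bullet> \<phi>)\<bar>"
      by (simp add: j'' Q_def)
    show "\<exists>C>0. \<forall>w\<in>L2T. \<forall>\<xi>\<in>L2T. \<forall>\<phi>\<in>L2T. \<bar>j'' w \<xi> \<phi>\<bar> \<le> C * norm \<xi> * norm \<phi>"
      using B by (auto simp: j'' mult_ac intro!: exI[of _ B])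
    show "lam > 0 \<longrightarrow>
        \<not> (\<exists>C>0. \<forall>w\<in>L2T. \<forall>\<psi>\<in>L2T. \<forall>\<phi>\<in>L2T.
             \<bar>j'' w \<psi> \<phi>\<bar> \<le> C * L1_norm (T_end P) \<psi> * L1_norm (T_end P) \<phi>)"
      using no_L1_bound unfolding j''[rule_format] by blast
  qed
qed

end
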